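(* For each relaxation degree $r$, let $\mathbf{y}^{(r)}_{\mathbf{a}_{\mathrm{s}}^1}$ be the optimal first-order moments associated with an optimal solution of the $r$-th relaxation of the scaled problem (S), and set $\tilde{a}_e=\frac{y^{(r)}_{a_{\mathrm{s},e}^1}+1}{2}\frac{\overline{w}}{\rho_e\ell_e}$ for $e\in\{1,\dots,n_{\mathrm{e}}\}$. Suppose that $\inf_{\delta>0}c_j(\delta\tilde{\mathbf{a}})<\overline{c}_j$ for all $j\in\{1,\dots,n_{\mathrm{lc}}\}$, that the weight minimization problem (P) is solvable, and let $\delta^*\tilde{\mathbf{a}}$, with $\delta^*$ a solution of the univariate problem $(\mathrm{U}_{\tilde{\mathbf{a}}})$, be the resulting feasible (upper-bound) solution to (P) (so $\tilde{\mathbf{a}}$ and $\delta^*$ depend on $r$). If the set of global minimizers is convex, then $$\lim_{r\to\infty}(\delta^*-1)\,0.5\,\overline{w}\,\bigl(n_{\mathrm{e}}+\mathbf{1}^{\mathrm{T}}\mathbf{y}^{(r)}_{\mathbf{a}_{\mathrm{s}}^1}\bigr)=0.$$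
   Context: Let $n_{\mathrm{e}}, n_{\mathrm{lc}}$ be positive integers and, for each $j\in\{1,\dots,n_{\mathrm{lc}}\}$, let $n_{\mathrm{dof},j}$ be a positive integer, $\mathbf{0}\neq\mathbf{f}_j\in\mathbb{R}^{n_{\mathrm{dof},j}}$ and $\overline{c}_j>0$. Let $\rho_e,\ell_e>0$ for $e\in\{1,\dots,n_{\mathrm{e}}\}$. For $\mathbf{a}\in\mathbb{R}^{n_{\mathrm{e}}}_{\ge 0}$ the stiffness matrix is $$\mathbf{K}_j(\mathbf{a})=\mathbf{K}_{j,0}+\sum_{e=1}^{n_{\mathrm{e}}}\sum_{i=1}^{3}\mathbf{K}^{(i)}_{j,e}a_e^i,$$ where $\mathbf{K}_{j,0}$ and $\mathbf{K}^{(i)}_{j,e}$ are fixed real symmetric positive semidefinite $n_{\mathrm{dof},j}\times n_{\mathrm{dof},j}$ matrices. Standing assumption: $\mathbf{K}_j(\mathbf{a})\succ 0$ for all $\mathbf{a}>\mathbf{0}$ (componentwise) and all $j$. The compliance is $c_j(\mathbf{a})=\mathbf{f}_j^{\mathrm{T}}\mathbf{K}_j(\mathbf{a})^{\dagger}\mathbf{f}_j$ ($\dagger$ is the Moore-Penrose pseudo-inverse), defined for $\mathbf{a}\ge\mathbf{0}$ with $\mathbf{f}_j\in\mathrm{Im}(\mathbf{K}_j(\mathbf{a}))$. Weight minimization problem: $$\text{(P)}\quad \min_{\mathbf{a},\mathbf{u}}\ \sum_{e=1}^{n_{\mathrm{e}}}\rho_e\ell_e a_e\quad\text{s.t.}\quad\mathbf{K}_j(\mathbf{a})\mathbf{u}_j=\mathbf{f}_j,\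 \ \overline{c}_j-\mathbf{f}_j^{\mathrm{T}}\mathbf{u}_j\ge 0\ \ \forall j,\quad \mathbf{a}\ge\mathbf{0}.$$ A vector $\mathbf{a}$ is called feasible for (P) if it is feasible together with some $\mathbf{u}_1,\dots,\mathbf{u}_{n_{\mathrm{lc}}}$; equivalently, $\mathbf{a}\ge\mathbf{0}$ and $\begin{pmatrix}\overline{c}_j&-\mathbf{f}_j^{\mathrm{T}}\\-\mathbf{f}_j&\mathbf{K}_j(\mathbf{a})\end{pmatrix}\succeq 0$ for all $j$. The set of global minimizers is the set of optimal design vectors $\mathbf{a}$ (equivalently, up to the affine scaling below, the set of optimal $\mathbf{a}_{\mathrm{s}}$ of (S)). Univariate problem: for $\hat{\mathbf{a}}\ge\mathbf{0}$ with $\mathbf{f}_j\in\mathrm{Im}(\mathbf{K}_j(\hat{\mathbf{a}}))$ for all $j$, $$(\mathrm{U}_{\hat{\mathbf{a}}})\quad\min_{\delta}\ \delta\quad\text{s.t.}\quad\mathbf{f}_j^{\mathrm{T}}\mathbf{K}_j(\delta\hat{\mathbf{a}})^{\dagger}\mathbf{f}_j\le\overline{c}_j\ \ \forall j,\quad\delta>0.$$ Scaled problem: fix any $\hat{\mathbf{a}}>\mathbf{0}$, let $\hat\delta$ be a solution of $(\mathrm{U}_{\hat{\mathbf{a}}})$ and put $\overline{w}=\hat\delta\sum_e\rho_e\ell_e\hat a_e$ (an upper bound on the optimal weight). Substituting $a_e=\frac{a_{\mathrm{s},e}+1}{2}\frac{\overline{w}}{\rho_e\ell_e}$ and writing $\mathbf{K}_j(\mathbf{a}_{\mathrm{s}})$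 for the resulting polynomial matrix, define $$\text{(S)}\quad\min_{\mathbf{a}_{\mathrm{s}}}\ 0.5\,\overline{w}\,(n_{\mathrm{e}}+\mathbf{1}^{\mathrm{T}}\mathbf{a}_{\mathrm{s}})\quad\text{s.t.}\quad\begin{pmatrix}\overline{c}_j&-\mathbf{f}_j^{\mathrm{T}}\\-\mathbf{f}_j&\mathbf{K}_j(\mathbf{a}_{\mathrm{s}})\end{pmatrix}\succeq 0\ \ \forall j,\quad a_{\mathrm{s},e}^2\le 1\ \ \forall e.$$ Moment relaxations (Lasserre hierarchy): write all constraints of (S) as $\mathbf{G}(\mathbf{a}_{\mathrm{s}})\succeq 0$ with $\mathbf{G}$ block-diagonal (blocks: the matrix constraints and the scalars $1-a_{\mathrm{s},e}^2$), and let $d$ be the maximum degree of a polynomial in $\mathbf{G}$. Let $\mathbf{b}_k$ be the column vector of all monomials in $\mathbf{a}_{\mathrm{s}}$ of degree at most $k$. For a vector $\mathbf{y}$ of moments indexed by the monomials in $\mathbf{b}_{2r}$, with the moment of the monomial $1$ equal to $1$, let $L_{\mathbf{y}}$ be the linear map sending each monomial to its moment, applied entrywise to polynomial matrices. For $2r\ge d$ the $r$-th relaxation is $$f^{(r)}=\min_{\mathbf{y}}\ L_{\mathbf{y}}\bigl(0.5\,\overline{w}(n_{\mathrm{e}}+\mathbf{1}^{\mathrm{T}}\mathbf{a}_{\mathrm{s}})\bigr)\quad\text{s.t.}\quad\mathbf{M}_{2r}(\mathbf{y})=L_{\mathbf{y}}(\mathbf{b}_r\mathbf{b}_r^{\mathrm{T}})\succeq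 0,\quad\mathbf{M}_{2r-d}(\mathbf{G}\mathbf{y})=L_{\mathbf{y}}\bigl((\mathbf{b}_s\mathbf{b}_s^{\mathrm{T}})\otimes\mathbf{G}\bigr)\succeq 0,\quad s=\lfloor(2r-d)/2\rfloor.$$ The first-order moments are the entries $y_{a_{\mathrm{s},e}^1}$ of $\mathbf{y}$ corresponding to the degree-one monomials $a_{\mathrm{s},e}$. *)

theory Defs
  imports
    "HOL-Analysis.Analysis"
    "HOL-Library.Poly_Mapping"
    "Jordan_Normal_Form.Matrix"
begin

(* "$" is kept for design vectors in real ^ 'e; degrees of freedom use the carrier-based
   vectors and matrices of Jordan_Normal_Form, since their number depends on the load case. *)
no_notation vec_index (infixl "$" 100)

section \<open>Real matrices\<close>

definition psd_mat :: "real mat \<Rightarrow> bool" where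
  "psd_mat A \<longleftrightarrow> square_mat A \<and> transpose_mat A = A \<and>
     (\<forall>v \<in> carrier_vec (dim_row A). 0 \<le> scalar_prod v (A *\<^sub>v v))"

definition pd_mat :: "real mat \<Rightarrow> bool" where
  "pd_mat A \<longleftrightarrow> square_mat A \<and> transpose_mat A = A \<and>
     (\<forall>v \<in> carrier_vec (dim_row A). v \<noteq> 0\<^sub>v (dim_row A) \<longrightarrow> 0 < scalar_prod v (A *\<^sub>v v))"

definition mat_image :: "real mat \<Rightarrow> real vec set" where
  "mat_image A = (\<lambda>u. A *\<^sub>v u) ` carrier_vec (dim_col A)"

(* the four Penrose conditions; they determine X uniquely *)
definition is_pinv :: "real mat \<Rightarrow> real mat \<Rightarrow> bool" where
  "is_pinv A X \<longleftrightarrow> X \<in> carrier_mat (dim_col A) (dim_row A) \<and>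
     A * X * A = A \<and> X * A * X = X \<and>
     transpose_mat (A * X) = A * X \<and> transpose_mat (X * A) = X * A"

definition pinv :: "real mat \<Rightarrow> real mat" where
  "pinv A = (THE X. is_pinv A X)"

definition kronecker_mat :: "'a::times mat \<Rightarrow> 'a mat \<Rightarrow> 'a mat" where
  "kronecker_mat A B = mat (dim_row A * dim_row B) (dim_col A * dim_col B)
     (\<lambda>(p, q). A $$ (p div dim_row B, q div dim_col B) * B $$ (p mod dim_row B, q mod dim_col B))"


section \<open>Weight minimization\<close>

definition stiffness ::
    "real mat \<Rightarrow> ('e::finite \<Rightarrow> nat \<Rightarrow> real mat) \<Rightarrow> real ^ 'e \<Rightarrow> real mat" where
  "stiffness K0 K a = mat (dim_row K0) (dim_col K0)
     (\<lambda>(p, q). K0 $$ (p, q) + (\<Sum>e\<in>UNIV. \<Sum>i=1..3. K e i $$ (p, q) * (a $ e) ^ i))"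

(* meaningful only when f lies in the image of the stiffness matrix *)
definition compliance ::
    "real vec \<Rightarrow> real mat \<Rightarrow> ('e::finite \<Rightarrow> nat \<Rightarrow> real mat) \<Rightarrow> real ^ 'e \<Rightarrow> real" where
  "compliance f K0 K a = scalar_prod f (pinv (stiffness K0 K a) *\<^sub>v f)"

definition weight :: "('e::finite \<Rightarrow> real) \<Rightarrow> ('e \<Rightarrow> real) \<Rightarrow> real ^ 'e \<Rightarrow> real" where
  "weight rho len a = (\<Sum>e\<in>UNIV. rho e * len e * a $ e)"

definition design_feasible ::
    "('l \<Rightarrow> real vec) \<Rightarrow> ('l \<Rightarrow> real) \<Rightarrow> ('l \<Rightarrow> real mat) \<Rightarrow> ('l \<Rightarrow> 'e::finite \<Rightarrow> nat \<Rightarrow> real mat)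
      \<Rightarrow> (real ^ 'e) \<times> ('l \<Rightarrow> real vec) \<Rightarrow> bool" where
  "design_feasible f cbar K0 K = (\<lambda>(a, u).
     (\<forall>j. u j \<in> carrier_vec (dim_vec (f j)) \<and>
          stiffness (K0 j) (K j) a *\<^sub>v u j = f j \<and>
          0 \<le> cbar j - scalar_prod (f j) (u j)) \<and>
     (\<forall>e. 0 \<le> a $ e))"

definition global_minimizers ::
    "('e::finite \<Rightarrow> real) \<Rightarrow> ('e \<Rightarrow> real) \<Rightarrow> ('l \<Rightarrow> real vec) \<Rightarrow> ('l \<Rightarrow> real) \<Rightarrow> ('l \<Rightarrow> real mat)
      \<Rightarrow> ('l \<Rightarrow> 'e \<Rightarrow> nat \<Rightarrow> real mat) \<Rightarrow> (real ^ 'e) set" where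
  "global_minimizers rho len f cbar K0 K =
     {a. \<exists>u. is_arg_min (\<lambda>(a, u). weight rho len a) (design_feasible f cbar K0 K) (a, u)}"

definition univariate_solution ::
    "('l \<Rightarrow> real vec) \<Rightarrow> ('l \<Rightarrow> real) \<Rightarrow> ('l \<Rightarrow> real mat) \<Rightarrow> ('l \<Rightarrow> 'e::finite \<Rightarrow> nat \<Rightarrow> real mat)
      \<Rightarrow> real ^ 'e \<Rightarrow> real \<Rightarrow> bool" where
  "univariate_solution f cbar K0 K a = is_arg_min (\<lambda>\<delta>. \<delta>)
     (\<lambda>\<delta>. (\<forall>j. compliance (f j) (K0 j) (K j) (\<delta> *\<^sub>R a) \<le> cbar j) \<and> 0 < \<delta>)"


section \<open>Polynomials in the scaled design variables\<close>

(* Finitely supported maps from exponents to coefficients; an exponent 'e \<Rightarrow>\<^sub>0 nat is identified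
   with its monomial. *)
type_synonym 'e mpoly = "('e \<Rightarrow>\<^sub>0 nat) \<Rightarrow>\<^sub>0 real"

definition Const :: "real \<Rightarrow> 'e mpoly" where
  "Const c = Poly_Mapping.single 0 c"

definition Monom :: "('e \<Rightarrow>\<^sub>0 nat) \<Rightarrow> 'e mpoly" where
  "Monom m = Poly_Mapping.single m 1"

definition Var :: "'e \<Rightarrow> 'e mpoly" where
  "Var e = Monom (Poly_Mapping.single e 1)"

definition mdeg :: "('e::finite \<Rightarrow>\<^sub>0 nat) \<Rightarrow> nat" where
  "mdeg m = (\<Sum>e\<in>UNIV. Poly_Mapping.lookup m e)"

definition total_degree :: "'e::finite mpoly \<Rightarrow> nat" where
  "total_degree p = Max (insert 0 (mdeg ` Poly_Mapping.keys p))"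

definition mat_degree :: "'e::finite mpoly mat \<Rightarrow> nat" where
  "mat_degree G = Max (total_degree ` elements_mat G)"


section \<open>The scaled problem\<close>

definition scaled_area :: "real \<Rightarrow> ('e \<Rightarrow> real) \<Rightarrow> ('e \<Rightarrow> real) \<Rightarrow> 'e \<Rightarrow> 'e mpoly" where
  "scaled_area wbar rho len e = Const (1 / 2) * (Var e + 1) * Const (wbar / (rho e * len e))"

definition scaled_stiffness ::
    "real \<Rightarrow> ('e::finite \<Rightarrow> real) \<Rightarrow> ('e \<Rightarrow> real) \<Rightarrow> real mat \<Rightarrow> ('e \<Rightarrow> nat \<Rightarrow> real mat) \<Rightarrow> 'e mpoly mat"
  where
  "scaled_stiffness wbar rho len K0 K = mat (dim_row K0) (dim_col K0)
     (\<lambda>(p, q). Const (K0 $$ (p, q)) +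
        (\<Sum>e\<in>UNIV. \<Sum>i=1..3. Const (K e i $$ (p, q)) * scaled_area wbar rho len e ^ i))"

definition compliance_block :: "real \<Rightarrow> real vec \<Rightarrow> 'e mpoly mat \<Rightarrow> 'e mpoly mat" where
  "compliance_block cbar f K = four_block_mat
     (mat 1 1 (\<lambda>_. Const cbar))   (mat_of_row (map_vec Const (- f)))
     (mat_of_cols (dim_vec f) [map_vec Const (- f)])   K"

(* The linear orders of the index types stand for the numbering of load cases and elements. *)
definition scaled_constraints ::
    "real \<Rightarrow> ('e::{finite,linorder} \<Rightarrow> real) \<Rightarrow> ('e \<Rightarrow> real) \<Rightarrow> ('l::{finite,linorder} \<Rightarrow> real vec)
      \<Rightarrow> ('l \<Rightarrow> real) \<Rightarrow> ('l \<Rightarrow> real mat) \<Rightarrow> ('l \<Rightarrow> 'e \<Rightarrow> nat \<Rightarrow> real mat) \<Rightarrow> 'e mpoly mat" where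
  "scaled_constraints wbar rho len f cbar K0 K = diag_block_mat
     (map (\<lambda>j. compliance_block (cbar j) (f j) (scaled_stiffness wbar rho len (K0 j) (K j)))
        (sorted_list_of_set UNIV) @
      map (\<lambda>e. mat 1 1 (\<lambda>_. 1 - Var e ^ 2)) (sorted_list_of_set UNIV))"

definition scaled_objective :: "real \<Rightarrow> 'e::finite mpoly" where
  "scaled_objective wbar = Const (0.5 * wbar) * (of_nat CARD('e) + (\<Sum>e\<in>UNIV. Var e))"


section \<open>Moment relaxations\<close>

(* In a relaxation of order r only the moments of degree at most 2 * r occur; the values of y on
   higher monomials are irrelevant. *)
definition Lfun :: "(('e \<Rightarrow>\<^sub>0 nat) \<Rightarrow> real) \<Rightarrow> 'e mpoly \<Rightarrow> real" where
  "Lfun y p = (\<Sum>m\<in>Poly_Mapping.keys p. Poly_Mapping.lookup p m * y m)"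

definition monomials :: "nat \<Rightarrow> 'e::{finite,linorder} mpoly vec" where
  "monomials k = vec_of_list (map Monom (sorted_list_of_set {m. mdeg m \<le> k}))"

definition monomial_products :: "nat \<Rightarrow> 'e::{finite,linorder} mpoly mat" where
  "monomial_products k =
     (let b = monomials k in mat_of_cols (dim_vec b) [b] * mat_of_row b)"

definition relaxation_feasible ::
    "'e::{finite,linorder} mpoly mat \<Rightarrow> nat \<Rightarrow> (('e \<Rightarrow>\<^sub>0 nat) \<Rightarrow> real) \<Rightarrow> bool" where
  "relaxation_feasible G r y \<longleftrightarrow>
     y 0 = 1 \<and>
     psd_mat (map_mat (Lfun y) (monomial_products r)) \<and>
     psd_mat (map_mat (Lfun y)
       (kronecker_mat (monomial_products ((2 * r - mat_degree G) div 2)) G))"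

definition relaxation_optimal ::
    "'e::{finite,linorder} mpoly \<Rightarrow> 'e mpoly mat \<Rightarrow> nat \<Rightarrow> (('e \<Rightarrow>\<^sub>0 nat) \<Rightarrow> real) \<Rightarrow> bool" where
  "relaxation_optimal obj G r = is_arg_min (\<lambda>y. Lfun y obj) (relaxation_feasible G r)"

definition first_moment :: "(('e \<Rightarrow>\<^sub>0 nat) \<Rightarrow> real) \<Rightarrow> 'e \<Rightarrow> real" where
  "first_moment y e = y (Poly_Mapping.single e 1)"

definition moment_design ::
    "real \<Rightarrow> ('e::finite \<Rightarrow> real) \<Rightarrow> ('e \<Rightarrow> real) \<Rightarrow> (('e \<Rightarrow>\<^sub>0 nat) \<Rightarrow> real) \<Rightarrow> real ^ 'e" where
  "moment_design wbar rho len y =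
     (\<chi> e. (first_moment y e + 1) / 2 * (wbar / (rho e * len e)))"

end

theory Submission
  imports Defs "Jordan_Normal_Form.Determinant"
begin

text \<open>All moments of fixed degree are eventually bounded by 1, so along any bad sequence of relaxation
  orders the optimal moments have a pointwise cluster point \<open>z\<close>. The polynomials \<open>t\<close> for which
  \<open>q \<mapsto> L_z (q\<^sup>2 t)\<close> is nonnegative form an Archimedean cone, which is closed under products; a
  Krivine-type argument on this cone shows that \<open>L_z p \<ge> 0\<close> for every polynomial \<open>p\<close> that is positive
  on the feasible set. Applied to affine \<open>p\<close>, this puts the first moments of \<open>z\<close> into the convex hull
  of the feasible set. Since their weight does not exceed the optimal weight, they lie in the convex
  hull of the minimizers, and convexity makes the limit design a minimizer \<open>a\<close>. Eventually
  \<open>(1 + \<epsilon>)\<close> times the moment design dominates \<open>a\<close> componentwise, so monotonicity of the compliance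
  gives \<open>\<delta>* \<le> 1 + \<epsilon>\<close>; the lower bound comes from the feasibility of the rescaled design.\<close>

(* Determinant re-activates the vector index notation that Defs reserves for design vectors. *)
no_notation vec_index (infixl "$" 100)

section \<open>Linear functionals and evaluation of polynomials\<close>

text \<open>The obstacle is nonconvexity: the feasible set is cut out by cubic matrix polynomials,
  so first moments are only known to reach its convex hull, and convexity is available for the
  minimizers alone. Neither moments nor designs need converge; hence a contradiction along a filter
  of bad orders. The cone is attached to the functional \<open>z\<close> and not generated by the
  constraints. A cone generated by constraints and squares is in general not closed under products,
  whereas membership defined by inequalities for \<open>z\<close> tolerates errors that tend to 0.
  Products are what allows formal expectations with the probabilities
  \<open>(1 + Var e) / 2\<close>, that is, a Bernstein operator on the box. No measure representing
  \<open>z\<close> is built; positivity on affine polynomials is all that is finally used. The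
  pseudo-inverse is discontinuous where the stiffness changes rank, so compliance bounds are
  translated into solvability of the equilibrium equation with a bound, and this into quadratic
  forms that are polynomial in the design.\<close>

lemma Lfun_superset:
  assumes "finite S" "Poly_Mapping.keys p \<subseteq> S"
  shows "Lfun y p = (\<Sum>m\<in>S. Poly_Mapping.lookup p m * y m)"
  unfolding Lfun_def using assms
  by (intro sum.mono_neutral_left) (auto simp: in_keys_iff)

lemma Lfun_0 [simp]: "Lfun y 0 = 0"
  by (simp add: Lfun_def)

lemma Lfun_add: "Lfun y (p + q) = Lfun y p + Lfun y q"
proof -
  let ?S = "Poly_Mapping.keys p \<union> Poly_Mapping.keys q"
  have "Lfun y (p + q) = (\<Sum>m\<in>?S. Poly_Mapping.lookup (p + q) m * y m)"
    by (intro Lfun_superset) (use keys_add[of p q] in auto)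
  moreover have "Lfun y p = (\<Sum>m\<in>?S. Poly_Mapping.lookup p m * y m)"
    by (intro Lfun_superset) auto
  moreover have "Lfun y q = (\<Sum>m\<in>?S. Poly_Mapping.lookup q m * y m)"
    by (intro Lfun_superset) auto
  ultimately show ?thesis
    by (simp add: lookup_add distrib_right sum.distrib)
qed

lemma Lfun_single [simp]: "Lfun y (Poly_Mapping.single m c) = c * y m"
  by (cases "c = 0") (simp_all add: Lfun_def)

lemma Lfun_sum: "Lfun y (sum f A) = (\<Sum>a\<in>A. Lfun y (f a))"
  by (induction A rule: infinite_finite_induct) (simp_all add: Lfun_add)

lemma Lfun_uminus: "Lfun y (- p) = - Lfun y p"
  by (metis Lfun_0 Lfun_add add.right_inverse add_eq_0_iff)

lemma Lfun_diff: "Lfun y (p - q) = Lfun y p - Lfun y q"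
  by (metis Lfun_add Lfun_uminus diff_conv_add_uminus)

lemma poly_mapping_sum_single:
  "p = (\<Sum>m\<in>Poly_Mapping.keys p. Poly_Mapping.single m (Poly_Mapping.lookup p m))"
proof (rule poly_mapping_eqI)
  fix k
  have *: "finite A \<Longrightarrow> Poly_Mapping.lookup (\<Sum>m\<in>A. Poly_Mapping.single m (Poly_Mapping.lookup p m)) k
        = (if k \<in> A then Poly_Mapping.lookup p k else 0)" for A
    by (induction A rule: finite_induct) (auto simp: lookup_add lookup_single when_def)
  show "Poly_Mapping.lookup p k = Poly_Mapping.lookup
      (\<Sum>m\<in>Poly_Mapping.keys p. Poly_Mapping.single m (Poly_Mapping.lookup p m)) k"
    by (subst *) (auto simp: in_keys_iff)
qed

lemma Const_0 [simp]: "Const 0 = 0"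
  and Const_1 [simp]: "Const 1 = 1"
  by (simp_all add: Const_def)

lemma Const_add: "Const (a + b) = Const a + Const b"
  and Const_diff: "Const (a - b) = Const a - Const b"
  and Const_uminus: "Const (- a) = - Const a"
  by (simp_all add: Const_def single_add single_diff single_uminus)

lemma Const_mult: "Const (a * b) = Const a * Const b"
  by (simp add: Const_def mult_single)

lemma Const_numeral: "Const (numeral n) = numeral n"
  by (simp add: Const_def)

lemma Lfun_Const_mult: "Lfun y (Const c * p) = c * Lfun y p"
proof -
  have "Lfun y (Const c * (\<Sum>m\<in>Poly_Mapping.keys p. Poly_Mapping.single m (Poly_Mapping.lookup p m)))
      = c * Lfun y (\<Sum>m\<in>Poly_Mapping.keys p. Poly_Mapping.single m (Poly_Mapping.lookup p m))"
    by (simp add: sum_distrib_left Lfun_sum Const_def mult_single mult.assoc)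
  then show ?thesis
    by (simp flip: poly_mapping_sum_single)
qed

lemma Lfun_Const: "Lfun y (Const c) = c * y 0"
  by (simp add: Const_def)

lemma Lfun_1: "Lfun y 1 = y 0"
  by (metis Const_1 Lfun_Const mult_1)

lemma Lfun_Var: "Lfun y (Var e) = first_moment y e"
  by (simp add: Var_def Monom_def first_moment_def)

lemma Lfun_Monom: "Lfun y (Monom m) = y m"
  by (simp add: Monom_def)

lemma Monom_add: "Monom (m + n) = Monom m * Monom n"
  by (simp add: Monom_def mult_single)

lemma Monom_0: "Monom 0 = 1"
  by (simp add: Monom_def)

text \<open>Induction over the ring operations: a property stable under sums and products needs
  checking at constants and variables only. Continuity of evaluation, the Archimedean bound and the
  Lipschitz estimate on the box all go through it.\<close>

lemma mpoly_induct [case_names Const Var add mult]: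
  fixes p :: "'e::finite mpoly"
  assumes C: "\<And>c. Q (Const c)" and V: "\<And>e. Q (Var e)"
    and A: "\<And>p q. Q p \<Longrightarrow> Q q \<Longrightarrow> Q (p + q)"
    and M: "\<And>p q. Q p \<Longrightarrow> Q q \<Longrightarrow> Q (p * q)"
  shows "Q p"
proof -
  have pow: "Q (Monom (Poly_Mapping.single e n))" for e n
  proof (induction n)
    case 0
    then show ?case using C[of 1] by (simp add: Monom_0)
  next
    case (Suc n)
    have "Poly_Mapping.single e (Suc n) = Poly_Mapping.single e 1 + Poly_Mapping.single e n"
      by (simp flip: single_add)
    then have "Monom (Poly_Mapping.single e (Suc n)) = Var e * Monom (Poly_Mapping.single e n)"
      by (simp add: Monom_add Var_def)
    then show ?case using M[OF V Suc] by simp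
  qed
  have msum: "finite A \<Longrightarrow> Q (Monom (\<Sum>e\<in>A. Poly_Mapping.single e (k e)))" for A and k :: "'e \<Rightarrow> nat"
  proof (induction A rule: finite_induct)
    case empty
    then show ?case using C[of 1] by (simp add: Monom_0)
  next
    case (insert x F)
    then show ?case using M[OF pow insert.IH] by (simp add: Monom_add)
  qed
  have mono: "Q (Monom m)" for m
  proof -
    have "m = (\<Sum>e\<in>UNIV. Poly_Mapping.single e (Poly_Mapping.lookup m e))"
    proof (rule poly_mapping_eqI)
      fix k
      have "finite A \<Longrightarrow> Poly_Mapping.lookup (\<Sum>e\<in>A. Poly_Mapping.single e (Poly_Mapping.lookup m e)) k
          = (if k \<in> A then Poly_Mapping.lookup m k else 0)" for A
        by (induction A rule: finite_induct) (auto simp: lookup_add lookup_single when_def)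
      then show "Poly_Mapping.lookup m k = Poly_Mapping.lookup
          (\<Sum>e\<in>UNIV. Poly_Mapping.single e (Poly_Mapping.lookup m e)) k"
        by simp
    qed
    then show ?thesis using msum[of UNIV "Poly_Mapping.lookup m"] by simp
  qed
  have single: "Q (Poly_Mapping.single m c)" for m c
  proof -
    have "Poly_Mapping.single m c = Const c * Monom m"
      by (simp add: Const_def Monom_def mult_single)
    then show ?thesis using M[OF C mono] by simp
  qed
  have "finite A \<Longrightarrow> Q (\<Sum>m\<in>A. Poly_Mapping.single m (Poly_Mapping.lookup p m))" for A
  proof (induction A rule: finite_induct)
    case empty
    then show ?case using C[of 0] by simp
  next
    case (insert x F)
    then show ?case using A[OF single insert.IH] by simp
  qed
  from this[of "Poly_Mapping.keys p"] show ?thesis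
    by (simp flip: poly_mapping_sum_single)
qed

text \<open>The moment sequence of the Dirac measure at \<open>c\<close>. Evaluation becomes an
  instance of \<open>Lfun\<close>, so one set of linearity lemmas serves evaluations and moments,
  and points can be inserted into the relaxations.\<close>

definition monom_value :: "real ^ 'e \<Rightarrow> ('e::finite \<Rightarrow>\<^sub>0 nat) \<Rightarrow> real" where
  "monom_value c m = (\<Prod>e\<in>UNIV. (c $ e) ^ Poly_Mapping.lookup m e)"

abbreviation eval_at :: "real ^ 'e::finite \<Rightarrow> 'e mpoly \<Rightarrow> real" where
  "eval_at c \<equiv> Lfun (monom_value c)"

lemma monom_value_0 [simp]: "monom_value c 0 = 1"
  by (simp add: monom_value_def)

lemma monom_value_add: "monom_value c (m + n) = monom_value c m * monom_value c n"
  by (simp add: monom_value_def lookup_add power_add prod.distrib)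

lemma first_moment_monom_value [simp]: "first_moment (monom_value c) e = c $ e"
proof -
  have "first_moment (monom_value c) e = (\<Prod>i\<in>UNIV. if i = e then c $ e else 1)"
    unfolding first_moment_def monom_value_def
    by (intro prod.cong) (auto simp: lookup_single when_def)
  then show ?thesis by simp
qed

lemma eval_at_mult: "eval_at c (p * q) = eval_at c p * eval_at c q"
proof -
  define P where "P = (\<Sum>m\<in>Poly_Mapping.keys p. Poly_Mapping.single m (Poly_Mapping.lookup p m))"
  define Q where "Q = (\<Sum>m\<in>Poly_Mapping.keys q. Poly_Mapping.single m (Poly_Mapping.lookup q m))"
  have "eval_at c (P * Q) = eval_at c P * eval_at c Q"
    by (simp add: P_def Q_def sum_product Lfun_sum mult_single monom_value_add algebra_simps)
  moreover have "P = p" "Q = q"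
    by (simp_all add: P_def Q_def flip: poly_mapping_sum_single)
  ultimately show ?thesis by simp
qed

lemma eval_at_Const [simp]: "eval_at c (Const a) = a"
  by (simp add: Lfun_Const)

lemma eval_at_1 [simp]: "eval_at c 1 = 1"
  by (simp add: Lfun_1)

lemma eval_at_Var [simp]: "eval_at c (Var e) = c $ e"
  by (simp add: Lfun_Var)

lemma eval_at_power: "eval_at c (p ^ n) = eval_at c p ^ n"
  by (induction n) (simp_all add: eval_at_mult)

lemma continuous_on_eval_at: "continuous_on S (\<lambda>c. eval_at c p)"
proof (induction p rule: mpoly_induct)
  case (Var e)
  then show ?case by (simp add: continuous_intros)
qed (simp_all add: Lfun_add eval_at_mult continuous_intros)

lemma of_nat_eq_Const: "of_nat n = (Const (real n) :: 'e mpoly)"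
  by (induction n) (simp_all add: Const_add)

section \<open>Positive linear functionals\<close>

locale moment_functional =
  fixes z :: "('e::finite \<Rightarrow>\<^sub>0 nat) \<Rightarrow> real"
  assumes square_nonneg: "0 \<le> Lfun z (q * q)"
    and box_nonneg: "0 \<le> Lfun z (q * q * (1 - Var e * Var e))"
begin

text \<open>If \<open>z\<close> came from a measure on the box, these would be the polynomials
  nonnegative on its support. The factor \<open>q * q\<close> makes multiplication by squares
  free.\<close>

definition cone :: "'e mpoly set" where
  "cone = {t. \<forall>q. 0 \<le> Lfun z (q * q * t)}"

lemma cone_Lfun: "t \<in> cone \<Longrightarrow> 0 \<le> Lfun z t"
  unfolding cone_def by (auto dest: spec[of _ 1])

lemma cone_add: "s \<in> cone \<Longrightarrow> t \<in> cone \<Longrightarrow> s + t \<in> cone"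
  by (simp add: cone_def distrib_left Lfun_add)

lemma cone_Const: "0 \<le> c \<Longrightarrow> Const c \<in> cone"
  using square_nonneg by (simp add: cone_def mult.commute[of _ "Const _"] Lfun_Const_mult)

lemma cone_0: "0 \<in> cone"
  by (simp add: cone_def)

lemma cone_1: "1 \<in> cone"
  using cone_Const[of 1] by simp

lemma cone_scale: "0 \<le> c \<Longrightarrow> t \<in> cone \<Longrightarrow> Const c * t \<in> cone"
  by (simp add: cone_def mult.left_commute[of _ "Const _"] Lfun_Const_mult)

lemma cone_square_mult: "t \<in> cone \<Longrightarrow> p * p * t \<in> cone"
  unfolding cone_def by (auto, metis (no_types, opaque_lifting) mult.assoc mult.left_commute)

lemma cone_square: "p * p \<in> cone"
  using cone_square_mult[OF cone_1] by simp

lemma cone_sum: "(\<And>a. a \<in> A \<Longrightarrow> f a \<in> cone) \<Longrightarrow> sum f A \<in> cone"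
  by (induction A rule: infinite_finite_induct) (auto intro: cone_add simp: cone_0)

lemma cone_box: "1 - Var e * Var e \<in> cone"
  using box_nonneg by (simp add: cone_def)

text \<open>The Archimedean property. Squares are bounded rather than \<open>p\<close> itself,
  because so far the cone admits multiplication only by squares: sums use the parallelogram law,
  products use \<open>C D - p\<^sup>2 q\<^sup>2 = D (C - p\<^sup>2) + p\<^sup>2 (D -
  q\<^sup>2)\<close>.\<close>

lemma square_bounded: "\<exists>C\<ge>0. Const C - p * p \<in> cone"
proof (induction p rule: mpoly_induct)
  case (Const c)
  have "Const (c * c) - Const c * Const c \<in> cone"
    by (simp add: Const_mult cone_0)
  then show ?case using zero_le_square by blast
next
  case (Var e)
  then show ?case using cone_box by (intro exI[of _ 1]) simp
next
  case (add p q)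
  then obtain C D where C: "C \<ge> 0" "Const C - p * p \<in> cone" and D: "D \<ge> 0" "Const D - q * q \<in> cone"
    by blast
  have "Const 2 * (Const C - p * p) + Const 2 * (Const D - q * q) + (p - q) * (p - q) \<in> cone"
    using C D by (intro cone_add cone_scale cone_square) auto
  also have "Const 2 * (Const C - p * p) + Const 2 * (Const D - q * q) + (p - q) * (p - q)
      = Const (2 * C + 2 * D) - (p + q) * (p + q)"
    by (simp add: Const_add Const_mult Const_numeral algebra_simps)
  finally show ?case using C D by (intro exI[of _ "2 * C + 2 * D"]) simp
next
  case (mult p q)
  then obtain C D where C: "C \<ge> 0" "Const C - p * p \<in> cone" and D: "D \<ge> 0" "Const D - q * q \<in> cone"
    by blast
  have "Const D * (Const C - p * p) + p * p * (Const D - q * q) \<in> cone"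
    using C D by (intro cone_add cone_scale cone_square_mult) auto
  also have "Const D * (Const C - p * p) + p * p * (Const D - q * q)
      = Const (C * D) - (p * q) * (p * q)"
    by (simp add: Const_mult algebra_simps)
  finally show ?case using C D by (intro exI[of _ "C * D"]) simp
qed

text \<open>From \<open>2 p \<le> 1 + p\<^sup>2\<close>, that is, from the square of
  \<open>1 - p\<close>.\<close>

lemma bounded_above: "\<exists>C>0. Const C - p \<in> cone"
proof -
  obtain C where C: "C \<ge> 0" "Const C - p * p \<in> cone"
    using square_bounded by blast
  have "Const (1 / 2) * (Const C - p * p) + Const (1 / 2) * ((1 - p) * (1 - p)) \<in> cone"
    using C by (intro cone_add cone_scale cone_square) auto
  also have "Const (1 / 2) * (Const C - p * p) + Const (1 / 2) * ((1 - p) * (1 - p))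
      = Const (1 / 2) * Const C + Const (1 / 2) - (Const (1 / 2) + Const (1 / 2)) * p"
    by (simp add: algebra_simps)
  also have "\<dots> = Const ((C + 1) / 2) - p"
    by (simp add: add_divide_distrib flip: Const_add Const_mult)
  finally show ?thesis using C(1) by (intro exI[of _ "(C + 1) / 2"]) simp
qed

end

text \<open>Since \<open>t\<close> is the sum of the squares of its logistic iterates plus a remainder that is small in
  mean square, \<open>q\<^sup>2 t s\<close> is a sum of squares times \<open>s\<close> up to a vanishing error: the cone below is
  closed under products.\<close>

fun logistic :: "'a::comm_ring_1 \<Rightarrow> nat \<Rightarrow> 'a" where
  "logistic t 0 = t"
| "logistic t (Suc n) = logistic t n - logistic t n * logistic t n"

lemma logistic_telescope: "t = (\<Sum>n<k. logistic t n * logistic t n) + logistic t k"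
  by (induction k) simp_all

text \<open>Random walk on exponent vectors: each entry \<open>e\<close> of the list increments the \<open>e\<close>-th coordinate
  with the formal probability \<open>t e\<close>, so that \<open>walk\<close> is the formal expectation of \<open>\<phi>\<close> at the end
  of the walk.\<close>

fun walk :: "('e \<Rightarrow> 'a::comm_ring_1) \<Rightarrow> 'e list \<Rightarrow> (('e \<Rightarrow> nat) \<Rightarrow> 'a) \<Rightarrow> 'a" where
  "walk t [] \<phi> = \<phi> (\<lambda>_. 0)"
| "walk t (e # es) \<phi> = t e * walk t es (\<lambda>k. \<phi> (k(e := Suc (k e)))) + (1 - t e) * walk t es \<phi>"

lemma walk_const: "walk t es (\<lambda>k. a) = a"
  by (induction es) (simp_all add: algebra_simps)

lemma walk_add: "walk t es (\<lambda>k. \<phi> k + \<psi> k) = walk t es \<phi> + walk t es \<psi>"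
  by (induction es arbitrary: \<phi> \<psi>) (simp_all add: algebra_simps)

lemma walk_mult: "walk t es (\<lambda>k. a * \<phi> k) = a * walk t es \<phi>"
  by (induction es arbitrary: \<phi>) (simp_all add: algebra_simps)

lemma walk_sum: "finite A \<Longrightarrow> walk t es (\<lambda>k. \<Sum>a\<in>A. \<phi> a k) = (\<Sum>a\<in>A. walk t es (\<phi> a))"
  by (induction A rule: finite_induct) (simp_all add: walk_add walk_const)

text \<open>The decomposition of the second moment of a shifted binomial variable into squared mean
  and variance, valid in any commutative ring. The shift \<open>s\<close> is kept general because a
  step in coordinate \<open>e\<close> turns it into \<open>s + 1\<close> in the induction.\<close>

lemma walk_second_moment:
  "walk t es (\<lambda>k. (of_nat (k e) + s) * (of_nat (k e) + s))
     = (of_nat (count_list es e) * t e + s) * (of_nat (count_list es e) * t e + s)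
       + of_nat (count_list es e) * (t e * (1 - t e))"
proof (induction es arbitrary: s)
  case Nil
  then show ?case by simp
next
  case (Cons a es)
  show ?case
  proof (cases "a = e")
    case True
    have "walk t es (\<lambda>k. (of_nat (Suc (k e)) + s) * (of_nat (Suc (k e)) + s))
        = walk t es (\<lambda>k. (of_nat (k e) + (s + 1)) * (of_nat (k e) + (s + 1)))"
      by (simp add: algebra_simps)
    then show ?thesis using True
      by (simp add: Cons.IH) (simp add: algebra_simps)
  next
    case False
    then show ?thesis
      by (simp add: Cons.IH) (simp add: algebra_simps)
  qed
qed

lemma ex_list_uniform_count:
  "\<exists>es :: 'e::finite list. \<forall>e. count_list es e = N"
proof -
  obtain us :: "'e list" where us: "set us = UNIV" "distinct us"
    using finite_distinct_list[OF finite[of UNIV]] by blast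
  have "distinct us \<Longrightarrow> count_list us e = (if e \<in> set us then 1 else 0)" for e
    by (induction us) auto
  then have 1: "count_list us e = 1" for e
    using us by simp
  have "\<forall>e. count_list (concat (replicate N us)) e = N"
    by (induction N) (simp_all add: 1)
  then show ?thesis by blast
qed

context moment_functional
begin

text \<open>Product closure is not yet available; the identity
  \<open>t - t\<^sup>2 = t\<^sup>2 (1 - t) + (1 - t)\<^sup>2 t\<close> needs multiplication by
  squares only.\<close>

lemma cone_logistic:
  assumes "t \<in> cone" "1 - t \<in> cone"
  shows "logistic t n \<in> cone \<and> 1 - logistic t n \<in> cone"
proof (induction n)
  case 0
  then show ?case using assms by simp
next
  case (Suc n)
  let ?t = "logistic t n"
  have "?t * ?t * (1 - ?t) + (1 - ?t) * (1 - ?t) * ?t \<in> cone"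
    using Suc by (intro cone_add cone_square_mult) auto
  also have "?t * ?t * (1 - ?t) + (1 - ?t) * (1 - ?t) * ?t = ?t - ?t * ?t"
    by (simp add: algebra_simps)
  finally have "logistic t (Suc n) \<in> cone" by simp
  moreover have "(1 - ?t) + ?t * ?t \<in> cone"
    using Suc by (intro cone_add cone_square) auto
  ultimately show ?case by (simp add: algebra_simps)
qed

lemma cone_mult_aux:
  assumes t: "t \<in> cone" "1 - t \<in> cone" and s: "s \<in> cone"
  shows "t * s \<in> cone"
proof -
  have "0 \<le> Lfun z (q * q * (t * s))" for q
  proof -
    define a where "a n = Lfun z (q * q * (logistic t n * logistic t n))" for n
    define b where "b = Lfun z (q * q * (s * s))"
    have a0: "0 \<le> a n" for n
      using square_nonneg[of "q * logistic t n"] by (simp add: a_def algebra_simps)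
    have "(\<Sum>n<k. a n) \<le> Lfun z (q * q * t)" for k
    proof -
      have "Lfun z (q * q * t)
          = Lfun z (q * q * ((\<Sum>n<k. logistic t n * logistic t n) + logistic t k))"
        by (subst logistic_telescope[of t k]) simp
      also have "\<dots> = (\<Sum>n<k. a n) + Lfun z (q * q * logistic t k)"
        by (simp add: distrib_left Lfun_add sum_distrib_left Lfun_sum a_def)
      finally show ?thesis
        using cone_logistic[OF t, of k] by (simp add: cone_def)
    qed
    \<comment> \<open>The partial sums are bounded because the remainder of the telescope lies in
      the cone; so the mean squares \<open>a n\<close> tend to 0.\<close>
    then have "summable a"
      using a0 by (intro bounded_imp_summable[of a "Lfun z (q * q * t)"])
        (auto simp flip: lessThan_Suc_atMost simp del: sum.lessThan_Suc)
    then have lim: "a \<longlonglongrightarrow> 0" by (rule summable_LIMSEQ_zero)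
    \<comment> \<open>Cauchy-Schwarz for the error term \<open>logistic t k * s\<close>, with a free
      weight \<open>A\<close>: letting \<open>k\<close> grow first removes \<open>A * a k\<close>,
      letting \<open>A\<close> grow afterwards removes \<open>b / A\<close>.\<close>
    have bound: "- (A * a k + b / A) / 2 \<le> Lfun z (q * q * (t * s))" if "A > 0" for A k
    proof -
      let ?l = "logistic t k"
      have "0 \<le> Lfun z (q * q * ((\<Sum>n<k. logistic t n * logistic t n) * s))"
      proof -
        have "(\<Sum>n<k. logistic t n * logistic t n) * s \<in> cone"
          unfolding sum_distrib_right using s by (intro cone_sum cone_square_mult)
        then show ?thesis by (simp add: cone_def)
      qed
      moreover have "Lfun z (q * q * (t * s)) =
          Lfun z (q * q * (((\<Sum>n<k. logistic t n * logistic t n) + ?l) * s))"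
        by (subst logistic_telescope[of t k]) simp
      ultimately have 1: "Lfun z (q * q * (?l * s)) \<le> Lfun z (q * q * (t * s))"
        by (simp add: distrib_left distrib_right Lfun_add)
      have "0 \<le> Lfun z ((Const A * (q * ?l) + q * s) * (Const A * (q * ?l) + q * s))"
        by (rule square_nonneg)
      also have "(Const A * (q * ?l) + q * s) * (Const A * (q * ?l) + q * s)
          = Const (A * A) * (q * q * (?l * ?l)) + Const (2 * A) * (q * q * (?l * s)) + q * q * (s * s)"
        by (simp add: Const_mult Const_numeral algebra_simps)
      finally have "0 \<le> A * A * a k + 2 * A * Lfun z (q * q * (?l * s)) + b"
        by (simp add: Lfun_add Lfun_Const_mult a_def b_def)
      then have "- (A * a k + b / A) / 2 \<le> Lfun z (q * q * (?l * s))"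
        using that by (simp add: field_simps)
      with 1 show ?thesis by simp
    qed
    have "- (b / A) / 2 \<le> Lfun z (q * q * (t * s))" if "A > 0" for A
    proof (rule LIMSEQ_le_const2)
      show "(\<lambda>k. - (A * a k + b / A) / 2) \<longlonglongrightarrow> - (b / A) / 2"
        by (rule tendsto_eq_intros lim refl | simp)+
      show "\<exists>N. \<forall>n\<ge>N. - (A * a n + b / A) / 2 \<le> Lfun z (q * q * (t * s))"
        using bound that by blast
    qed
    then have *: "- (b / real (Suc n)) / 2 \<le> Lfun z (q * q * (t * s))" for n
      by (metis of_nat_0_less_iff zero_less_Suc)
    have "(\<lambda>n. - (b / real (Suc n)) / 2) \<longlonglongrightarrow> - 0 / 2"
      by (intro tendsto_intros LIMSEQ_Suc[OF lim_const_over_n])  simp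
    then show ?thesis using * by (intro LIMSEQ_le_const2) auto
  qed
  then show ?thesis by (simp add: cone_def)
qed

text \<open>An Archimedean upper bound \<open>C\<close> for \<open>t\<close> reduces the claim to
  \<open>t / C\<close>, whose complement \<open>1 - t / C\<close> is in the cone.\<close>

lemma cone_mult:
  assumes "t \<in> cone" "s \<in> cone"
  shows "t * s \<in> cone"
proof -
  obtain C where C: "C > 0" "Const C - t \<in> cone"
    using bounded_above by blast
  have "Const (1 / C) * (Const C - t) \<in> cone"
    using C by (intro cone_scale) auto
  moreover have inv: "Const (1 / C) * Const C = (1 :: 'e mpoly)"
    using C by (simp flip: Const_mult)
  ultimately have "1 - Const (1 / C) * t \<in> cone"
    by (simp add: right_diff_distrib)
  then have "Const (1 / C) * t * s \<in> cone"
    using assms C by (intro cone_mult_aux cone_scale) auto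
  then have "Const C * (Const (1 / C) * t * s) \<in> cone"
    using C by (intro cone_scale) auto
  moreover have "Const C * (Const (1 / C) * t * s) = (Const (1 / C) * Const C) * (t * s)"
    by (simp only: ac_simps)
  ultimately show ?thesis by (simp add: inv)
qed

text \<open>The formal probabilities \<open>t e\<close> and \<open>1 - t e\<close> act as
  nonnegative weights, which is where products of cone elements are needed.\<close>

lemma cone_walk:
  assumes t: "\<And>e. t e \<in> cone" "\<And>e. 1 - t e \<in> cone"
    and "\<And>k. (\<And>e. k e \<le> count_list es e) \<Longrightarrow> \<phi> k \<in> cone"
  shows "walk t es \<phi> \<in> cone"
  using assms(3)
proof (induction es arbitrary: \<phi>)
  case Nil
  then show ?case by simp
next
  case (Cons a es)
  have "walk t es (\<lambda>k. \<phi> (k(a := Suc (k a)))) \<in> cone"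
    by (rule Cons.IH) (rule Cons.prems, simp)
  moreover have "walk t es \<phi> \<in> cone"
    by (rule Cons.IH) (rule Cons.prems, simp add: le_SucI)
  ultimately show ?case using t
    by (simp add: cone_add cone_mult)
qed

end

section \<open>Quadratic lower bounds at the points of the box\<close>

definition unit_box :: "(real ^ 'e) set" where
  "unit_box = {c. \<forall>e. \<bar>c $ e\<bar> \<le> 1}"

lemma unit_box_eq_cbox: "unit_box = cbox (- 1 :: real ^ 'e::finite) 1"
  by (auto simp: unit_box_def mem_box_cart abs_le_iff minus_le_iff)

lemma compact_unit_box: "compact (unit_box :: (real ^ 'e::finite) set)"
  unfolding unit_box_eq_cbox by (rule compact_cbox)

lemma convex_unit_box: "convex (unit_box :: (real ^ 'e::finite) set)"
  unfolding unit_box_eq_cbox by (rule convex_box)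

definition sq_dist_poly :: "real ^ 'e::finite \<Rightarrow> 'e mpoly" where
  "sq_dist_poly c = (\<Sum>e\<in>UNIV. (Var e - Const (c $ e)) * (Var e - Const (c $ e)))"

lemma eval_at_bounded_on_unit_box: "\<exists>B. \<forall>c\<in>unit_box. \<bar>eval_at c p\<bar> \<le> B"
proof -
  have "compact ((\<lambda>c. eval_at c p) ` unit_box)"
    by (intro compact_continuous_image continuous_on_eval_at compact_unit_box)
  then show ?thesis
    by (auto dest!: compact_imp_bounded simp: bounded_iff)
qed

context moment_functional
begin

lemma sq_dist_poly_in_cone: "sq_dist_poly c \<in> cone"
  unfolding sq_dist_poly_def by (intro cone_sum cone_square)

text \<open>A Lipschitz estimate in the order of the cone,
  \<open>(p - p(c))\<^sup>2 \<le> C |x - c|\<^sup>2\<close>, with one constant for all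
  \<open>c\<close> in the box. Products rest on
  \<open>p q - p(c) q(c) = (p - p(c)) q + p(c) (q - q(c))\<close>.\<close>

lemma square_increment_bounded:
  "\<exists>C\<ge>0. \<forall>c\<in>unit_box.
     Const C * sq_dist_poly c - (p - Const (eval_at c p)) * (p - Const (eval_at c p)) \<in> cone"
proof (induction p rule: mpoly_induct)
  case (Const a)
  then show ?case by (intro exI[of _ 0]) (simp add: cone_0)
next
  case (Var e)
  have "sq_dist_poly c - (Var e - Const (c $ e)) * (Var e - Const (c $ e)) \<in> cone" for c
    unfolding sq_dist_poly_def
    by (subst sum.remove[of _ e]) (auto intro: cone_sum cone_square)
  then show ?case by (intro exI[of _ 1]) simp
next
  case (add p q)
  then obtain C D where C: "C \<ge> 0"
      "\<forall>c\<in>unit_box. Const C * sq_dist_poly c - (p - Const (eval_at c p)) * (p - Const (eval_at c p)) \<in> cone"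
    and D: "D \<ge> 0"
      "\<forall>c\<in>unit_box. Const D * sq_dist_poly c - (q - Const (eval_at c q)) * (q - Const (eval_at c q)) \<in> cone"
    by blast
  show ?case
  proof (intro exI[of _ "2 * C + 2 * D"] conjI ballI)
    fix c :: "real ^ 'e" assume c: "c \<in> unit_box"
    define u v d where "u = p - Const (eval_at c p)" and "v = q - Const (eval_at c q)"
      and "d = sq_dist_poly c"
    have "Const 2 * (Const C * d - u * u) + Const 2 * (Const D * d - v * v) + (u - v) * (u - v) \<in> cone"
      using C D c by (intro cone_add cone_scale cone_square) (auto simp: u_def v_def d_def)
    also have "Const 2 * (Const C * d - u * u) + Const 2 * (Const D * d - v * v) + (u - v) * (u - v)
        = Const (2 * C + 2 * D) * d - (u + v) * (u + v)"
      by (simp add: Const_add Const_mult Const_numeral algebra_simps)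
    also have "u + v = p + q - Const (eval_at c (p + q))"
      by (simp add: u_def v_def Lfun_add Const_add)
    finally show "Const (2 * C + 2 * D) * sq_dist_poly c
        - (p + q - Const (eval_at c (p + q))) * (p + q - Const (eval_at c (p + q))) \<in> cone"
      by (simp add: d_def)
  qed (use C D in simp)
next
  case (mult p q)
  then obtain C D where C: "C \<ge> 0"
      "\<forall>c\<in>unit_box. Const C * sq_dist_poly c - (p - Const (eval_at c p)) * (p - Const (eval_at c p)) \<in> cone"
    and D: "D \<ge> 0"
      "\<forall>c\<in>unit_box. Const D * sq_dist_poly c - (q - Const (eval_at c q)) * (q - Const (eval_at c q)) \<in> cone"
    by blast
  obtain A where A: "A \<ge> 0" "Const A - q * q \<in> cone"
    using square_bounded by blast
  obtain B where B: "\<forall>c\<in>unit_box. \<bar>eval_at c (p * p)\<bar> \<le> B"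
    using eval_at_bounded_on_unit_box by blast
  have "0 \<in> (unit_box :: (real ^ 'e) set)" by (simp add: unit_box_def)
  then have B0: "0 \<le> B" using B by fastforce
  show ?case
  proof (intro exI[of _ "2 * (C * A) + 2 * (B * D)"] conjI ballI)
    fix c :: "real ^ 'e" assume c: "c \<in> unit_box"
    define u v d a where "u = p - Const (eval_at c p)" and "v = q - Const (eval_at c q)"
      and "d = sq_dist_poly c" and "a = eval_at c p"
    have a: "B - a * a \<ge> 0"
      using B c by (auto simp: a_def eval_at_mult)
    \<comment> \<open>The factor \<open>q\<close> is not frozen at \<open>c\<close> and must be
      bounded as a polynomial, by \<open>A\<close>; the product of \<open>d\<close> and
      \<open>Const A - q * q\<close> is in the cone by product closure.\<close>
    have 1: "q * q * (Const C * d - u * u) + Const C * (d * (Const A - q * q)) \<in> cone"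
      unfolding u_def d_def
      by (rule cone_add[OF cone_square_mult cone_scale[OF C(1) cone_mult]])
        (use A C c sq_dist_poly_in_cone in auto)
    have 2: "Const B * (Const D * d - v * v) + Const (B - a * a) * (v * v) \<in> cone"
      using B0 D c a by (intro cone_add cone_scale cone_square) (auto simp: v_def d_def)
    have "Const 2 * (q * q * (Const C * d - u * u) + Const C * (d * (Const A - q * q)))
        + Const 2 * (Const B * (Const D * d - v * v) + Const (B - a * a) * (v * v))
        + (u * q - Const a * v) * (u * q - Const a * v) \<in> cone"
      by (rule cone_add[OF cone_add[OF cone_scale[OF _ 1] cone_scale[OF _ 2]] cone_square]) auto
    also have "Const 2 * (q * q * (Const C * d - u * u) + Const C * (d * (Const A - q * q)))
        + Const 2 * (Const B * (Const D * d - v * v) + Const (B - a * a) * (v * v))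
        + (u * q - Const a * v) * (u * q - Const a * v)
        = Const (2 * (C * A) + 2 * (B * D)) * d - (u * q + Const a * v) * (u * q + Const a * v)"
      by (simp add: Const_add Const_mult Const_diff Const_numeral algebra_simps)
    also have "u * q + Const a * v = p * q - Const (eval_at c (p * q))"
      by (simp add: u_def v_def a_def eval_at_mult Const_mult algebra_simps)
    finally show "Const (2 * (C * A) + 2 * (B * D)) * sq_dist_poly c
        - (p * q - Const (eval_at c (p * q))) * (p * q - Const (eval_at c (p * q))) \<in> cone"
      by (simp add: d_def)
  qed (use A B0 C D in simp)
qed

text \<open>Not a vanishing set: these points, whose evaluation is nonnegative on the whole cone,
  substitute for the support of a representing measure.\<close>

definition zeros :: "(real ^ 'e) set" where
  "zeros = {c. \<forall>g\<in>cone. 0 \<le> eval_at c g}"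

lemma finite_certificates_off_zeros:
  assumes "closed N" "N \<subseteq> unit_box" "N \<inter> zeros = {}"
  shows "\<exists>\<G>. finite \<G> \<and> \<G> \<subseteq> cone \<and> (\<forall>c\<in>N. \<exists>g\<in>\<G>. eval_at c g < - 1)"
proof -
  have op: "open {c. eval_at c g < - 1}" for g
    by (intro open_Collect_less continuous_on_eval_at continuous_intros)
  have "compact N"
    using assms compact_unit_box by (metis compact_Int_closed inf.absorb_iff2)
  moreover have "N \<subseteq> (\<Union>g\<in>cone. {c. eval_at c g < - 1})"
  proof
    fix c assume "c \<in> N"
    then obtain g where g: "g \<in> cone" "eval_at c g < 0"
      using assms(3) by (force simp: zeros_def)
    \<comment> \<open>Scaling to the value -2 leaves room for the strict bound -1, so that the open
      cover by sets below -1 has a common margin.\<close>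
    define l where "l = - 2 / eval_at c g"
    have "l \<ge> 0" using g by (simp add: l_def)
    moreover have "eval_at c (Const l * g) = - 2"
      using g by (simp add: l_def Lfun_Const_mult)
    ultimately show "c \<in> (\<Union>g\<in>cone. {c. eval_at c g < - 1})"
      using cone_scale[OF _ g(1), of l] by force
  qed
  ultimately obtain \<G> where "\<G> \<subseteq> cone" "finite \<G>" "N \<subseteq> (\<Union>g\<in>\<G>. {c. eval_at c g < - 1})"
    using compactE_image[where C = cone and f = "\<lambda>g. {c. eval_at c g < - 1}" and S = N] op by auto
  then show ?thesis by (intro exI[of _ \<G>]) auto
qed

text \<open>With \<open>u = p - p(c)\<close>, the square of \<open>u + 2 \<epsilon>\<close> gives
  \<open>u \<ge> - \<epsilon> - u\<^sup>2 / (4 \<epsilon>)\<close>, and the Lipschitz estimate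
  bounds \<open>u\<^sup>2\<close>.\<close>

lemma local_nonneg_at_point:
  assumes "0 \<le> C" "Const C * sq_dist_poly c - (p - Const (eval_at c p)) * (p - Const (eval_at c p)) \<in> cone"
    and "0 < \<epsilon>" "0 \<le> eval_at c p"
  shows "p + Const \<epsilon> + Const (C / (4 * \<epsilon>)) * sq_dist_poly c \<in> cone"
proof -
  define u a d where "u = p - Const (eval_at c p)" and "a = eval_at c p" and "d = sq_dist_poly c"
  have "Const (1 / (4 * \<epsilon>)) * (Const C * d - u * u)
      + Const (1 / (4 * \<epsilon>)) * ((u + Const (2 * \<epsilon>)) * (u + Const (2 * \<epsilon>))) + Const a \<in> cone"
    using assms by (intro cone_add cone_scale cone_square cone_Const) (auto simp: u_def d_def a_def)
  also have "Const (1 / (4 * \<epsilon>)) * (Const C * d - u * u)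
      + Const (1 / (4 * \<epsilon>)) * ((u + Const (2 * \<epsilon>)) * (u + Const (2 * \<epsilon>))) + Const a
      = Const (1 / (4 * \<epsilon>)) * Const C * d + (Const (1 / (4 * \<epsilon>)) * Const (2 * \<epsilon>) + Const (1 / (4 * \<epsilon>)) * Const (2 * \<epsilon>)) * u
        + Const (1 / (4 * \<epsilon>)) * Const (2 * \<epsilon>) * Const (2 * \<epsilon>) + Const a"
    by (simp add: algebra_simps)
  also have "\<dots> = Const (C / (4 * \<epsilon>)) * d + u + Const \<epsilon> + Const a"
    using assms(3) by (simp flip: Const_mult Const_add)
  also have "\<dots> = p + Const \<epsilon> + Const (C / (4 * \<epsilon>)) * d"
    by (simp add: u_def a_def)
  finally show ?thesis by (simp add: d_def)
qed

text \<open>Covers points where \<open>p\<close> may be negative. Since \<open>g\<close> is in the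
  cone while \<open>g(c) < - 1\<close>, the Lipschitz estimate puts \<open>C d - 1\<close> into the
  cone for \<open>d = |x - c|\<^sup>2\<close>; in the order of the cone the distance to
  \<open>c\<close> is bounded away from 0. Then \<open>B\<close> times this compensates the lower
  bound \<open>- B\<close> of \<open>p\<close>.\<close>

lemma local_nonneg_by_certificate:
  assumes "Const C * sq_dist_poly c - (g - Const (eval_at c g)) * (g - Const (eval_at c g)) \<in> cone"
    and "g \<in> cone" "eval_at c g < - 1"
    and "0 \<le> B" "p + Const B \<in> cone"
  shows "p + Const (B * C) * sq_dist_poly c \<in> cone"
proof -
  define u a d where "u = g - Const (eval_at c g)" and "a = eval_at c g" and "d = sq_dist_poly c"
  have "Const B * ((Const C * d - u * u) + ((u - 1) * (u - 1)) + Const 2 * g + Const (- 2 - 2 * a)) \<in> cone"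
    using assms by (intro cone_add cone_scale cone_square cone_Const) (auto simp: u_def d_def a_def)
  from cone_add[OF this assms(5)]
  have "Const B * ((Const C * d - u * u) + ((u - 1) * (u - 1)) + Const 2 * g + Const (- 2 - 2 * a))
      + (p + Const B) \<in> cone" .
  also have "(Const C * d - u * u) + ((u - 1) * (u - 1)) + Const 2 * g + Const (- 2 - 2 * a)
      = Const C * d - 1"
    by (simp add: u_def a_def Const_diff Const_mult Const_numeral Const_uminus algebra_simps)
  also have "Const B * (Const C * d - 1) + (p + Const B) = p + Const (B * C) * d"
    by (simp add: Const_mult algebra_simps)
  finally show ?thesis by (simp add: d_def)
qed

lemma local_nonneg:
  assumes pos: "\<And>c. c \<in> zeros \<Longrightarrow> 0 < eval_at c p" and \<epsilon>: "0 < \<epsilon>"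
  shows "\<exists>M. \<forall>c\<in>unit_box. p + Const \<epsilon> + Const M * sq_dist_poly c \<in> cone"
proof -
  \<comment> \<open>Positivity on \<open>zeros\<close> makes \<open>N\<close> disjoint from it, so
    finitely many certificates handle \<open>N\<close>; off \<open>N\<close> the value at
    \<open>c\<close> is already positive.\<close>
  define N where "N = {c\<in>unit_box. eval_at c p \<le> 0}"
  have "closed N"
    unfolding N_def Collect_conj_eq Collect_mem_eq
    by (intro closed_Int compact_imp_closed compact_unit_box closed_Collect_le continuous_on_eval_at continuous_intros)
  then obtain \<G> where \<G>: "finite \<G>" "\<G> \<subseteq> cone" "\<forall>c\<in>N. \<exists>g\<in>\<G>. eval_at c g < - 1"
    using finite_certificates_off_zeros[of N] pos by (force simp: N_def)
  have "\<exists>C. \<forall>g. C g \<ge> 0 \<and> (\<forall>c\<in>unit_box.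
      Const (C g) * sq_dist_poly c - (g - Const (eval_at c g)) * (g - Const (eval_at c g)) \<in> cone)"
    by (intro choice allI square_increment_bounded)
  then obtain C where C: "\<And>g. C g \<ge> 0" "\<And>g c. c \<in> unit_box \<Longrightarrow>
      Const (C g) * sq_dist_poly c - (g - Const (eval_at c g)) * (g - Const (eval_at c g)) \<in> cone"
    by blast
  obtain B where B: "B > 0" "p + Const B \<in> cone"
    using bounded_above[of "- p"] by (metis add.commute diff_minus_eq_add)
  \<comment> \<open>Enlarging the coefficient of the squared distance is harmless, so a single
    \<open>M\<close> above the constants of both cases works for every \<open>c\<close>.\<close>
  define M where "M = C p / (4 * \<epsilon>) + (\<Sum>g\<in>\<G>. B * C g)"
  have weaken: "p + Const \<epsilon> + Const M * sq_dist_poly c \<in> cone"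
    if "p + Const \<epsilon> + Const M' * sq_dist_poly c \<in> cone" "M' \<le> M" for c M'
  proof -
    have "p + Const \<epsilon> + Const M' * sq_dist_poly c + Const (M - M') * sq_dist_poly c \<in> cone"
      using that by (intro cone_add[OF that(1)] cone_scale sq_dist_poly_in_cone) auto
    then show ?thesis by (simp add: Const_diff algebra_simps)
  qed
  show ?thesis
  proof (intro exI[of _ M] ballI)
    fix c :: "real ^ 'e" assume c: "c \<in> unit_box"
    show "p + Const \<epsilon> + Const M * sq_dist_poly c \<in> cone"
    proof (cases "c \<in> N")
      case False
      then have "p + Const \<epsilon> + Const (C p / (4 * \<epsilon>)) * sq_dist_poly c \<in> cone"
        using C c \<epsilon> by (intro local_nonneg_at_point) (auto simp: N_def)
      then show ?thesis
        by (rule weaken) (use B C in \<open>simp add: M_def sum_nonneg\<close>)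
    next
      case True
      then obtain g where g: "g \<in> \<G>" "eval_at c g < - 1" using \<G> by blast
      then have "p + Const (B * C g) * sq_dist_poly c \<in> cone"
        using B C c \<G> by (intro local_nonneg_by_certificate[where g = g]) auto
      then have "p + Const \<epsilon> + Const (B * C g) * sq_dist_poly c \<in> cone"
        using cone_add[OF _ cone_Const[of \<epsilon>]] \<epsilon> by (fastforce simp: algebra_simps)
      moreover have "B * C g \<le> (\<Sum>g\<in>\<G>. B * C g)"
        using B C \<G> g by (intro member_le_sum) auto
      ultimately show ?thesis
        using C \<epsilon> by (intro weaken[of "B * C g"]) (auto simp: M_def intro: add_increasing)
    qed
  qed
qed

text \<open>Averaging the pointwise bounds over the grid reached by the walk replaces the squared distance by
  the variance, which is of order \<open>1 / N\<close>.\<close>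

lemma averaged_nonneg:
  assumes "\<forall>c\<in>unit_box. p + Const \<epsilon> + Const M * sq_dist_poly c \<in> cone" and N: "0 < N"
  shows "p + Const \<epsilon> + Const (M / real N) * (\<Sum>e\<in>UNIV. 1 - Var e * Var e) \<in> cone"
proof -
  \<comment> \<open>The affine map from \<open>[-1, 1]\<close> to \<open>[0, 1]\<close> makes
    \<open>t e\<close> a formal probability, and \<open>pt\<close> sends step counts back to a grid
    in the box. With these choices the walk is the Bernstein operator.\<close>
  define t where "t e = Const (1 / 2) * (1 + Var e)" for e :: 'e
  define pt where "pt k = (\<chi> e. 2 * real (k e) / real N - 1)" for k :: "'e \<Rightarrow> nat"
  have half: "Const (1 / 2) * (2 * x) = x" for x :: "'e mpoly"
  proof -
    have "Const (1 / 2) * 2 = (1 :: 'e mpoly)"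
      using Const_mult[of "1 / 2" 2] by (simp add: Const_numeral)
    then show ?thesis by (simp flip: mult.assoc)
  qed
  have one_minus_t: "1 - t e = Const (1 / 2) * (1 - Var e)" for e
  proof -
    have "1 - t e = Const (1 / 2) * (2 * 1) - Const (1 / 2) * (1 + Var e)"
      by (simp only: half t_def)
    also have "\<dots> = Const (1 / 2) * (1 - Var e)"
      by (simp add: algebra_simps)
    finally show ?thesis .
  qed
  \<comment> \<open>Linear bounds come from the quadratic box constraint:
    \<open>2 (1 + x) = (1 - x\<^sup>2) + (1 + x)\<^sup>2\<close>, and likewise for
    \<open>1 - x\<close>.\<close>
  have "Const (1 / 2) * ((1 - Var e * Var e) + (1 + Var e) * (1 + Var e)) \<in> cone" for e
    by (intro cone_scale cone_add cone_square cone_box) simp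
  also have "Const (1 / 2) * ((1 - Var e * Var e) + (1 + Var e) * (1 + Var e)) = 1 + Var e" for e :: 'e
  proof -
    have "(1 - Var e * Var e) + (1 + Var e) * (1 + Var e) = 2 * (1 + Var e)"
      by (simp add: algebra_simps)
    then show ?thesis by (simp only: half)
  qed
  finally have t1: "t e \<in> cone" for e
    by (auto simp: t_def intro: cone_scale)
  have "Const (1 / 2) * (Const (1 / 2) * ((1 - Var e * Var e) + (1 - Var e) * (1 - Var e))) \<in> cone" for e
    by (intro cone_scale cone_add cone_square cone_box) simp_all
  also have "Const (1 / 2) * (Const (1 / 2) * ((1 - Var e * Var e) + (1 - Var e) * (1 - Var e)))
      = Const (1 / 2) * (1 - Var e)" for e :: 'e
  proof -
    have "(1 - Var e * Var e) + (1 - Var e) * (1 - Var e) = 2 * (1 - Var e)"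
      by (simp add: algebra_simps)
    then show ?thesis by (simp only: half)
  qed
  also have "Const (1 / 2) * (1 - Var e) = 1 - t e" for e :: 'e
    using one_minus_t[of e] by simp
  finally have t2: "1 - t e \<in> cone" for e .
  obtain es :: "'e list" where es: "\<forall>e. count_list es e = N"
    using ex_list_uniform_count by blast
  have variance: "walk t es (\<lambda>k. (Var e - Const (pt k $ e)) * (Var e - Const (pt k $ e)))
      = Const (1 / real N) * (1 - Var e * Var e)" for e
  proof -
    \<comment> \<open>The shift \<open>s = - N * t e\<close> cancels the mean in
      \<open>walk_second_moment\<close> and leaves the variance
      \<open>N * t e * (1 - t e)\<close>.\<close>
    have diff: "Var e - Const (pt k $ e) = Const (- 2 / real N) * (of_nat (k e) + (- Const (real N) * t e))" for k
    proof -
      have "Const (- 2 / real N) * (of_nat (k e) + (- Const (real N) * t e))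
          = Const (- 2 / real N) * Const (real (k e)) - Const (- 2 / real N) * Const (real N) * Const (1/2) * (1 + Var e)"
        by (simp add: of_nat_eq_Const t_def algebra_simps)
      also have "\<dots> = Const (- 2 * real (k e) / real N) + (1 + Var e)"
        using N by (simp flip: Const_mult add: Const_uminus)
      also have "\<dots> = Var e - Const (pt k $ e)"
        by (simp add: pt_def Const_diff Const_uminus)
      finally show ?thesis by simp
    qed
    have "(\<lambda>k. (Var e - Const (pt k $ e)) * (Var e - Const (pt k $ e)))
        = (\<lambda>k. Const (- 2 / real N) * Const (- 2 / real N) *
            ((of_nat (k e) + (- Const (real N) * t e)) * (of_nat (k e) + (- Const (real N) * t e))))"
      by (intro ext) (simp only: diff ac_simps)
    then have "walk t es (\<lambda>k. (Var e - Const (pt k $ e)) * (Var e - Const (pt k $ e)))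
        = Const (- 2 / real N) * Const (- 2 / real N) * (Const (real N) * (t e * (1 - t e)))"
      using es walk_second_moment[of t es e "- Const (real N) * t e"]
      by (simp add: walk_mult of_nat_eq_Const)
    also have "\<dots> = Const (4 / real N) * (t e * (1 - t e))"
      using N by (simp flip: Const_mult mult.assoc)
    also have "t e * (1 - t e) = Const (1 / 4) * (1 - Var e * Var e)"
    proof -
      have "t e * (1 - t e) = Const (1 / 2) * Const (1 / 2) * (1 - Var e * Var e)"
        unfolding one_minus_t by (simp add: t_def algebra_simps)
      then show ?thesis by (simp flip: Const_mult)
    qed
    finally show ?thesis by (simp flip: Const_mult mult.assoc)
  qed
  have "walk t es (\<lambda>k. p + Const \<epsilon> + Const M * sq_dist_poly (pt k)) \<in> cone"
  proof (rule cone_walk[OF t1 t2])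
    fix k :: "'e \<Rightarrow> nat" assume "\<And>e. k e \<le> count_list es e"
    then have "pt k \<in> unit_box"
      using N es by (auto simp: unit_box_def pt_def abs_le_iff field_simps)
    then show "p + Const \<epsilon> + Const M * sq_dist_poly (pt k) \<in> cone"
      using assms by blast
  qed
  \<comment> \<open>The polynomial \<open>p\<close> stays in the variables and does not depend on
    the grid point, so averaging reproduces it exactly; only the squared distance is
    affected.\<close>
  also have "walk t es (\<lambda>k. p + Const \<epsilon> + Const M * sq_dist_poly (pt k))
      = p + Const \<epsilon> + Const M * (\<Sum>e\<in>UNIV. walk t es (\<lambda>k.
          (Var e - Const (pt k $ e)) * (Var e - Const (pt k $ e))))"
    by (simp add: walk_add walk_const walk_mult sq_dist_poly_def walk_sum)
  also have "\<dots> = p + Const \<epsilon> + Const (M / real N) * (\<Sum>e\<in>UNIV. 1 - Var e * Var e)"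
    by (simp add: variance flip: sum_distrib_left Const_mult mult.assoc)
  finally show ?thesis .
qed

text \<open>\<open>M\<close> depends on \<open>\<epsilon>\<close>, so the grid is refined first,
  with \<open>\<epsilon>\<close> fixed, and \<open>\<epsilon>\<close> tends to 0 afterwards.\<close>

theorem Lfun_nonneg_if_pos_on_zeros:
  assumes "\<And>c. c \<in> zeros \<Longrightarrow> 0 < eval_at c p"
  shows "0 \<le> Lfun z p"
proof -
  define W where "W = Lfun z (\<Sum>e\<in>UNIV. 1 - Var e * Var e)"
  have eps: "0 \<le> Lfun z p + \<epsilon> * z 0" if "\<epsilon> > 0" for \<epsilon>
  proof -
    obtain M where M: "\<forall>c\<in>unit_box. p + Const \<epsilon> + Const M * sq_dist_poly c \<in> cone"
      using local_nonneg assms \<open>\<epsilon> > 0\<close> by blast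
    have "0 \<le> Lfun z p + \<epsilon> * z 0 + M / real (Suc n) * W" for n
      using cone_Lfun[OF averaged_nonneg[OF M, of "Suc n"]]
      unfolding Lfun_add Lfun_Const_mult Lfun_Const W_def by simp
    moreover have "(\<lambda>n. Lfun z p + \<epsilon> * z 0 + M / real (Suc n) * W)
        \<longlonglongrightarrow> Lfun z p + \<epsilon> * z 0 + 0 * W"
      by (intro tendsto_intros LIMSEQ_Suc[OF lim_const_over_n])
    ultimately show ?thesis by (intro LIMSEQ_le_const) auto
  qed
  have "(\<lambda>n. Lfun z p + 1 / real (Suc n) * z 0) \<longlonglongrightarrow> Lfun z p + 0 * z 0"
    by (intro tendsto_intros LIMSEQ_Suc[OF lim_const_over_n])
  moreover have "0 \<le> Lfun z p + 1 / real (Suc n) * z 0" for n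
    by (intro eps) simp
  ultimately show ?thesis by (intro LIMSEQ_le_const) auto
qed

end

section \<open>Symmetric matrices and the pseudo-inverse\<close>

lemma scalar_prod_self_eq_0:
  assumes "v \<in> carrier_vec n" "scalar_prod v (v :: real vec) = 0"
  shows "v = 0\<^sub>v n"
proof -
  have "\<forall>i\<in>{0..<n}. vec_index v i * vec_index v i = 0"
    using assms by (subst sum_nonneg_eq_0_iff[symmetric]) (auto simp: scalar_prod_def)
  then show ?thesis using assms by (intro eq_vecI) auto
qed

lemma symmetric_scalar_prod:
  fixes A :: "real mat"
  assumes "A \<in> carrier_mat n n" "transpose_mat A = A" "x \<in> carrier_vec n" "y \<in> carrier_vec n"
  shows "scalar_prod x (A *\<^sub>v y) = scalar_prod (A *\<^sub>v x) y"
  using transpose_vec_mult_scalar[of A n n y x] assms by simp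

text \<open>The projection is one of maximal trace among the symmetric idempotents annihilated by \<open>A\<close>: a
  common kernel vector would allow increasing the trace by 1, but traces are at most \<open>n\<close>.\<close>

lemma ex_kernel_projection:
  fixes A :: "real mat"
  assumes A: "A \<in> carrier_mat n n"
  shows "\<exists>P\<in>carrier_mat n n. transpose_mat P = P \<and> P * P = P \<and> A * P = 0\<^sub>m n n \<and>
    (\<forall>x\<in>carrier_vec n. A *\<^sub>v x = 0\<^sub>v n \<longrightarrow> P *\<^sub>v x = 0\<^sub>v n \<longrightarrow> x = 0\<^sub>v n)"
proof -
  define proj where "proj P \<longleftrightarrow> P \<in> carrier_mat n n \<and> transpose_mat P = P \<and> P * P = P \<and> A * P = 0\<^sub>m n n" for P
  \<comment> \<open>Traces are recorded as natural numbers, so boundedness alone provides a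
    maximum.\<close>
  define T where "T k \<longleftrightarrow> (\<exists>P. proj P \<and> (\<Sum>i<n. P $$ (i, i)) = real k)" for k
  have "T 0"
    unfolding T_def proj_def using A by (intro exI[of _ "0\<^sub>m n n"]) simp
  have bound: "k \<le> n" if Tk: "T k" for k
  proof -
    obtain P where P: "proj P" and tr: "(\<Sum>i<n. P $$ (i, i)) = real k"
      using Tk unfolding T_def by blast
    \<comment> \<open>A diagonal entry of a symmetric idempotent is the squared norm of its row,
      hence at least its own square.\<close>
    have le1: "P $$ (i, i) \<le> 1" if i: "i < n" for i
    proof -
      have Pc: "P \<in> carrier_mat n n" and sym: "\<And>j. j < n \<Longrightarrow> P $$ (j, i) = P $$ (i, j)"
        and idem: "P * P = P"
        using P i unfolding proj_def by (auto, metis carrier_matD index_transpose_mat(1))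
      have "P $$ (i, i) = (P * P) $$ (i, i)"
        by (simp add: idem)
      also have "\<dots> = (\<Sum>j\<in>{0..<n}. P $$ (i, j) * P $$ (j, i))"
        using Pc i by (auto simp: scalar_prod_def intro!: sum.cong)
      also have "\<dots> = (\<Sum>j\<in>{0..<n}. P $$ (i, j) * P $$ (i, j))"
        by (intro sum.cong) (auto simp: sym)
      also have "\<dots> \<ge> P $$ (i, i) * P $$ (i, i)"
        using i by (intro member_le_sum) auto
      finally have "P $$ (i, i) * P $$ (i, i) \<le> P $$ (i, i)" .
      then show ?thesis
        by (metis mult_le_cancel_left1 mult_le_cancel_left2 linorder_not_le mult.commute zero_less_one order_less_le_trans order_less_imp_le)
    qed
    have "real k \<le> (\<Sum>i<n. 1)"
      unfolding tr[symmetric] by (intro sum_mono le1) simp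
    then show ?thesis by simp
  qed
  obtain k where k: "T k" "\<And>j. T j \<Longrightarrow> j \<le> k"
    using \<open>T 0\<close> bound by (metis GreatestI_nat Greatest_le_nat)
  then obtain P where P: "proj P" and tr: "(\<Sum>i<n. P $$ (i, i)) = real k"
    unfolding T_def by blast
  have Pc: "P \<in> carrier_mat n n" and Ps: "transpose_mat P = P" and PP: "P * P = P" and AP: "A * P = 0\<^sub>m n n"
    using P by (auto simp: proj_def)
  have "x = 0\<^sub>v n" if x: "x \<in> carrier_vec n" and Ax: "A *\<^sub>v x = 0\<^sub>v n" and Px: "P *\<^sub>v x = 0\<^sub>v n" for x
  proof (rule ccontr)
    assume "x \<noteq> 0\<^sub>v n"
    then have nz: "scalar_prod x x \<noteq> 0"
      using x scalar_prod_self_eq_0 by blast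
    define c where "c = 1 / scalar_prod x x"
    \<comment> \<open>The orthogonal projection onto the line of \<open>x\<close>, of trace 1. Both
      \<open>A\<close> and \<open>P\<close> annihilate \<open>x\<close>, so \<open>P + R\<close>
      again satisfies \<open>proj\<close>.\<close>
    define R where "R = mat n n (\<lambda>(i, j). c * (vec_index x i * vec_index x j))"
    have Rc: "R \<in> carrier_mat n n" by (simp add: R_def)
    have Rs: "transpose_mat R = R"
      by (intro eq_matI) (auto simp: R_def)
    have MR: "M * R = 0\<^sub>m n n" if "M \<in> carrier_mat n n" "M *\<^sub>v x = 0\<^sub>v n" for M
    proof (intro eq_matI)
      fix i j assume "i < dim_row (0\<^sub>m n n :: real mat)" "j < dim_col (0\<^sub>m n n :: real mat)"
      then have ij: "i < n" "j < n" by auto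
      have "(M * R) $$ (i, j) = (\<Sum>k\<in>{0..<n}. M $$ (i, k) * (c * (vec_index x k * vec_index x j)))"
        using that ij by (auto simp: R_def scalar_prod_def intro!: sum.cong)
      also have "\<dots> = c * vec_index x j * (\<Sum>k\<in>{0..<n}. M $$ (i, k) * vec_index x k)"
        unfolding sum_distrib_left by (intro sum.cong) auto
      also have "(\<Sum>k\<in>{0..<n}. M $$ (i, k) * vec_index x k) = vec_index (M *\<^sub>v x) i"
        using that(1) ij x by (auto simp: scalar_prod_def intro!: sum.cong)
      finally show "(M * R) $$ (i, j) = 0\<^sub>m n n $$ (i, j)"
        unfolding that(2) using ij by simp
    qed (use that Rc in auto)
    have RR: "R * R = R"
    proof (intro eq_matI)
      fix i j assume "i < dim_row R" "j < dim_col R"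
      then have ij: "i < n" "j < n" using Rc by auto
      have "(R * R) $$ (i, j) = (\<Sum>k\<in>{0..<n}. c * (vec_index x i * vec_index x k) * (c * (vec_index x k * vec_index x j)))"
        using ij by (auto simp: R_def scalar_prod_def intro!: sum.cong)
      also have "\<dots> = c * (vec_index x i * vec_index x j) * (c * (\<Sum>k\<in>{0..<n}. vec_index x k * vec_index x k))"
        unfolding sum_distrib_left by (intro sum.cong) auto
      also have "(\<Sum>k\<in>{0..<n}. vec_index x k * vec_index x k) = scalar_prod x x"
        using x by (simp add: scalar_prod_def)
      finally show "(R * R) $$ (i, j) = R $$ (i, j)"
        using ij nz by (simp add: R_def c_def)
    qed (use Rc in auto)
    have PR: "P * R = 0\<^sub>m n n" using MR[OF Pc Px] .
    have RP: "R * P = 0\<^sub>m n n"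
      using arg_cong[OF PR, of transpose_mat] transpose_mult[OF Pc Rc] Ps Rs by simp
    have "proj (P + R)"
    proof -
      have "(P + R) * (P + R) = P + R"
        using Pc Rc by (simp add: add_mult_distrib_mat[of _ n n] mult_add_distrib_mat[of _ n n] PP RR PR RP)
      moreover have "A * (P + R) = 0\<^sub>m n n"
        using A Pc Rc by (simp add: mult_add_distrib_mat[of _ n n] AP MR[OF A Ax])
      ultimately show ?thesis
        using Pc Rc Ps Rs by (simp add: proj_def transpose_add[of P n n])
    qed
    moreover have "(\<Sum>i<n. (P + R) $$ (i, i)) = real (Suc k)"
    proof -
      have "(\<Sum>i<n. (P + R) $$ (i, i)) = real k + (\<Sum>i<n. c * (vec_index x i * vec_index x i))"
        using Pc Rc by (simp add: tr[symmetric] sum.distrib[symmetric] R_def)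
      also have "(\<Sum>i<n. c * (vec_index x i * vec_index x i)) = c * scalar_prod x x"
        using x by (simp add: scalar_prod_def sum_distrib_left atLeast0LessThan)
      finally show ?thesis using nz by (simp add: c_def)
    qed
    ultimately have "T (Suc k)" unfolding T_def by blast
    then show False using k(2) by fastforce
  qed
  then show ?thesis using Pc Ps PP AP by blast
qed

text \<open>With \<open>P\<close> from the kernel projection, \<open>A + P\<close> has trivial
  kernel and is invertible. Its inverse acts as the identity on the range of \<open>P\<close>, so
  subtracting \<open>P\<close> from it leaves the pseudo-inverse.\<close>

lemma ex_is_pinv_symmetric:
  fixes A :: "real mat"
  assumes A: "A \<in> carrier_mat n n" and As: "transpose_mat A = A"
  shows "\<exists>X. is_pinv A X"
proof -
  obtain P where P: "P \<in> carrier_mat n n" and Ps: "transpose_mat P = P" and PP: "P * P = P"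
    and AP: "A * P = 0\<^sub>m n n"
    and ker: "\<And>x. x \<in> carrier_vec n \<Longrightarrow> A *\<^sub>v x = 0\<^sub>v n \<Longrightarrow> P *\<^sub>v x = 0\<^sub>v n \<Longrightarrow> x = 0\<^sub>v n"
    using ex_kernel_projection[OF A] by blast
  have PA: "P * A = 0\<^sub>m n n"
    using arg_cong[OF AP, of transpose_mat] transpose_mult[OF A P] Ps As by simp
  define B where "B = A + P"
  have B: "B \<in> carrier_mat n n" using A P by (simp add: B_def)
  have Bs: "transpose_mat B = B" using A P As Ps by (simp add: B_def transpose_add[of A n n])
  have "x = 0\<^sub>v n" if x: "x \<in> carrier_vec n" and Bx: "B *\<^sub>v x = 0\<^sub>v n" for x
  proof -
    have sum: "A *\<^sub>v x + P *\<^sub>v x = 0\<^sub>v n"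
      using Bx A P x by (simp add: B_def add_mult_distrib_mat_vec[of _ n n])
    have "P *\<^sub>v (A *\<^sub>v x + P *\<^sub>v x) = (P * A) *\<^sub>v x + (P * P) *\<^sub>v x"
      using A P x by (simp add: mult_add_distrib_mat_vec[of _ n n])
    also have "\<dots> = 0\<^sub>m n n *\<^sub>v x + P *\<^sub>v x"
      by (simp add: PA PP)
    also have "0\<^sub>m n n *\<^sub>v x = 0\<^sub>v n"
      using x by (intro eq_vecI) auto
    also have "0\<^sub>v n + P *\<^sub>v x = P *\<^sub>v x"
      using P x by simp
    finally have "P *\<^sub>v x = P *\<^sub>v 0\<^sub>v n" by (simp add: sum)
    also have "\<dots> = 0\<^sub>v n" using P by (intro eq_vecI) auto
    finally have "P *\<^sub>v x = 0\<^sub>v n" .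
    moreover from this have "A *\<^sub>v x = 0\<^sub>v n"
      using sum A x by (metis mult_mat_vec_carrier right_zero_vec)
    ultimately show ?thesis using ker x by blast
  qed
  then have "det B \<noteq> 0"
    using det_0_iff_vec_prod_zero_field[OF B] by blast
  from det_non_zero_imp_unit[OF B this] obtain C where C: "C \<in> carrier_mat n n"
    and CB: "C * B = 1\<^sub>m n" and BC: "B * C = 1\<^sub>m n"
    unfolding Units_def ring_mat_def by auto
  have Cs: "transpose_mat C = C"
  proof -
    have "transpose_mat C * B = 1\<^sub>m n"
      using arg_cong[OF BC, of transpose_mat] transpose_mult[OF B C] Bs by simp
    then have "transpose_mat C * B * C = C" using C by simp
    then show ?thesis using B C BC by (simp add: assoc_mult_mat[of _ n n _ n _ n])
  qed
  have BP: "B * P = P"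
    using A P by (simp add: B_def add_mult_distrib_mat[of _ n n] AP PP)
  have CP: "C * P = P"
  proof -
    have "C * (B * P) = (C * B) * P" using B C P by simp
    then show ?thesis using P by (simp add: BP CB)
  qed
  have PC: "P * C = P"
    using arg_cong[OF CP, of transpose_mat] transpose_mult[OF C P] Cs Ps by simp
  have PB: "P * B = P"
    using arg_cong[OF BP, of transpose_mat] transpose_mult[OF B P] Bs Ps by simp
  define X where "X = C - P"
  have X: "X \<in> carrier_mat n n" unfolding X_def using P by (rule minus_carrier_mat)
  have minus_0: "M - 0\<^sub>m n n = M" if "M \<in> carrier_mat n n" for M :: "real mat"
    using that by (intro eq_matI) auto
  have AX: "A * X = 1\<^sub>m n - P"
  proof -
    have "A * X = A * C"
      using A C P by (simp add: X_def mult_minus_distrib_mat[of _ n n] AP minus_0)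
    also have "A * C = (B * C) - P * C"
      unfolding B_def using A C P
      by (simp add: add_mult_distrib_mat[of _ n n]) (intro eq_matI, auto)
    finally show ?thesis by (simp add: BC PC)
  qed
  have XA: "X * A = 1\<^sub>m n - P"
  proof -
    have "X * A = C * A"
      using A C P by (simp add: X_def minus_mult_distrib_mat[of _ n n] PA minus_0)
    also have "C * A = C * B - C * P"
      unfolding B_def using A C P
      by (simp add: mult_add_distrib_mat[of _ n n]) (intro eq_matI, auto)
    finally show ?thesis by (simp add: CB CP)
  qed
  have "A * X * A = A"
    unfolding AX using A P by (simp add: minus_mult_distrib_mat[of _ n n] PA minus_0)
  moreover have "X * A * X = X"
  proof -
    have "(1\<^sub>m n - P) * (C - P) = (C - P) - (P * C - P * P)"
      using C P X by (simp add: X_def minus_mult_distrib_mat[of "1\<^sub>m n" n n P "C - P" n]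
          mult_minus_distrib_mat[of P n n])
    also have "\<dots> = C - P"
      using C P by (simp add: PC PP) (intro eq_matI, auto)
    finally show ?thesis unfolding XA by (simp add: X_def)
  qed
  moreover have "transpose_mat (1\<^sub>m n - P) = 1\<^sub>m n - P"
    using P Ps by (simp add: transpose_minus[of _ n n])
  ultimately have "is_pinv A X"
    using A X by (simp add: is_pinv_def AX XA)
  then show ?thesis by blast
qed

text \<open>\<open>A * X\<close> and \<open>A * Y\<close> are symmetric and absorb each other, so
  transposition identifies them; likewise on the other side.\<close>

lemma is_pinv_unique:
  assumes X: "is_pinv A X" and Y: "is_pinv A Y"
  shows "X = Y"
proof -
  define m n where "m = dim_row A" and "n = dim_col A"
  have A: "A \<in> carrier_mat m n" by (simp add: m_def n_def)
  have Xc: "X \<in> carrier_mat n m" and Yc: "Y \<in> carrier_mat n m"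
    using X Y by (auto simp: is_pinv_def m_def n_def)
  have X1: "A * X * A = A" and X2: "X * A * X = X" and X3: "transpose_mat (A * X) = A * X"
    and X4: "transpose_mat (X * A) = X * A"
    using X by (auto simp: is_pinv_def)
  have Y1: "A * Y * A = A" and Y2: "Y * A * Y = Y" and Y3: "transpose_mat (A * Y) = A * Y"
    and Y4: "transpose_mat (Y * A) = Y * A"
    using Y by (auto simp: is_pinv_def)
  have c: "A * X \<in> carrier_mat m m" "A * Y \<in> carrier_mat m m" "X * A \<in> carrier_mat n n" "Y * A \<in> carrier_mat n n"
    using A Xc Yc by auto
  have "A * X = A * Y"
  proof -
    have "A * Y = (A * X) * (A * Y)"
      using assoc_mult_mat[OF c(1) A Yc] X1 by simp
    also have "\<dots> = transpose_mat ((A * Y) * (A * X))"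
      using transpose_mult[OF c(2) c(1)] X3 Y3 by simp
    also have "(A * Y) * (A * X) = A * X"
      using assoc_mult_mat[OF c(2) A Xc] Y1 by simp
    finally show ?thesis using X3 by simp
  qed
  moreover have "X * A = Y * A"
  proof -
    have "X * A = (X * A) * (Y * A)"
      using assoc_mult_mat[OF Xc A c(4)] assoc_mult_mat[OF A Yc A] Y1 by simp
    also have "\<dots> = transpose_mat ((Y * A) * (X * A))"
      using transpose_mult[OF c(4) c(3)] X4 Y4 by simp
    also have "(Y * A) * (X * A) = Y * A"
      using assoc_mult_mat[OF Yc A c(3)] assoc_mult_mat[OF A Xc A] X1 by simp
    finally show ?thesis using Y4 by simp
  qed
  ultimately have "X * A * X = Y * A * Y"
    using assoc_mult_mat[OF Yc A Xc] assoc_mult_mat[OF Yc A Yc] by simp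
  then show ?thesis using X2 Y2 by simp
qed

lemma is_pinv_pinv:
  assumes "A \<in> carrier_mat n n" "transpose_mat A = A"
  shows "is_pinv A (pinv A)"
  unfolding pinv_def
  using ex_is_pinv_symmetric[OF assms] is_pinv_unique by (metis theI)

text \<open>The residual \<open>f - A X f\<close> lies in the kernel, and it is orthogonal to itself
  because \<open>f\<close> and the range of \<open>A\<close> are orthogonal to the kernel.
  Orthogonality to the kernel stands in for membership in the image, as it transfers easily between
  stiffness matrices.\<close>

lemma pinv_solves:
  assumes A: "A \<in> carrier_mat n n" and As: "transpose_mat A = A" and f: "f \<in> carrier_vec n"
    and orth: "\<And>w. w \<in> carrier_vec n \<Longrightarrow> A *\<^sub>v w = 0\<^sub>v n \<Longrightarrow> scalar_prod f w = 0"
  shows "pinv A *\<^sub>v f \<in> carrier_vec n" "A *\<^sub>v (pinv A *\<^sub>v f) = f"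
proof -
  define X where "X = pinv A"
  have X: "X \<in> carrier_mat n n" and X1: "A * X * A = A" and X3: "transpose_mat (A * X) = A * X"
    using is_pinv_pinv[OF A As] A by (auto simp: is_pinv_def X_def)
  have AAX: "A * (A * X) = A"
  proof -
    have "A * (A * X) = transpose_mat A * transpose_mat (A * X)" by (simp add: As X3)
    also have "\<dots> = transpose_mat (A * X * A)"
      using A X by (intro transpose_mult[symmetric]) auto
    finally show ?thesis by (simp add: X1 As)
  qed
  show Xf: "pinv A *\<^sub>v f \<in> carrier_vec n"
    using X f unfolding X_def by simp
  define g where "g = A *\<^sub>v (X *\<^sub>v f)"
  have g: "g \<in> carrier_vec n" using A X f by (simp add: g_def)
  define w where "w = f - g"
  have w: "w \<in> carrier_vec n" using f g by (simp add: w_def)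
  have Ag: "A *\<^sub>v g = A *\<^sub>v f"
  proof -
    have "A *\<^sub>v g = (A * (A * X)) *\<^sub>v f"
      using A X f by (simp add: g_def assoc_mult_mat_vec[of _ n n _ n])
    then show ?thesis by (simp add: AAX)
  qed
  have Aw: "A *\<^sub>v w = 0\<^sub>v n"
    using A f g by (simp add: w_def mult_minus_distrib_mat_vec[of _ n n] Ag)
  have "scalar_prod w w = scalar_prod w f - scalar_prod w g"
    using f g w unfolding w_def[symmetric] by (subst (2) w_def) (rule scalar_prod_minus_distrib, auto)
  also have "scalar_prod w f = 0"
    using orth[OF w Aw] comm_scalar_prod[OF w f] by simp
  also have "scalar_prod w g = scalar_prod (A *\<^sub>v w) (X *\<^sub>v f)"
    unfolding g_def using A As w X f by (intro symmetric_scalar_prod) auto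
  also have "\<dots> = 0"
    using X f by (simp add: Aw)
  finally have "w = 0\<^sub>v n" using w scalar_prod_self_eq_0 by simp
  have "f = g"
  proof (rule eq_vecI)
    fix i assume "i < dim_vec g"
    then have "i < n" using g by simp
    then show "vec_index f i = vec_index g i"
      using arg_cong[OF \<open>w = 0\<^sub>v n\<close>, of "\<lambda>v. vec_index v i"] f g by (simp add: w_def)
  qed (use f g in simp)
  then show "A *\<^sub>v (pinv A *\<^sub>v f) = f"
    by (simp add: g_def X_def)
qed

section \<open>Compliance and the stiffness matrix\<close>

abbreviation qform :: "real mat \<Rightarrow> real vec \<Rightarrow> real" where
  "qform A v \<equiv> scalar_prod v (A *\<^sub>v v)"

lemma qform_eq_sum:
  assumes "A \<in> carrier_mat n n" "v \<in> carrier_vec n"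
  shows "qform A v = (\<Sum>p<n. \<Sum>q<n. vec_index v p * vec_index v q * A $$ (p, q))"
proof -
  have "qform A v = (\<Sum>p<n. vec_index v p * (\<Sum>q<n. A $$ (p, q) * vec_index v q))"
    using assms by (auto simp: scalar_prod_def atLeast0LessThan intro!: sum.cong)
  then show ?thesis
    by (simp add: sum_distrib_left ac_simps)
qed

lemma psd_mat_iff:
  "A \<in> carrier_mat n n \<Longrightarrow>
    psd_mat A \<longleftrightarrow> transpose_mat A = A \<and> (\<forall>v\<in>carrier_vec n. 0 \<le> qform A v)"
  by (auto simp: psd_mat_def)

lemma qform_add_smult:
  fixes A :: "real mat"
  assumes A: "A \<in> carrier_mat n n" "transpose_mat A = A" and x: "x \<in> carrier_vec n" and y: "y \<in> carrier_vec n"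
  shows "qform A (x + t \<cdot>\<^sub>v y) = qform A x + 2 * t * scalar_prod y (A *\<^sub>v x) + t * t * qform A y"
proof -
  have "scalar_prod x (A *\<^sub>v y) = scalar_prod (A *\<^sub>v x) y"
    using symmetric_scalar_prod[OF A x y] .
  also have "\<dots> = scalar_prod y (A *\<^sub>v x)"
    using A x y by (intro comm_scalar_prod) auto
  finally have sym: "scalar_prod x (A *\<^sub>v y) = scalar_prod y (A *\<^sub>v x)" .
  have "A *\<^sub>v (x + t \<cdot>\<^sub>v y) = A *\<^sub>v x + t \<cdot>\<^sub>v (A *\<^sub>v y)"
    using A x y by (simp add: mult_add_distrib_mat_vec[of _ n n] mult_mat_vec[of _ n n])
  moreover have "A *\<^sub>v x \<in> carrier_vec n" "A *\<^sub>v y \<in> carrier_vec n"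
    using A x y by auto
  ultimately show ?thesis
    using x y sym by (simp add: add_scalar_prod_distrib[of _ n] scalar_prod_add_distrib[of _ n] algebra_simps)
qed

lemma linear_le_quadratic_imp_0:
  fixes b c :: real
  assumes "\<And>t. 0 \<le> t * b + t * t * c"
  shows "b = 0"
proof (rule ccontr)
  assume b: "b \<noteq> 0"
  \<comment> \<open>Any positive \<open>k > c\<close> would do: at \<open>t = - b / k\<close> the
    expression is \<open>b\<^sup>2 (c - k) / k\<^sup>2 < 0\<close>.\<close>
  define k where "k = \<bar>c\<bar> + 1"
  have k: "k > 0" "c \<le> k - 1" "k - 1 \<ge> 0" by (auto simp: k_def)
  have "0 \<le> (- b / k) * b + (- b / k) * (- b / k) * c" by (rule assms)
  also have "\<dots> \<le> (- b / k) * b + (- b / k) * (- b / k) * (k - 1)"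
    using k by (intro add_left_mono mult_left_mono) auto
  also have "\<dots> = - (b * b) / (k * k)"
    using k by (simp add: field_simps)
  also have "\<dots> < 0"
  proof (rule divide_neg_pos)
    show "- (b * b) < 0" using b by (auto simp: zero_less_mult_iff linorder_neq_iff)
    show "0 < k * k" using k by simp
  qed
  finally show False by simp
qed

text \<open>Moving from \<open>x\<close> in the direction \<open>A x\<close> changes the form by
  \<open>2 t |A x|\<^sup>2\<close> to first order, which nonnegativity forces to vanish.\<close>

lemma psd_qform_0_imp_kernel:
  assumes A: "A \<in> carrier_mat n n" "psd_mat A" and x: "x \<in> carrier_vec n" and "qform A x = 0"
  shows "A *\<^sub>v x = 0\<^sub>v n"
proof -
  define y where "y = A *\<^sub>v x"
  have y: "y \<in> carrier_vec n" using A x by (simp add: y_def)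
  have pos: "0 \<le> qform A (x + t \<cdot>\<^sub>v y)" for t
    using A x y psd_mat_iff[OF A(1)] by auto
  have "0 \<le> t * (2 * scalar_prod y y) + t * t * qform A y" for t
  proof -
    have "qform A (x + t \<cdot>\<^sub>v y) = 0 + 2 * t * scalar_prod y y + t * t * qform A y"
      using qform_add_smult[OF A(1) _ x y, of t] psd_mat_iff[OF A(1)] A assms(4)
      unfolding y_def by simp
    with pos[of t] show ?thesis by (simp add: algebra_simps)
  qed
  then have "2 * scalar_prod y y = 0"
    by (rule linear_le_quadratic_imp_0)
  then show ?thesis
    using scalar_prod_self_eq_0[OF y] by (simp add: y_def)
qed

section \<open>Stiffness and compliance of a single load case\<close>

locale stiffness_model =
  fixes n :: nat and K0 :: "real mat" and K :: "'e::finite \<Rightarrow> nat \<Rightarrow> real mat"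
  assumes K0: "K0 \<in> carrier_mat n n" "psd_mat K0"
    and K: "\<And>e i. i \<in> {1..3} \<Longrightarrow> K e i \<in> carrier_mat n n" "\<And>e i. i \<in> {1..3} \<Longrightarrow> psd_mat (K e i)"
begin

text \<open>The constraint of the weight problem for one load case, free of the pseudo-inverse. It
  includes that \<open>f\<close> lies in the image, where alone the compliance is
  meaningful.\<close>

definition solvable_within :: "real vec \<Rightarrow> real \<Rightarrow> real ^ 'e \<Rightarrow> bool" where
  "solvable_within f c a \<longleftrightarrow>
     (\<exists>u\<in>carrier_vec n. stiffness K0 K a *\<^sub>v u = f \<and> scalar_prod f u \<le> c)"

lemma stiffness_carrier [simp]: "stiffness K0 K a \<in> carrier_mat n n"
  using K0 by (simp add: stiffness_def)

lemma psd_mat_index_sym: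
  assumes "psd_mat A" "A \<in> carrier_mat n n" "p < n" "q < n"
  shows "A $$ (p, q) = A $$ (q, p)"
proof -
  have "A $$ (p, q) = transpose_mat A $$ (q, p)"
    using assms(2-) by simp
  also have "transpose_mat A = A"
    using assms(1) by (simp add: psd_mat_def)
  finally show ?thesis .
qed

lemma stiffness_symmetric: "transpose_mat (stiffness K0 K a) = stiffness K0 K a"
proof (rule eq_matI)
  fix p q assume "p < dim_row (stiffness K0 K a)" "q < dim_col (stiffness K0 K a)"
  then have pq: "p < n" "q < n" using stiffness_carrier[of a] by auto
  have "K e i $$ (q, p) = K e i $$ (p, q)" if "i \<in> {1..3}" for e i
    using psd_mat_index_sym K that pq by blast
  moreover have "K0 $$ (q, p) = K0 $$ (p, q)"
    using psd_mat_index_sym K0 pq by blast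
  ultimately show "transpose_mat (stiffness K0 K a) $$ (p, q) = stiffness K0 K a $$ (p, q)"
    using pq K0 by (simp add: stiffness_def)
qed (use K0 in \<open>auto simp: stiffness_def\<close>)

lemma qform_stiffness:
  assumes v: "v \<in> carrier_vec n"
  shows "qform (stiffness K0 K a) v = qform K0 v + (\<Sum>e\<in>UNIV. \<Sum>i=1..3. qform (K e i) v * (a $ e) ^ i)"
proof -
  have "(\<Sum>e\<in>UNIV. \<Sum>i=1..3. qform (K e i) v * (a $ e) ^ i)
      = (\<Sum>e\<in>UNIV. \<Sum>i=1..3. (\<Sum>p<n. \<Sum>q<n. vec_index v p * vec_index v q * K e i $$ (p, q)) * (a $ e) ^ i)"
    using K v by (intro sum.cong refl) (simp add: qform_eq_sum[of _ n])
  also have "\<dots> = (\<Sum>e\<in>UNIV. \<Sum>i=1..3. \<Sum>p<n. \<Sum>q<n. vec_index v p * vec_index v q * (K e i $$ (p, q) * (a $ e) ^ i))"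
    by (simp add: sum_distrib_right mult.assoc)
  also have "\<dots> = (\<Sum>e\<in>UNIV. \<Sum>p<n. \<Sum>i=1..3. \<Sum>q<n. vec_index v p * vec_index v q * (K e i $$ (p, q) * (a $ e) ^ i))"
    by (intro sum.cong refl sum.swap)
  also have "\<dots> = (\<Sum>p<n. \<Sum>e\<in>UNIV. \<Sum>i=1..3. \<Sum>q<n. vec_index v p * vec_index v q * (K e i $$ (p, q) * (a $ e) ^ i))"
    by (rule sum.swap)
  also have "\<dots> = (\<Sum>p<n. \<Sum>e\<in>UNIV. \<Sum>q<n. \<Sum>i=1..3. vec_index v p * vec_index v q * (K e i $$ (p, q) * (a $ e) ^ i))"
    by (intro sum.cong refl sum.swap)
  also have "\<dots> = (\<Sum>p<n. \<Sum>q<n. \<Sum>e\<in>UNIV. \<Sum>i=1..3. vec_index v p * vec_index v q * (K e i $$ (p, q) * (a $ e) ^ i))"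
    by (intro sum.cong refl sum.swap)
  finally show ?thesis
    using K0 v
    by (simp add: qform_eq_sum[of _ n] stiffness_def sum.distrib[symmetric] distrib_left sum_distrib_left)
qed

lemma qform_K_nonneg:
  assumes "v \<in> carrier_vec n"
  shows "0 \<le> qform K0 v" "i \<in> {1..3} \<Longrightarrow> 0 \<le> qform (K e i) v"
  using K0 K[of i e] assms by (auto simp: psd_mat_def)

lemma psd_stiffness:
  assumes "\<forall>e. 0 \<le> a $ e"
  shows "psd_mat (stiffness K0 K a)"
  using assms qform_K_nonneg
  by (subst psd_mat_iff[OF stiffness_carrier])
    (auto simp: stiffness_symmetric qform_stiffness intro!: sum_nonneg add_nonneg_nonneg mult_nonneg_nonneg)

lemma qform_stiffness_mono:
  assumes "\<forall>e. 0 \<le> a $ e" "\<forall>e. a $ e \<le> b $ e" "v \<in> carrier_vec n"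
  shows "qform (stiffness K0 K a) v \<le> qform (stiffness K0 K b) v"
  using assms qform_K_nonneg
  by (auto simp: qform_stiffness intro!: sum_mono mult_left_mono power_mono)

text \<open>The form at \<open>w\<close> is a sum of nonnegative terms, and which of them vanish
  does not depend on \<open>\<delta>\<close>. This carries the image condition from \<open>a\<close>
  over to its multiples.\<close>

lemma kernel_stiffness_scale:
  assumes a: "\<forall>e. 0 \<le> a $ e" and \<delta>: "0 < \<delta>" and w: "w \<in> carrier_vec n"
    and ker: "stiffness K0 K (\<delta> *\<^sub>R a) *\<^sub>v w = 0\<^sub>v n"
  shows "stiffness K0 K a *\<^sub>v w = 0\<^sub>v n"
proof -
  have nn: "0 \<le> (\<Sum>i=1..3. qform (K e i) w * (\<delta> * a $ e) ^ i)" for e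
    using a \<delta> qform_K_nonneg[OF w] by (intro sum_nonneg mult_nonneg_nonneg) auto
  have "qform (stiffness K0 K (\<delta> *\<^sub>R a)) w = 0"
    using w by (simp add: ker)
  then have 0: "qform K0 w + (\<Sum>e\<in>UNIV. \<Sum>i=1..3. qform (K e i) w * (\<delta> * a $ e) ^ i) = 0"
    using w by (simp add: qform_stiffness)
  then have "qform K0 w = 0"
    using qform_K_nonneg(1)[OF w] nn by (smt (verit, best) sum_nonneg)
  with 0 have "(\<Sum>e\<in>UNIV. \<Sum>i=1..3. qform (K e i) w * (\<delta> * a $ e) ^ i) = 0" by simp
  then have "(\<Sum>i=1..3. qform (K e i) w * (\<delta> * a $ e) ^ i) = 0" for e
    using nn by (subst (asm) sum_nonneg_eq_0_iff) auto
  then have "qform (K e i) w * (\<delta> * a $ e) ^ i = 0" if "i \<in> {1..3}" for e i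
    using a \<delta> qform_K_nonneg[OF w] that
    by (subst (asm) sum_nonneg_eq_0_iff)
      (auto simp del: mult_eq_0_iff power_eq_0_iff intro!: mult_nonneg_nonneg zero_le_power)
  then have "qform (K e i) w * (a $ e) ^ i = 0" if "i \<in> {1..3}" for e i
    using \<delta> that by fastforce
  then have "(\<Sum>e\<in>UNIV. \<Sum>i=1..3. qform (K e i) w * (a $ e) ^ i) = 0"
    by (intro sum.neutral ballI)
  then have "qform (stiffness K0 K a) w = 0"
    by (simp only: qform_stiffness[OF w] \<open>qform K0 w = 0\<close> add_0)
  then show ?thesis
    using psd_qform_0_imp_kernel[OF stiffness_carrier psd_stiffness[OF a] w] by blast
qed

text \<open>The image condition is given at \<open>a\<close> but used at
  \<open>\<delta> *\<^sub>R a\<close>. A small \<open>compliance\<close> alone would say nothing,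
  since the pseudo-inverse returns a value even for an unsolvable load.\<close>

lemma solvable_withinI_compliance:
  assumes f: "f \<in> carrier_vec n" and a: "\<forall>e. 0 \<le> a $ e" and \<delta>: "0 < \<delta>"
    and im: "f \<in> mat_image (stiffness K0 K a)"
    and c: "compliance f K0 K (\<delta> *\<^sub>R a) \<le> c"
  shows "solvable_within f c (\<delta> *\<^sub>R a)"
proof -
  obtain u where u: "u \<in> carrier_vec n" "f = stiffness K0 K a *\<^sub>v u"
    using im stiffness_carrier[of a] by (auto simp: mat_image_def)
  have "scalar_prod f w = 0" if w: "w \<in> carrier_vec n" "stiffness K0 K (\<delta> *\<^sub>R a) *\<^sub>v w = 0\<^sub>v n" for w
  proof -
    have "scalar_prod f w = scalar_prod u (stiffness K0 K a *\<^sub>v w)"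
      using u w symmetric_scalar_prod[OF stiffness_carrier stiffness_symmetric] by simp
    then show ?thesis
      using kernel_stiffness_scale[OF a \<delta> w] u by simp
  qed
  then show ?thesis
    using pinv_solves[OF stiffness_carrier stiffness_symmetric f] c
    unfolding solvable_within_def compliance_def by metis
qed

text \<open>One half of the Schur complement criterion. Kernel vectors as \<open>v\<close> force
  \<open>f\<close> to be orthogonal to the kernel; the displacement as \<open>v\<close>, with
  \<open>s = 1\<close>, gives the bound \<open>c\<close>.\<close>

lemma solvable_withinI_block:
  assumes f: "f \<in> carrier_vec n" and a: "\<forall>e. 0 \<le> a $ e"
    and block: "\<And>s v. v \<in> carrier_vec n \<Longrightarrow>
      0 \<le> c * (s * s) - 2 * s * scalar_prod f v + qform (stiffness K0 K a) v"
  shows "solvable_within f c a"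
proof -
  let ?A = "stiffness K0 K a"
  have "scalar_prod f w = 0" if w: "w \<in> carrier_vec n" "?A *\<^sub>v w = 0\<^sub>v n" for w
  proof -
    have "0 \<le> t * (- 2 * scalar_prod f w) + t * t * c" for t
      using block[OF w(1), of t] w f by (simp add: algebra_simps)
    from linear_le_quadratic_imp_0[OF this] show ?thesis by simp
  qed
  note sol = pinv_solves[OF stiffness_carrier[of a] stiffness_symmetric f this]
  have "qform ?A (pinv ?A *\<^sub>v f) = scalar_prod f (pinv ?A *\<^sub>v f)"
    using sol f by (simp add: comm_scalar_prod)
  then have "scalar_prod f (pinv ?A *\<^sub>v f) \<le> c"
    using block[OF sol(1), of 1] by simp
  then show ?thesis
    using sol unfolding solvable_within_def by blast
qed

text \<open>The converse half: the expression dominates the form of the stiffness matrix at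
  \<open>v - s u\<close>.\<close>

lemma solvable_within_block:
  assumes f: "f \<in> carrier_vec n" and a: "\<forall>e. 0 \<le> a $ e" and v: "v \<in> carrier_vec n"
    and sol: "solvable_within f c a"
  shows "0 \<le> c * (s * s) - 2 * s * scalar_prod f v + qform (stiffness K0 K a) v"
proof -
  obtain u where u: "u \<in> carrier_vec n" "stiffness K0 K a *\<^sub>v u = f" "scalar_prod f u \<le> c"
    using sol by (auto simp: solvable_within_def)
  have "0 \<le> qform (stiffness K0 K a) (v + (- s) \<cdot>\<^sub>v u)"
    using psd_stiffness[OF a] u v psd_mat_iff[OF stiffness_carrier] by auto
  also have "\<dots> = qform (stiffness K0 K a) v - 2 * s * scalar_prod u (stiffness K0 K a *\<^sub>v v) + s * s * scalar_prod u f"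
    using qform_add_smult[OF stiffness_carrier[of a] stiffness_symmetric v u(1), of "- s"] u(2) by simp
  also have "scalar_prod u (stiffness K0 K a *\<^sub>v v) = scalar_prod f v"
    using symmetric_scalar_prod[OF stiffness_carrier[of a] stiffness_symmetric[of a] u(1) v] u(2) by simp
  also have "scalar_prod u f = scalar_prod f u"
    using u(1) f by (rule comm_scalar_prod)
  also have "s * s * scalar_prod f u \<le> s * s * c"
    using u(3) by (intro mult_left_mono) auto
  finally show ?thesis by (simp add: algebra_simps)
qed

text \<open>The stiffness grows with the design, so the kernel at \<open>b\<close> lies inside the
  kernel at \<open>a\<close> and \<open>f\<close> stays solvable. Testing the block inequality of
  \<open>a\<close> with the displacement of \<open>b\<close> then compares the two
  compliances.\<close>

lemma compliance_le_if_solvable_below: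
  assumes f: "f \<in> carrier_vec n" and a: "\<forall>e. 0 \<le> a $ e" and ab: "\<forall>e. a $ e \<le> b $ e"
    and sol: "solvable_within f c a"
  shows "compliance f K0 K b \<le> c"
proof -
  have b: "\<forall>e. 0 \<le> b $ e" using a ab order_trans by blast
  let ?A = "stiffness K0 K a" and ?B = "stiffness K0 K b"
  obtain u where u: "u \<in> carrier_vec n" "?A *\<^sub>v u = f" "scalar_prod f u \<le> c"
    using sol by (auto simp: solvable_within_def)
  have "scalar_prod f w = 0" if w: "w \<in> carrier_vec n" "?B *\<^sub>v w = 0\<^sub>v n" for w
  proof -
    have "qform ?A w \<le> 0"
      using qform_stiffness_mono[OF a ab w(1)] w by simp
    then have "qform ?A w = 0"
      using psd_stiffness[OF a] w psd_mat_iff[OF stiffness_carrier] by force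
    then have "?A *\<^sub>v w = 0\<^sub>v n"
      by (rule psd_qform_0_imp_kernel[OF stiffness_carrier psd_stiffness[OF a] w(1)])
    moreover have "scalar_prod f w = scalar_prod u (?A *\<^sub>v w)"
      using symmetric_scalar_prod[OF stiffness_carrier[of a] stiffness_symmetric[of a] u(1) w(1)] u(2) by simp
    ultimately show ?thesis using u by simp
  qed
  note v = pinv_solves[OF stiffness_carrier[of b] stiffness_symmetric f this]
  define v where "v = pinv ?B *\<^sub>v f"
  have vc: "v \<in> carrier_vec n" and Bv: "?B *\<^sub>v v = f"
    using v by (auto simp: v_def)
  have "0 \<le> scalar_prod f u - 2 * scalar_prod f v + qform ?A v"
    using solvable_within_block[OF f a vc, of "scalar_prod f u" 1] u
    unfolding solvable_within_def by auto
  also have "qform ?A v \<le> qform ?B v"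
    using qform_stiffness_mono[OF a ab vc] .
  also have "qform ?B v = scalar_prod f v"
    unfolding Bv using vc f by (rule comm_scalar_prod)
  finally show ?thesis
    using u(3) by (simp add: compliance_def v_def)
qed

end

section \<open>Moment and localizing matrices\<close>

text \<open>Reduces a matrix constraint to scalar polynomials, one for each constant test vector, so
  that it fits the scalar cone of \<open>z\<close>.\<close>

definition poly_qform :: "'e mpoly mat \<Rightarrow> real vec \<Rightarrow> 'e mpoly" where
  "poly_qform G v = (\<Sum>p<dim_row G. \<Sum>q<dim_row G. Const (vec_index v p * vec_index v q) * G $$ (p, q))"

lemma Lfun_poly_qform:
  assumes "G \<in> carrier_mat n n" "v \<in> carrier_vec n"
  shows "Lfun y (poly_qform G v) = qform (map_mat (Lfun y) G) v"
  using assms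
  by (subst qform_eq_sum[of _ n]) (auto simp: poly_qform_def Lfun_sum Lfun_Const_mult intro!: sum.cong)

lemma sum_lessThan_add:
  fixes f :: "nat \<Rightarrow> 'a::comm_monoid_add"
  shows "(\<Sum>p<m + n. f p) = (\<Sum>p<m. f p) + (\<Sum>p<n. f (m + p))"
  by (induction n) (simp_all add: add.assoc)

lemma sum_lessThan_mult:
  fixes h :: "nat \<Rightarrow> nat \<Rightarrow> 'a::comm_monoid_add"
  shows "(\<Sum>P<N * n. h (P div n) (P mod n)) = (\<Sum>i<N. \<Sum>k<n. h i k)"
proof (induction N)
  case (Suc N)
  have "(\<Sum>P<Suc N * n. h (P div n) (P mod n)) = (\<Sum>P<N * n + n. h (P div n) (P mod n))"
    by (simp add: add.commute)
  also have "\<dots> = (\<Sum>i<N. \<Sum>k<n. h i k) + (\<Sum>k<n. h ((N * n + k) div n) ((N * n + k) mod n))"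
    by (simp only: sum_lessThan_add Suc)
  also have "(\<Sum>k<n. h ((N * n + k) div n) ((N * n + k) mod n)) = (\<Sum>k<n. h N k)"
    by (intro sum.cong refl) auto
  finally show ?case by simp
qed simp

lemma poly_qform_four_block:
  assumes A: "A \<in> carrier_mat m m" and D: "D \<in> carrier_mat n n"
    and v: "v \<in> carrier_vec m" and w: "w \<in> carrier_vec n"
  shows "poly_qform (four_block_mat A (0\<^sub>m m n) (0\<^sub>m n m) D) (v @\<^sub>v w) = poly_qform A v + poly_qform D w"
proof -
  let ?G = "four_block_mat A (0\<^sub>m m n) (0\<^sub>m n m) D"
  have dim: "dim_row ?G = m + n" using A D by simp
  have "poly_qform ?G (v @\<^sub>v w)
      = (\<Sum>p<m. \<Sum>q<m. Const (vec_index v p * vec_index v q) * A $$ (p, q))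
      + (\<Sum>p<n. \<Sum>q<n. Const (vec_index w p * vec_index w q) * D $$ (p, q))"
    unfolding poly_qform_def dim sum_lessThan_add using A D v w
    by (auto intro!: arg_cong2[where f = "(+)"] sum.cong)
  then show ?thesis using A D by (simp add: poly_qform_def)
qed

lemma diag_block_mat_carrier:
  assumes "\<forall>B\<in>set Bs. dim_row B = dim_col B"
  shows "diag_block_mat Bs \<in> carrier_mat (dim_row (diag_block_mat Bs)) (dim_row (diag_block_mat Bs))"
proof -
  have "map dim_col Bs = map dim_row Bs" using assms by simp
  then have "dim_col (diag_block_mat Bs) = dim_row (diag_block_mat Bs)"
    unfolding dim_diag_block_mat by (rule arg_cong)
  then show ?thesis by (metis carrier_matI)
qed

lemma diag_block_mat_symmetric:
  assumes "\<forall>B\<in>set Bs. transpose_mat B = B"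
  shows "transpose_mat (diag_block_mat Bs) = diag_block_mat Bs"
  using assms
proof (induction Bs)
  case (Cons B Bs)
  let ?D = "diag_block_mat Bs"
  have B: "transpose_mat B = B" and D: "transpose_mat ?D = ?D" using Cons by auto
  have sq: "dim_col B = dim_row B" "dim_col ?D = dim_row ?D"
    by (metis B index_transpose_mat(2)) (metis D index_transpose_mat(2))
  have c: "B \<in> carrier_mat (dim_row B) (dim_row B)" "?D \<in> carrier_mat (dim_row ?D) (dim_row ?D)"
    using sq by (metis carrier_matI)+
  show ?case
    using transpose_four_block_mat[OF c(1) zero_carrier_mat zero_carrier_mat c(2)] sq
    by (simp add: Let_def B D)
qed simp

text \<open>Padding \<open>v\<close> by zeros picks out one diagonal block.\<close>

lemma ex_poly_qform_block:
  assumes "\<forall>B\<in>set Bs. dim_row B = dim_col B" "B \<in> set Bs" "v \<in> carrier_vec (dim_row B)"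
  shows "\<exists>w\<in>carrier_vec (dim_row (diag_block_mat Bs)). poly_qform (diag_block_mat Bs) w = poly_qform B v"
  using assms
proof (induction Bs)
  case (Cons C Bs)
  let ?D = "diag_block_mat Bs" let ?m = "dim_row C" let ?n = "dim_row (diag_block_mat Bs)"
  have D: "?D \<in> carrier_mat ?n ?n" using Cons.prems by (intro diag_block_mat_carrier) simp
  have "dim_row C = dim_col C" using Cons.prems(1) by auto
  then have C: "C \<in> carrier_mat ?m ?m" by (metis carrier_matI)
  have eq: "diag_block_mat (C # Bs) = four_block_mat C (0\<^sub>m ?m ?n) (0\<^sub>m ?n ?m) ?D"
    by (simp only: diag_block_mat.simps Let_def carrier_matD(2)[OF C] carrier_matD(2)[OF D])
  have zero: "poly_qform M (0\<^sub>v k) = 0" if "dim_row M = k" for M :: "'a mpoly mat" and k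
    using that by (simp add: poly_qform_def)
  show ?case
  proof (cases "B = C")
    case True
    then have "poly_qform (diag_block_mat (C # Bs)) (v @\<^sub>v 0\<^sub>v ?n) = poly_qform B v"
      using poly_qform_four_block[OF C D, of v "0\<^sub>v ?n"] Cons.prems unfolding eq by (simp add: zero)
    moreover have "v @\<^sub>v 0\<^sub>v ?n \<in> carrier_vec (dim_row (diag_block_mat (C # Bs)))"
      using True Cons.prems(3) unfolding eq by simp
    ultimately show ?thesis by blast
  next
    case False
    then obtain w where w: "w \<in> carrier_vec ?n" "poly_qform ?D w = poly_qform B v"
      using Cons by auto
    have "poly_qform (diag_block_mat (C # Bs)) (0\<^sub>v ?m @\<^sub>v w) = poly_qform B v"
      using poly_qform_four_block[OF C D, of "0\<^sub>v ?m" w] w unfolding eq by (simp add: zero)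
    moreover have "0\<^sub>v ?m @\<^sub>v w \<in> carrier_vec (dim_row (diag_block_mat (C # Bs)))"
      using w(1) unfolding eq by simp
    ultimately show ?thesis by blast
  qed
qed simp

lemma Lfun_poly_qform_diag_nonneg:
  assumes "\<forall>B\<in>set Bs. dim_row B = dim_col B"
    and "\<forall>B\<in>set Bs. \<forall>v\<in>carrier_vec (dim_row B). 0 \<le> Lfun y (poly_qform B v)"
    and "w \<in> carrier_vec (dim_row (diag_block_mat Bs))"
  shows "0 \<le> Lfun y (poly_qform (diag_block_mat Bs) w)"
  using assms
proof (induction Bs arbitrary: w)
  case Nil
  then show ?case by (simp add: poly_qform_def)
next
  case (Cons C Bs)
  let ?D = "diag_block_mat Bs" let ?m = "dim_row C" let ?n = "dim_row (diag_block_mat Bs)"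
  have D: "?D \<in> carrier_mat ?n ?n" using Cons.prems by (intro diag_block_mat_carrier) simp
  have "dim_row C = dim_col C" using Cons.prems(1) by auto
  then have C: "C \<in> carrier_mat ?m ?m" by (metis carrier_matI)
  have eq: "diag_block_mat (C # Bs) = four_block_mat C (0\<^sub>m ?m ?n) (0\<^sub>m ?n ?m) ?D"
    by (simp only: diag_block_mat.simps Let_def carrier_matD(2)[OF C] carrier_matD(2)[OF D])
  have w: "w \<in> carrier_vec (?m + ?n)" using Cons.prems(3) unfolding eq by simp
  have c: "vec_first w ?m \<in> carrier_vec ?m" "vec_last w ?n \<in> carrier_vec ?n" by auto
  have "poly_qform (diag_block_mat (C # Bs)) w
      = poly_qform C (vec_first w ?m) + poly_qform ?D (vec_last w ?n)"
    using poly_qform_four_block[OF C D c] vec_first_last_append[OF w] unfolding eq by simp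
  then show ?case
    using Cons c by (simp add: Lfun_add)
qed

section \<open>Monomial bases, moment matrices and localizing matrices\<close>

lemma finite_mdeg_le: "finite {m :: 'e::finite \<Rightarrow>\<^sub>0 nat. mdeg m \<le> k}"
proof -
  have "Poly_Mapping.lookup m e \<le> mdeg m" for m :: "'e \<Rightarrow>\<^sub>0 nat" and e
    unfolding mdeg_def by (intro member_le_sum) auto
  then have "Poly_Mapping.lookup ` {m :: 'e \<Rightarrow>\<^sub>0 nat. mdeg m \<le> k} \<subseteq> Pi\<^sub>E UNIV (\<lambda>_. {..k})"
    by (auto intro: order_trans)
  moreover have "finite (Pi\<^sub>E (UNIV :: 'e set) (\<lambda>_. {..k}))"
    by (intro finite_PiE) auto
  ultimately have "finite (Poly_Mapping.lookup ` {m :: 'e \<Rightarrow>\<^sub>0 nat. mdeg m \<le> k})"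
    by (rule finite_subset)
  then show ?thesis
    by (rule finite_imageD) (auto intro: inj_onI poly_mapping_eqI)
qed

definition monom_list :: "nat \<Rightarrow> ('e::{finite,linorder} \<Rightarrow>\<^sub>0 nat) list" where
  "monom_list k = sorted_list_of_set {m. mdeg m \<le> k}"

lemma set_monom_list: "set (monom_list k) = {m. mdeg m \<le> k}"
  and distinct_monom_list: "distinct (monom_list k)"
  by (simp_all add: monom_list_def finite_mdeg_le)

lemma dim_monomials: "dim_vec (monomials k :: 'e::{finite,linorder} mpoly vec) = length (monom_list k :: ('e \<Rightarrow>\<^sub>0 nat) list)"
  by (simp add: monomials_def monom_list_def)

lemma monomial_products_carrier:
  "(monomial_products k :: 'e::{finite,linorder} mpoly mat) \<in>
     carrier_mat (length (monom_list k :: ('e \<Rightarrow>\<^sub>0 nat) list)) (length (monom_list k :: ('e \<Rightarrow>\<^sub>0 nat) list))"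
proof (rule carrier_matI)
  show "dim_row (monomial_products k :: 'e mpoly mat) = length (monom_list k :: ('e \<Rightarrow>\<^sub>0 nat) list)"
    by (simp only: monomial_products_def Let_def index_mult_mat mat_of_cols_carrier dim_monomials)
  show "dim_col (monomial_products k :: 'e mpoly mat) = length (monom_list k :: ('e \<Rightarrow>\<^sub>0 nat) list)"
    by (simp only: monomial_products_def Let_def index_mult_mat mat_of_row_dim dim_monomials)
qed

lemma monomial_products_index:
  assumes "i < length (monom_list k :: ('e::{finite,linorder} \<Rightarrow>\<^sub>0 nat) list)" "j < length (monom_list k :: ('e \<Rightarrow>\<^sub>0 nat) list)"
  shows "monomial_products k $$ (i, j) = Monom (monom_list k ! i) * (Monom (monom_list k ! j) :: 'e mpoly)"
proof -
  have idx: "vec_index (monomials k) i = (Monom (monom_list k ! i) :: 'e mpoly)"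
    if "i < length (monom_list k :: ('e \<Rightarrow>\<^sub>0 nat) list)" for i
    using that by (simp add: monomials_def monom_list_def vec_of_list_index)
  show ?thesis
    using assms
    by (simp add: monomial_products_def Let_def dim_monomials scalar_prod_def idx mat_of_cols_def mat_of_rows_def mat_of_row_def)
qed

lemma poly_eq_sum_monom_list:
  fixes q :: "'e::{finite,linorder} mpoly" and ms :: "('e \<Rightarrow>\<^sub>0 nat) list" and k :: nat
  defines "ms \<equiv> monom_list k"
  assumes "\<And>m. m \<in> Poly_Mapping.keys q \<Longrightarrow> mdeg m \<le> k"
  shows "q = (\<Sum>i<length ms. Const (Poly_Mapping.lookup q (ms ! i)) * Monom (ms ! i))"
proof -
  have "q = (\<Sum>m\<in>Poly_Mapping.keys q. Poly_Mapping.single m (Poly_Mapping.lookup q m))"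
    by (rule poly_mapping_sum_single)
  also have "\<dots> = (\<Sum>m\<in>set (ms). Poly_Mapping.single m (Poly_Mapping.lookup q m))"
    using assms by (intro sum.mono_neutral_left) (auto simp: set_monom_list ms_def finite_mdeg_le in_keys_iff)
  also have "\<dots> = (\<Sum>m\<leftarrow>ms. Poly_Mapping.single m (Poly_Mapping.lookup q m))"
    by (simp add: sum_list_distinct_conv_sum_set distinct_monom_list ms_def)
  also have "\<dots> = (\<Sum>i<length (ms). Poly_Mapping.single (ms ! i) (Poly_Mapping.lookup q (ms ! i)))"
    by (simp add: sum_list_sum_nth atLeast0LessThan)
  finally show ?thesis
    by (simp add: Const_def Monom_def mult_single)
qed

text \<open>The localizing form is evaluated at the Kronecker product of the coefficient vector of
  \<open>q\<close> with \<open>v\<close>.\<close>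

lemma localizing_nonneg:
  fixes q :: "'e::{finite,linorder} mpoly"
  assumes psd: "psd_mat (map_mat (Lfun y) (kronecker_mat (monomial_products k) G))"
    and G: "G \<in> carrier_mat n n" and v: "v \<in> carrier_vec n"
    and q: "\<And>m. m \<in> Poly_Mapping.keys q \<Longrightarrow> mdeg m \<le> k"
  shows "0 \<le> Lfun y (q * q * poly_qform G v)"
proof -
  define ms :: "('e \<Rightarrow>\<^sub>0 nat) list" where "ms = monom_list k"
  define N where "N = length ms"
  define c where "c i = Poly_Mapping.lookup q (ms ! i)" for i
  have qs: "q = (\<Sum>i<N. Const (c i) * Monom (ms ! i))"
    using poly_eq_sum_monom_list[OF q] unfolding ms_def N_def c_def by simp
  have qq: "q * q = (\<Sum>i<N. \<Sum>j<N. (Const (c i) * Monom (ms ! i)) * (Const (c j) * Monom (ms ! j)))"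
    by (subst (1 2) qs) (rule sum_product)
  define V where "V = vec (N * n) (\<lambda>P. c (P div n) * vec_index v (P mod n))"
  let ?M = "map_mat (Lfun y) (kronecker_mat (monomial_products k) G)"
  have mp: "(monomial_products k :: 'e mpoly mat) \<in> carrier_mat N N"
    unfolding N_def ms_def by (rule monomial_products_carrier)
  have M: "?M \<in> carrier_mat (N * n) (N * n)"
    using mp G by (simp add: kronecker_mat_def)
  have idx: "?M $$ (P, Q) = Lfun y (Monom (ms ! (P div n)) * Monom (ms ! (Q div n)) * G $$ (P mod n, Q mod n))"
    if "P < N * n" "Q < N * n" for P Q
  proof -
    have "P div n < N" "Q div n < N" "P mod n < n" "Q mod n < n"
      using that by (auto simp: less_mult_imp_div_less) (metis gr_zeroI mod_less_divisor mult_0_right not_less_zero)+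
    then show ?thesis
      using that mp G by (simp add: kronecker_mat_def monomial_products_index N_def ms_def)
  qed
  have "0 \<le> qform ?M V"
    using psd psd_mat_iff[OF M] by (simp add: V_def)
  also have "qform ?M V = (\<Sum>P<N * n. \<Sum>Q<N * n. (c (P div n) * vec_index v (P mod n)) * (c (Q div n) * vec_index v (Q mod n))
      * Lfun y (Monom (ms ! (P div n)) * Monom (ms ! (Q div n)) * G $$ (P mod n, Q mod n)))"
    using idx by (subst qform_eq_sum[OF M]) (simp_all add: V_def)
  also have "\<dots> = (\<Sum>i<N. \<Sum>k<n. \<Sum>j<N. \<Sum>l<n. (c i * vec_index v k) * (c j * vec_index v l)
      * Lfun y (Monom (ms ! i) * Monom (ms ! j) * G $$ (k, l)))"
    by (simp only: sum_lessThan_mult[of "\<lambda>j l. (c _ * vec_index v _) * (c j * vec_index v l)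
      * Lfun y (Monom (ms ! _) * Monom (ms ! j) * G $$ (_, l))"]
      sum_lessThan_mult[of "\<lambda>i k. \<Sum>j<N. \<Sum>l<n. (c i * vec_index v k) * (c j * vec_index v l)
      * Lfun y (Monom (ms ! i) * Monom (ms ! j) * G $$ (k, l))"])
  also have "\<dots> = Lfun y (\<Sum>i<N. \<Sum>k<n. \<Sum>j<N. \<Sum>l<n. Const ((c i * vec_index v k) * (c j * vec_index v l))
      * (Monom (ms ! i) * Monom (ms ! j) * G $$ (k, l)))"
    by (simp only: Lfun_sum Lfun_Const_mult)
  also have "(\<Sum>i<N. \<Sum>k<n. \<Sum>j<N. \<Sum>l<n. Const ((c i * vec_index v k) * (c j * vec_index v l))
      * (Monom (ms ! i) * Monom (ms ! j) * G $$ (k, l)))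
      = (\<Sum>i<N. \<Sum>j<N. \<Sum>k<n. \<Sum>l<n. (Const (c i) * Monom (ms ! i)) * (Const (c j) * Monom (ms ! j)) *
          (Const (vec_index v k * vec_index v l) * G $$ (k, l)))"
    by (rule sum.cong[OF refl], subst sum.swap, simp add: Const_mult ac_simps)
  also have "\<dots> = (\<Sum>i<N. \<Sum>j<N. (Const (c i) * Monom (ms ! i)) * (Const (c j) * Monom (ms ! j)) * poly_qform G v)"
    by (simp only: poly_qform_def carrier_matD(1)[OF G] sum_distrib_left)
  also have "\<dots> = q * q * poly_qform G v"
    by (simp only: qq sum_distrib_right)
  finally show ?thesis .
qed

text \<open>The moment matrix is the localizing matrix of the 1 by 1 identity.\<close>

lemma moment_matrix_nonneg:
  fixes q :: "'e::{finite,linorder} mpoly"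
  assumes psd: "psd_mat (map_mat (Lfun y) (monomial_products k))"
    and q: "\<And>m. m \<in> Poly_Mapping.keys q \<Longrightarrow> mdeg m \<le> k"
  shows "0 \<le> Lfun y (q * q)"
proof -
  define E :: "'e mpoly mat" where "E = 1\<^sub>m 1"
  have "kronecker_mat (monomial_products k) E = monomial_products k"
    by (intro eq_matI) (simp_all add: kronecker_mat_def E_def)
  then have "psd_mat (map_mat (Lfun y) (kronecker_mat (monomial_products k) E))"
    using psd by simp
  from localizing_nonneg[OF this, of 1 "vec 1 (\<lambda>_. 1)" q] q
  show ?thesis by (simp add: E_def poly_qform_def)
qed

lemma psd_eval_moment_matrix:
  "psd_mat (map_mat (eval_at c) (monomial_products k :: 'e::{finite,linorder} mpoly mat))"
proof -
  define ms :: "('e \<Rightarrow>\<^sub>0 nat) list" where "ms = monom_list k"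
  define N where "N = length ms"
  let ?M = "map_mat (eval_at c) (monomial_products k)"
  have M: "?M \<in> carrier_mat N N"
    unfolding map_carrier_mat N_def ms_def by (rule monomial_products_carrier)
  have idx: "?M $$ (i, j) = monom_value c (ms ! i) * monom_value c (ms ! j)" if "i < N" "j < N" for i j
    using that monomial_products_carrier[of k, where 'e = 'e]
    by (auto simp: N_def ms_def monomial_products_index eval_at_mult Lfun_Monom)
  have "transpose_mat ?M = ?M"
    using M by (intro eq_matI) (auto simp: idx simp del: index_map_mat)
  moreover have "0 \<le> qform ?M v" if v: "v \<in> carrier_vec N" for v
  proof -
    have "qform ?M v = (\<Sum>i<N. vec_index v i * monom_value c (ms ! i)) * (\<Sum>j<N. vec_index v j * monom_value c (ms ! j))"
      by (simp add: qform_eq_sum[OF M v] idx sum_product ac_simps del: index_map_mat)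
    then show ?thesis by simp
  qed
  ultimately show ?thesis using psd_mat_iff[OF M] by blast
qed

text \<open>At a point the matrix is the Kronecker product of \<open>b b\<^sup>T\<close> with
  \<open>G(c)\<close>; contracting the test vector with \<open>b\<close> leaves the form of
  \<open>G(c)\<close> at a shorter vector.\<close>

lemma psd_eval_localizing_matrix:
  fixes G :: "'e::{finite,linorder} mpoly mat"
  assumes G: "G \<in> carrier_mat n n" and psd: "psd_mat (map_mat (eval_at c) G)"
  shows "psd_mat (map_mat (eval_at c) (kronecker_mat (monomial_products k) G))"
proof -
  define ms :: "('e \<Rightarrow>\<^sub>0 nat) list" where "ms = monom_list k"
  define N where "N = length ms"
  define b where "b i = monom_value c (ms ! i)" for i
  let ?M = "map_mat (eval_at c) (kronecker_mat (monomial_products k) G)"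
  let ?G = "map_mat (eval_at c) G"
  have mp: "(monomial_products k :: 'e mpoly mat) \<in> carrier_mat N N"
    unfolding N_def ms_def by (rule monomial_products_carrier)
  have M: "?M \<in> carrier_mat (N * n) (N * n)"
    using mp G by (simp add: kronecker_mat_def)
  have Gc: "?G \<in> carrier_mat n n" using G by simp
  have Gs: "?G $$ (k, l) = ?G $$ (l, k)" if "k < n" "l < n" for k l
  proof -
    have "?G $$ (k, l) = transpose_mat ?G $$ (l, k)" using that Gc by (simp only: index_transpose_mat carrier_matD)
    then show ?thesis using psd psd_mat_iff[OF Gc] by simp
  qed
  have lt: "P div n < N \<and> P mod n < n" if "P < N * n" for P
  proof -
    have "n > 0" using that by (cases n) auto
    then show ?thesis using that by (simp add: less_mult_imp_div_less)
  qed
  have idx: "?M $$ (P, Q) = b (P div n) * b (Q div n) * ?G $$ (P mod n, Q mod n)"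
    if "P < N * n" "Q < N * n" for P Q
    using that mp G lt
    by (simp add: kronecker_mat_def monomial_products_index N_def ms_def eval_at_mult Lfun_Monom b_def)
  have "transpose_mat ?M = ?M"
  proof (rule eq_matI)
    fix P Q assume "P < dim_row ?M" "Q < dim_col ?M"
    then have PQ: "P < N * n" "Q < N * n" using carrier_matD[OF M] by auto
    have "transpose_mat ?M $$ (P, Q) = ?M $$ (Q, P)"
      using PQ carrier_matD[OF M] by (simp only: index_transpose_mat)
    then show "transpose_mat ?M $$ (P, Q) = ?M $$ (P, Q)"
      unfolding idx[OF PQ(2) PQ(1)] idx[OF PQ] using Gs lt PQ by (metis mult.commute)
  qed (use carrier_matD[OF M] in \<open>simp_all only: index_transpose_mat\<close>)
  moreover have "0 \<le> qform ?M V" if V: "V \<in> carrier_vec (N * n)" for V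
  proof -
    define v where "v = vec n (\<lambda>k. \<Sum>i<N. b i * vec_index V (i * n + k))"
    have vv: "vec_index v k * vec_index v l * g
        = (\<Sum>i<N. \<Sum>j<N. vec_index V (i * n + k) * vec_index V (j * n + l) * (b i * b j * g))"
      if "k < n" "l < n" for k l g
    proof -
      have "vec_index v k * vec_index v l
          = (\<Sum>i<N. \<Sum>j<N. (b i * vec_index V (i * n + k)) * (b j * vec_index V (j * n + l)))"
        using that by (simp only: v_def index_vec sum_product)
      then show ?thesis
        by (simp only: sum_distrib_right) (intro sum.cong refl, simp only: mult_ac)
    qed
    have "qform ?M V = (\<Sum>P<N * n. \<Sum>Q<N * n. vec_index V P * vec_index V Q * ?M $$ (P, Q))"
      by (rule qform_eq_sum[OF M V])
    also have "\<dots> = (\<Sum>P<N * n. \<Sum>Q<N * n. vec_index V ((P div n) * n + P mod n) * vec_index V ((Q div n) * n + Q mod n)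
        * (b (P div n) * b (Q div n) * ?G $$ (P mod n, Q mod n)))"
      by (intro sum.cong refl) (simp only: idx lessThan_iff div_mult_mod_eq)
    also have "\<dots> = (\<Sum>i<N. \<Sum>k<n. \<Sum>j<N. \<Sum>l<n. vec_index V (i * n + k) * vec_index V (j * n + l) * (b i * b j * ?G $$ (k, l)))"
      by (simp only: sum_lessThan_mult[of "\<lambda>j l. vec_index V (_ * n + _) * vec_index V (j * n + l) * (b _ * b j * ?G $$ (_, l))"]
        sum_lessThan_mult[of "\<lambda>i k. \<Sum>j<N. \<Sum>l<n. vec_index V (i * n + k) * vec_index V (j * n + l) * (b i * b j * ?G $$ (k, l))"])
    also have "\<dots> = (\<Sum>k<n. \<Sum>i<N. \<Sum>j<N. \<Sum>l<n. vec_index V (i * n + k) * vec_index V (j * n + l) * (b i * b j * ?G $$ (k, l)))"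
      by (rule sum.swap)
    also have "\<dots> = (\<Sum>k<n. \<Sum>i<N. \<Sum>l<n. \<Sum>j<N. vec_index V (i * n + k) * vec_index V (j * n + l) * (b i * b j * ?G $$ (k, l)))"
      by (rule sum.cong[OF refl], rule sum.cong[OF refl], rule sum.swap)
    also have "\<dots> = (\<Sum>k<n. \<Sum>l<n. \<Sum>i<N. \<Sum>j<N. vec_index V (i * n + k) * vec_index V (j * n + l) * (b i * b j * ?G $$ (k, l)))"
      by (rule sum.cong[OF refl], rule sum.swap)
    also have "\<dots> = (\<Sum>k<n. \<Sum>l<n. vec_index v k * vec_index v l * ?G $$ (k, l))"
      by (intro sum.cong refl) (simp only: lessThan_iff vv)
    also have "\<dots> = qform ?G v"
      by (rule qform_eq_sum[OF Gc, symmetric]) (simp add: v_def)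
    also have "\<dots> \<ge> 0"
      using psd psd_mat_iff[OF Gc] by (simp add: v_def)
    finally show ?thesis .
  qed
  ultimately show ?thesis using psd_mat_iff[OF M] by blast
qed

section \<open>Limits of moment sequences\<close>

text \<open>Tychonoff for the cube indexed by all monomials; a finer filter takes the place of a
  diagonal subsequence.\<close>

lemma ex_pointwise_cluster_point:
  fixes y :: "nat \<Rightarrow> 'm \<Rightarrow> real"
  assumes F: "F \<noteq> bot" and bound: "\<And>m. \<forall>\<^sub>F r in F. \<bar>y r m\<bar> \<le> 1"
  obtains z H where "H \<noteq> bot" "H \<le> F" "\<And>m. ((\<lambda>r. y r m) \<longlongrightarrow> z m) H"
proof -
  \<comment> \<open>The bounds hold only eventually, from an order that depends on \<open>m\<close>.
    Clipping puts every \<open>y r\<close> into the compact cube and has no effect eventually for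
    each fixed \<open>m\<close>.\<close>
  define y' where "y' r m = max (- 1) (min 1 (y r m))" for r m
  define C :: "('m \<Rightarrow> real) set" where "C = Pi\<^sub>E UNIV (\<lambda>_. {- 1..1})"
  have "compact C"
  proof -
    have "compactin (product_topology (\<lambda>_. euclidean) UNIV) C"
      unfolding C_def by (simp add: compactin_PiE)
    then show ?thesis by (simp add: euclidean_product_topology)
  qed
  moreover have "filtermap y' F \<noteq> bot" using F by (simp add: filtermap_bot_iff)
  moreover have "\<forall>\<^sub>F w in filtermap y' F. w \<in> C"
    by (auto simp: eventually_filtermap C_def y'_def PiE_iff)
  ultimately obtain z where z: "inf (nhds z) (filtermap y' F) \<noteq> bot"
    unfolding compact_filter by blast
  define H where "H = inf (filtercomap y' (nhds z)) F"
  have "H \<noteq> bot"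
  proof
    assume "H = bot"
    then have "eventually (\<lambda>_. False) H" by simp
    then obtain P Q where P: "eventually P (filtercomap y' (nhds z))" and Q: "eventually Q F"
      and PQ: "\<And>r. P r \<Longrightarrow> Q r \<Longrightarrow> False"
      unfolding H_def eventually_inf by auto
    obtain P' where P': "eventually P' (nhds z)" "\<And>r. P' (y' r) \<Longrightarrow> P r"
      using P unfolding eventually_filtercomap by auto
    have "\<forall>\<^sub>F w in filtermap y' F. \<not> P' w"
      unfolding eventually_filtermap using Q by (rule eventually_mono) (use P' PQ in blast)
    with P'(1) have "eventually (\<lambda>_. False) (inf (nhds z) (filtermap y' F))"
      unfolding eventually_inf by blast
    with z show False by (simp add: trivial_limit_def)
  qed
  moreover have HF: "H \<le> F" by (simp add: H_def)
  moreover have "((\<lambda>r. y r m) \<longlongrightarrow> z m) H" for m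
  proof -
    have "(y' \<longlongrightarrow> z) H"
      unfolding H_def using filterlim_filtercomap filterlim_mono inf_le1 order_refl by blast
    then have "((\<lambda>r. y' r m) \<longlongrightarrow> z m) H"
    proof (intro topological_tendstoI)
      fix S :: "real set" assume S: "open S" "z m \<in> S"
      have "open ((\<lambda>w :: 'm \<Rightarrow> real. w m) -` S)"
        by (intro open_vimage S continuous_on_product_coordinates)
      then show "\<forall>\<^sub>F r in H. y' r m \<in> S"
        using topological_tendstoD[OF \<open>(y' \<longlongrightarrow> z) H\<close>, of "(\<lambda>w. w m) -` S"] S by simp
    qed
    moreover have "\<forall>\<^sub>F r in H. y' r m = y r m"
      using filter_leD[OF HF bound[of m]] by (rule eventually_mono) (auto simp: y'_def)
    ultimately show ?thesis by (rule Lim_transform_eventually)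
  qed
  ultimately show ?thesis using that by blast
qed

lemma tendsto_Lfun:
  assumes "\<And>m. ((\<lambda>r. y r m) \<longlongrightarrow> z m) H"
  shows "((\<lambda>r. Lfun (y r) p) \<longlongrightarrow> Lfun z p) H"
  unfolding Lfun_def by (intro tendsto_intros assms)

section \<open>Uniform bounds on moments from the box constraints\<close>

lemma mdeg_add: "mdeg (m + k) = mdeg m + mdeg k"
  by (simp add: mdeg_def lookup_add sum.distrib)

lemma mdeg_single: "mdeg (Poly_Mapping.single e i) = i"
proof -
  have "mdeg (Poly_Mapping.single e i) = (\<Sum>k\<in>UNIV. if k = e then i else 0)"
    unfolding mdeg_def by (intro sum.cong) (auto simp: lookup_single when_def)
  then show ?thesis by simp
qed

lemma keys_Monom: "Poly_Mapping.keys (Monom m) = {m}"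
  by (simp add: Monom_def)

text \<open>Removing one variable from \<open>m\<close> leaves some \<open>k\<close>, and the box
  constraint tested with \<open>Monom k\<close> gives
  \<open>y (m + m) \<le> y (k + k)\<close>.\<close>

lemma even_moment_le_1:
  fixes y :: "('e::finite \<Rightarrow>\<^sub>0 nat) \<Rightarrow> real"
  assumes y0: "y 0 = 1"
    and box: "\<And>q e. (\<And>k. k \<in> Poly_Mapping.keys q \<Longrightarrow> mdeg k \<le> s) \<Longrightarrow>
        0 \<le> Lfun y (q * q * (1 - Var e * Var e))"
    and m: "mdeg m \<le> s"
  shows "y (m + m) \<le> 1"
  using m
proof (induction "mdeg m" arbitrary: m)
  case 0
  then have "m = 0"
    by (intro poly_mapping_eqI) (simp add: mdeg_def)
  then show ?case using y0 by simp
next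
  case (Suc d)
  then obtain e where e: "Poly_Mapping.lookup m e > 0"
    unfolding mdeg_def by (metis (no_types, lifting) bot_nat_0.not_eq_extremum nat.distinct(1) sum.neutral)
  define k where "k = m - Poly_Mapping.single e 1"
  have mk: "m = Poly_Mapping.single e 1 + k"
  proof (rule poly_mapping_eqI)
    fix i
    show "Poly_Mapping.lookup m i = Poly_Mapping.lookup (Poly_Mapping.single e 1 + k) i"
      using e by (cases "i = e") (auto simp: k_def lookup_add lookup_minus lookup_single when_def)
  qed
  have dk: "mdeg k = d"
    using Suc(2) mk mdeg_add[of "Poly_Mapping.single e 1" k] mdeg_single[of e 1] by simp
  have "0 \<le> Lfun y (Monom k * Monom k * (1 - Var e * Var e))"
    using Suc dk by (intro box) (auto simp: keys_Monom)
  also have "Monom k * Monom k * (1 - Var e * Var e) = Monom (k + k) - Monom (m + m)"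
    unfolding mk Monom_add Var_def by (simp add: algebra_simps)
  finally have "y (m + m) \<le> y (k + k)"
    by (simp add: Lfun_diff Lfun_Monom)
  also have "y (k + k) \<le> 1"
    using Suc dk by simp
  finally show ?case .
qed

text \<open>Squares of \<open>Monom m + 1\<close> and \<open>Monom m - 1\<close> give
  \<open>2 * \<bar>y m\<bar> \<le> 1 + y (m + m)\<close>.\<close>

lemma abs_moment_le_1:
  fixes y :: "('e::finite \<Rightarrow>\<^sub>0 nat) \<Rightarrow> real"
  assumes y0: "y 0 = 1"
    and box: "\<And>q e. (\<And>k. k \<in> Poly_Mapping.keys q \<Longrightarrow> mdeg k \<le> s) \<Longrightarrow>
        0 \<le> Lfun y (q * q * (1 - Var e * Var e))"
    and sq: "\<And>q. (\<And>k. k \<in> Poly_Mapping.keys q \<Longrightarrow> mdeg k \<le> s) \<Longrightarrow> 0 \<le> Lfun y (q * q)"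
    and m: "mdeg m \<le> s"
  shows "\<bar>y m\<bar> \<le> 1"
proof -
  have "0 \<le> 1 + 2 * t * y m + y (m + m)" if "t * t = 1" for t :: real
  proof -
    have "mdeg k \<le> s" if "k \<in> Poly_Mapping.keys (Const t + Monom m)" for k
    proof -
      have "Poly_Mapping.keys (Const t) \<subseteq> {0 :: 'e \<Rightarrow>\<^sub>0 nat}" by (simp add: Const_def)
      then have "k = 0 \<or> k = m"
        using that keys_add[of "Const t" "Monom m"] by (auto simp: keys_Monom)
      then show ?thesis using m by (auto simp: mdeg_def)
    qed
    then have "0 \<le> Lfun y ((Const t + Monom m) * (Const t + Monom m))"
      by (rule sq)
    also have "(Const t + Monom m) * (Const t + Monom m) = Const (t * t) + Const (2 * t) * Monom m + Monom (m + m)"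
      by (simp add: Const_mult Const_numeral Monom_add algebra_simps)
    finally show ?thesis
      using that y0 by (simp add: Lfun_add Lfun_Const_mult Lfun_Const Lfun_1 Lfun_Monom)
  qed
  from this[of 1] this[of "- 1"] show ?thesis
    using even_moment_le_1[OF y0 box m] by simp
qed

section \<open>The scaled problem\<close>

definition scaled_design :: "real \<Rightarrow> ('e::finite \<Rightarrow> real) \<Rightarrow> ('e \<Rightarrow> real) \<Rightarrow> real ^ 'e \<Rightarrow> real ^ 'e" where
  "scaled_design wbar rho len c = (\<chi> e. (c $ e + 1) / 2 * (wbar / (rho e * len e)))"

lemma eval_scaled_area: "eval_at c (scaled_area wbar rho len e) = scaled_design wbar rho len c $ e"
  by (simp add: scaled_area_def scaled_design_def eval_at_mult Lfun_add)

lemma eval_scaled_stiffness: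
  "map_mat (eval_at c) (scaled_stiffness wbar rho len K0 K) = stiffness K0 K (scaled_design wbar rho len c)"
  by (intro eq_matI) (simp_all add: scaled_stiffness_def stiffness_def Lfun_add Lfun_sum eval_at_mult
      eval_at_power eval_scaled_area)

context stiffness_model
begin

lemma scaled_stiffness_carrier: "scaled_stiffness wbar rho len K0 K \<in> carrier_mat n n"
  using K0 by (simp add: scaled_stiffness_def)

lemma scaled_stiffness_sym:
  assumes "p < n" "q < n"
  shows "scaled_stiffness wbar rho len K0 K $$ (p, q) = scaled_stiffness wbar rho len K0 K $$ (q, p)"
proof -
  have "K e i $$ (q, p) = K e i $$ (p, q)" if "i \<in> {1..3}" for e i
    using psd_mat_index_sym K that assms by blast
  moreover have "K0 $$ (q, p) = K0 $$ (p, q)"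
    using psd_mat_index_sym K0 assms by blast
  ultimately show ?thesis
    using assms K0 by (simp add: scaled_stiffness_def)
qed

lemma compliance_block_index:
  assumes f: "f \<in> carrier_vec n" and "p < Suc n" "q < Suc n"
  shows "compliance_block cb f (scaled_stiffness wbar rho len K0 K) $$ (p, q) =
    (if p = 0 then (if q = 0 then Const cb else Const (- vec_index f (q - 1)))
     else (if q = 0 then Const (- vec_index f (p - 1)) else scaled_stiffness wbar rho len K0 K $$ (p - 1, q - 1)))"
  using assms scaled_stiffness_carrier[of wbar rho len]
  by (auto simp: compliance_block_def mat_of_row_def mat_of_rows_def mat_of_cols_def)

lemma compliance_block_carrier:
  assumes "f \<in> carrier_vec n"
  shows "compliance_block cb f (scaled_stiffness wbar rho len K0 K) \<in> carrier_mat (Suc n) (Suc n)"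
  using assms scaled_stiffness_carrier[of wbar rho len]
  by (auto simp: compliance_block_def intro!: carrier_matI)

lemma compliance_block_sym:
  assumes f: "f \<in> carrier_vec n"
  shows "transpose_mat (compliance_block cb f (scaled_stiffness wbar rho len K0 K))
    = compliance_block cb f (scaled_stiffness wbar rho len K0 K)"
proof (rule eq_matI)
  let ?B = "compliance_block cb f (scaled_stiffness wbar rho len K0 K)"
  note B = carrier_matD[OF compliance_block_carrier[OF f, of cb wbar rho len]]
  fix p q assume "p < dim_row ?B" "q < dim_col ?B"
  then have pq: "p < Suc n" "q < Suc n" using B by auto
  then show "transpose_mat ?B $$ (p, q) = ?B $$ (p, q)"
    using B by (simp add: compliance_block_index[OF f])
      (auto intro: scaled_stiffness_sym)
qed (use carrier_matD[OF compliance_block_carrier[OF f, of cb wbar rho len]] in \<open>simp_all only: index_transpose_mat\<close>)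

lemma eval_compliance_block:
  assumes f: "f \<in> carrier_vec n"
  shows "eval_at c (poly_qform (compliance_block cb f (scaled_stiffness wbar rho len K0 K)) w)
    = cb * (vec_index w 0 * vec_index w 0)
      - 2 * vec_index w 0 * scalar_prod f (vec n (\<lambda>i. vec_index w (Suc i)))
      + qform (stiffness K0 K (scaled_design wbar rho len c)) (vec n (\<lambda>i. vec_index w (Suc i)))"
proof -
  define v where "v = vec n (\<lambda>i. vec_index w (Suc i))"
  define s where "s = vec_index w 0"
  let ?S = "stiffness K0 K (scaled_design wbar rho len c)"
  have idx: "eval_at c (scaled_stiffness wbar rho len K0 K $$ (p, q)) = ?S $$ (p, q)" if "p < n" "q < n" for p q
    using that scaled_stiffness_carrier[of wbar rho len] by (simp flip: eval_scaled_stiffness)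
  have "eval_at c (poly_qform (compliance_block cb f (scaled_stiffness wbar rho len K0 K)) w)
      = (\<Sum>p<Suc n. \<Sum>q<Suc n. vec_index w p * vec_index w q
          * eval_at c (compliance_block cb f (scaled_stiffness wbar rho len K0 K) $$ (p, q)))"
    unfolding poly_qform_def carrier_matD(1)[OF compliance_block_carrier[OF f]]
    by (simp only: Lfun_sum Lfun_Const_mult)
  also have "\<dots> = s * s * cb + (\<Sum>q<n. s * vec_index v q * (- vec_index f q))
      + (\<Sum>p<n. vec_index v p * s * (- vec_index f p) + (\<Sum>q<n. vec_index v p * vec_index v q * ?S $$ (p, q)))"
    by (simp add: sum.lessThan_Suc_shift compliance_block_index[OF f] idx v_def s_def del: sum.lessThan_Suc)
  also have "\<dots> = cb * (s * s) - 2 * s * (\<Sum>q<n. vec_index f q * vec_index v q)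
      + (\<Sum>p<n. \<Sum>q<n. vec_index v p * vec_index v q * ?S $$ (p, q))"
    by (simp add: sum.distrib sum_subtractf sum_negf sum_distrib_left algebra_simps flip: sum.distrib)
  also have "(\<Sum>q<n. vec_index f q * vec_index v q) = scalar_prod f v"
    using f by (simp add: scalar_prod_def v_def atLeast0LessThan)
  also have "(\<Sum>p<n. \<Sum>q<n. vec_index v p * vec_index v q * ?S $$ (p, q)) = qform ?S v"
    by (rule qform_eq_sum[symmetric]) (simp_all add: v_def)
  finally show ?thesis by (simp only: v_def s_def)
qed

text \<open>The Schur complement criterion turns feasibility, phrased with displacements, into
  inequalities that are polynomial in the scaled variables.\<close>

lemma solvable_within_iff_compliance_block:
  assumes f: "f \<in> carrier_vec n" and a: "\<forall>e. 0 \<le> scaled_design wbar rho len c $ e"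
  shows "solvable_within f cb (scaled_design wbar rho len c) \<longleftrightarrow>
    (\<forall>w\<in>carrier_vec (Suc n). 0 \<le> eval_at c (poly_qform (compliance_block cb f (scaled_stiffness wbar rho len K0 K)) w))"
proof
  assume "solvable_within f cb (scaled_design wbar rho len c)"
  then show "\<forall>w\<in>carrier_vec (Suc n). 0 \<le> eval_at c (poly_qform (compliance_block cb f (scaled_stiffness wbar rho len K0 K)) w)"
    unfolding eval_compliance_block[OF f] using solvable_within_block[OF f a] by simp
next
  assume *: "\<forall>w\<in>carrier_vec (Suc n). 0 \<le> eval_at c (poly_qform (compliance_block cb f (scaled_stiffness wbar rho len K0 K)) w)"
  show "solvable_within f cb (scaled_design wbar rho len c)"
  proof (rule solvable_withinI_block[OF f a])
    fix s :: real and v :: "real vec" assume v: "v \<in> carrier_vec n"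
    have "vec n (\<lambda>i. vec_index (vCons s v) (Suc i)) = v"
      using v by (intro eq_vecI) auto
    moreover have "vec_index (vCons s v) 0 = s" by simp
    moreover have "0 \<le> eval_at c (poly_qform (compliance_block cb f (scaled_stiffness wbar rho len K0 K)) (vCons s v))"
      using * v by simp
    ultimately show "0 \<le> cb * (s * s) - 2 * s * scalar_prod f v + qform (stiffness K0 K (scaled_design wbar rho len c)) v"
      by (simp only: eval_compliance_block[OF f])
  qed
qed

end

section \<open>The scaled problem and its relaxations\<close>

locale scaled_problem =
  fixes n_dof :: "'l::{finite,linorder} \<Rightarrow> nat"
    and f :: "'l \<Rightarrow> real vec"
    and cbar :: "'l \<Rightarrow> real"
    and rho len :: "'e::{finite,linorder} \<Rightarrow> real"
    and K0 :: "'l \<Rightarrow> real mat"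
    and K :: "'l \<Rightarrow> 'e \<Rightarrow> nat \<Rightarrow> real mat"
    and wbar :: real
  assumes f: "\<And>j. f j \<in> carrier_vec (n_dof j)"
    and rho_pos: "\<And>e. 0 < rho e"
    and len_pos: "\<And>e. 0 < len e"
    and wbar_pos: "0 < wbar"
    and model: "\<And>j. stiffness_model (n_dof j) (K0 j) (K j)"
begin

abbreviation "design \<equiv> scaled_design wbar rho len"

abbreviation "block j \<equiv> compliance_block (cbar j) (f j) (scaled_stiffness wbar rho len (K0 j) (K j))"

abbreviation "box_block e \<equiv> mat 1 1 (\<lambda>_. 1 - Var e ^ 2 :: 'e mpoly)"

definition blocks :: "'e mpoly mat list" where
  "blocks = map block (sorted_list_of_set UNIV) @ map box_block (sorted_list_of_set UNIV)"

definition G :: "'e mpoly mat" where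
  "G = diag_block_mat blocks"

lemma scaled_constraints_eq: "scaled_constraints wbar rho len f cbar K0 K = G"
  by (simp add: scaled_constraints_def G_def blocks_def)

lemma set_blocks: "set blocks = range block \<union> range box_block"
  by (simp add: blocks_def)

definition feasible :: "real ^ ('e::{finite,linorder}) \<Rightarrow> bool" where
  "feasible a \<longleftrightarrow> (\<forall>e. 0 \<le> a $ e) \<and>
     (\<forall>j. stiffness_model.solvable_within (n_dof j) (K0 j) (K j) (f j) (cbar j) a)"

text \<open>In terms of polynomial inequalities closedness is immediate; in terms of displacements
  it would not be.\<close>

definition feasible_scaled :: "(real ^ ('e::{finite,linorder})) set" where
  "feasible_scaled = {c\<in>unit_box. \<forall>j. \<forall>w\<in>carrier_vec (Suc (n_dof j)). 0 \<le> eval_at c (poly_qform (block j) w)}"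

lemma design_nonneg: "c \<in> unit_box \<Longrightarrow> 0 \<le> design c $ e"
  using rho_pos[of e] len_pos[of e] wbar_pos
  by (auto simp: scaled_design_def unit_box_def abs_le_iff intro!: mult_nonneg_nonneg divide_nonneg_nonneg)
    (smt (verit))

lemma feasible_scaled_iff: "c \<in> feasible_scaled \<longleftrightarrow> c \<in> unit_box \<and> feasible (design c)"
  using design_nonneg stiffness_model.solvable_within_iff_compliance_block[OF model f]
  unfolding feasible_scaled_def feasible_def by blast

lemma compact_feasible_scaled: "compact feasible_scaled"
proof -
  have "feasible_scaled = unit_box \<inter> (\<Inter>j. \<Inter>w\<in>carrier_vec (Suc (n_dof j)). {c. 0 \<le> eval_at c (poly_qform (block j) w)})"
    by (auto simp: feasible_scaled_def)
  moreover have "closed (\<Inter>j. \<Inter>w\<in>carrier_vec (Suc (n_dof j)). {c. 0 \<le> eval_at c (poly_qform (block j) w)})"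
    by (intro closed_INT ballI closed_Collect_le continuous_on_eval_at continuous_intros)
  ultimately show ?thesis
    by (simp add: compact_Int_closed compact_unit_box)
qed

lemma block_carrier: "block j \<in> carrier_mat (Suc (n_dof j)) (Suc (n_dof j))"
  by (rule stiffness_model.compliance_block_carrier[OF model f])

lemma blocks_square: "\<forall>B\<in>set blocks. dim_row B = dim_col B"
  using carrier_matD[OF block_carrier] by (auto simp: set_blocks)

lemma blocks_sym: "\<forall>B\<in>set blocks. transpose_mat B = B"
  using stiffness_model.compliance_block_sym[OF model f] by (auto simp: set_blocks intro!: eq_matI)

lemma G_carrier: "G \<in> carrier_mat (dim_row G) (dim_row G)"
  unfolding G_def by (rule diag_block_mat_carrier[OF blocks_square])

lemma poly_qform_box_block_1: "poly_qform (box_block e) (vec 1 (\<lambda>_. 1)) = 1 - Var e * Var e"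
  by (simp add: poly_qform_def power2_eq_square)

lemma poly_qform_box_block: "poly_qform (box_block e) v = Const (vec_index v 0 * vec_index v 0) * (1 - Var e * Var e)"
  by (simp add: poly_qform_def power2_eq_square)

lemma localizing_block_nonneg:
  assumes feas: "relaxation_feasible G r y" and B: "B \<in> set blocks" and v: "v \<in> carrier_vec (dim_row B)"
    and q: "\<And>m. m \<in> Poly_Mapping.keys q \<Longrightarrow> mdeg m \<le> (2 * r - mat_degree G) div 2"
  shows "0 \<le> Lfun y (q * q * poly_qform B v)"
proof -
  obtain w where w: "w \<in> carrier_vec (dim_row G)" "poly_qform G w = poly_qform B v"
    using ex_poly_qform_block[OF blocks_square B v] by (auto simp: G_def)
  have "psd_mat (map_mat (Lfun y) (kronecker_mat (monomial_products ((2 * r - mat_degree G) div 2)) G))"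
    using feas by (simp add: relaxation_feasible_def)
  from localizing_nonneg[OF this G_carrier w(1) q] show ?thesis
    by (simp add: w)
qed

lemma localizing_box_nonneg:
  assumes feas: "relaxation_feasible G r y"
    and q: "\<And>m. m \<in> Poly_Mapping.keys q \<Longrightarrow> mdeg m \<le> (2 * r - mat_degree G) div 2"
  shows "0 \<le> Lfun y (q * q * (1 - Var e * Var e))"
  by (rule localizing_block_nonneg[OF feas, of "box_block e" "vec 1 (\<lambda>_. 1)" q, unfolded poly_qform_box_block_1])
    (use q in \<open>auto simp: set_blocks\<close>)

lemma relaxation_feasible_moments:
  assumes feas: "relaxation_feasible G r y" and m: "mdeg m \<le> (2 * r - mat_degree G) div 2"
  shows "\<bar>y m\<bar> \<le> 1"
proof (rule abs_moment_le_1[OF _ _ _ m])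
  show "y 0 = 1" using feas by (simp add: relaxation_feasible_def)
  show "0 \<le> Lfun y (q * q * (1 - Var e * Var e))"
    if "\<And>k. k \<in> Poly_Mapping.keys q \<Longrightarrow> mdeg k \<le> (2 * r - mat_degree G) div 2" for q e
    using localizing_box_nonneg[OF feas that] .
  show "0 \<le> Lfun y (q * q)"
    if "\<And>k. k \<in> Poly_Mapping.keys q \<Longrightarrow> mdeg k \<le> (2 * r - mat_degree G) div 2" for q
  proof (rule moment_matrix_nonneg[where k = r])
    show "psd_mat (map_mat (Lfun y) (monomial_products r))"
      using feas by (simp add: relaxation_feasible_def)
    show "mdeg k \<le> r" if "k \<in> Poly_Mapping.keys q" for k
      using \<open>\<And>k. k \<in> Poly_Mapping.keys q \<Longrightarrow> mdeg k \<le> (2 * r - mat_degree G) div 2\<close>[OF that] by linarith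
  qed
qed

text \<open>Dirac moments of feasible points enter every relaxation, which makes the relaxation
  values lower bounds for the weight.\<close>

lemma relaxation_feasible_monom_value:
  assumes c: "c \<in> feasible_scaled"
  shows "relaxation_feasible G r (monom_value c)"
proof -
  have Gc: "map_mat (eval_at c) G \<in> carrier_mat (dim_row G) (dim_row G)"
    unfolding map_carrier_mat by (rule G_carrier)
  have "transpose_mat (map_mat (eval_at c) G) = map_mat (eval_at c) (transpose_mat G)"
    by (rule map_mat_transpose)
  also have "transpose_mat G = G"
    unfolding G_def by (rule diag_block_mat_symmetric[OF blocks_sym])
  finally have "transpose_mat (map_mat (eval_at c) G) = map_mat (eval_at c) G" .
  moreover have "0 \<le> qform (map_mat (eval_at c) G) w" if w: "w \<in> carrier_vec (dim_row G)" for w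
  proof -
    have "0 \<le> eval_at c (poly_qform B v)" if "B \<in> set blocks" "v \<in> carrier_vec (dim_row B)" for B v
      using that(1) unfolding set_blocks
    proof (elim UnE rangeE)
      fix j assume "B = block j"
      then show ?thesis
        using c that(2) carrier_matD[OF block_carrier[of j]] by (simp add: feasible_scaled_def)
    next
      fix e assume B: "B = box_block e"
      have "\<bar>c $ e\<bar> \<le> 1" using c by (simp add: feasible_scaled_def unit_box_def)
      then have "c $ e * c $ e \<le> 1"
        using abs_square_le_1[of "c $ e"] by (simp add: power2_eq_square)
      then show ?thesis
        unfolding B poly_qform_box_block by (simp add: eval_at_mult Lfun_diff)
    qed
    then have "0 \<le> eval_at c (poly_qform G w)"
      unfolding G_def by (intro Lfun_poly_qform_diag_nonneg[OF blocks_square]) (use w in \<open>auto simp: G_def\<close>)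
    then show ?thesis
      using Lfun_poly_qform[OF G_carrier w] by simp
  qed
  ultimately have "psd_mat (map_mat (eval_at c) G)"
    using psd_mat_iff[OF Gc] by blast
  then show ?thesis
    by (simp add: relaxation_feasible_def psd_eval_moment_matrix psd_eval_localizing_matrix[OF G_carrier])
qed

lemma weight_design: "weight rho len (design c) = 0.5 * wbar * (real CARD('e) + (\<Sum>e\<in>UNIV. c $ e))"
proof -
  have eq: "rho e * len e * design c $ e = 0.5 * wbar * (1 + c $ e)" for e
    using rho_pos[of e] len_pos[of e] by (simp add: scaled_design_def field_simps)
  show ?thesis
    by (simp only: weight_def eq sum_distrib_left[symmetric] sum.distrib) simp
qed

lemma Lfun_scaled_objective:
  fixes y :: "('e \<Rightarrow>\<^sub>0 nat) \<Rightarrow> real"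
  shows "y 0 = 1 \<Longrightarrow> Lfun y (scaled_objective wbar) = 0.5 * wbar * (real CARD('e) + (\<Sum>e\<in>UNIV. first_moment y e))"
  by (simp add: scaled_objective_def Lfun_Const_mult Lfun_add Lfun_sum Lfun_Var of_nat_eq_Const Lfun_Const)

lemma design_affine:
  assumes "u + v = 1"
  shows "design (u *\<^sub>R x + v *\<^sub>R y) = u *\<^sub>R design x + v *\<^sub>R design y"
proof (rule Finite_Cartesian_Product.vec_eq_iff[THEN iffD2], rule allI)
  fix e
  have "u * x $ e + v * y $ e + 1 = u * (x $ e + 1) + v * (y $ e + 1)"
    using assms by (simp add: algebra_simps)
  then have "(u * x $ e + v * y $ e + 1) / 2 * (wbar / (rho e * len e))
      = (u * (x $ e + 1) + v * (y $ e + 1)) / 2 * (wbar / (rho e * len e))"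
    by simp
  also have "\<dots> = u * ((x $ e + 1) / 2 * (wbar / (rho e * len e))) + v * ((y $ e + 1) / 2 * (wbar / (rho e * len e)))"
  proof -
    have "(u * A + v * B) / 2 * k = u * (A / 2 * k) + v * (B / 2 * k)" for A B k :: real
      by (simp add: field_simps)
    then show ?thesis .
  qed
  finally show "design (u *\<^sub>R x + v *\<^sub>R y) $ e = (u *\<^sub>R design x + v *\<^sub>R design y) $ e"
    by (simp add: scaled_design_def)
qed

text \<open>All terms of the weight are nonnegative, so a weight of at most \<open>wbar\<close>
  bounds each term and keeps the scaled coordinates at most 1.\<close>

lemma ex_scaled_preimage:
  assumes a: "feasible a" and w: "weight rho len a \<le> wbar"
  shows "\<exists>c\<in>feasible_scaled. design c = a"
proof -
  define c where "c = (\<chi> e. 2 * (rho e * len e * a $ e) / wbar - 1)"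
  have dc: "design c = a"
    using rho_pos len_pos wbar_pos
    by (intro Finite_Cartesian_Product.vec_eq_iff[THEN iffD2]) (simp add: scaled_design_def c_def field_simps less_imp_neq[symmetric])
  have nn: "0 \<le> rho e * len e * a $ e" for e
    using a rho_pos[of e] len_pos[of e] by (simp add: feasible_def)
  have "rho e * len e * a $ e \<le> wbar" for e
  proof -
    have "rho e * len e * a $ e \<le> weight rho len a"
      unfolding weight_def using nn by (intro member_le_sum) auto
    then show ?thesis using w by simp
  qed
  then have "c \<in> unit_box"
    using nn wbar_pos by (auto simp: unit_box_def c_def abs_le_iff field_simps)
  then show ?thesis
    using feasible_scaled_iff dc a by auto
qed

lemma global_minimizers_iff:
  "a \<in> global_minimizers rho len f cbar K0 K \<longleftrightarrow>
    feasible a \<and> (\<forall>b. feasible b \<longrightarrow> weight rho len a \<le> weight rho len b)"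
proof -
  have feas: "feasible b \<longleftrightarrow> (\<exists>u. design_feasible f cbar K0 K (b, u))" for b
  proof -
    have "(\<forall>j. stiffness_model.solvable_within (n_dof j) (K0 j) (K j) (f j) (cbar j) b) \<longleftrightarrow>
        (\<forall>j. \<exists>u. u \<in> carrier_vec (dim_vec (f j)) \<and> stiffness (K0 j) (K j) b *\<^sub>v u = f j
          \<and> 0 \<le> cbar j - scalar_prod (f j) u)"
      by (simp add: stiffness_model.solvable_within_def[OF model] carrier_vecD[OF f] Bex_def)
    also have "\<dots> \<longleftrightarrow> (\<exists>u. \<forall>j. u j \<in> carrier_vec (dim_vec (f j)) \<and> stiffness (K0 j) (K j) b *\<^sub>v u j = f j
          \<and> 0 \<le> cbar j - scalar_prod (f j) (u j))"
      by (rule choice_iff)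
    finally show ?thesis
      by (auto simp: feasible_def design_feasible_def)
  qed
  show ?thesis
    by (auto simp: global_minimizers_def is_arg_min_def feas not_less)
qed

lemma limit_moment_functional:
  assumes H: "H \<noteq> bot" "H \<le> sequentially"
    and feas: "\<forall>\<^sub>F r in sequentially. relaxation_feasible G r (y r)"
    and lim: "\<And>m. ((\<lambda>r. y r m) \<longlongrightarrow> z m) H"
  shows "moment_functional z" "z 0 = 1" "moment_functional.zeros z \<subseteq> feasible_scaled"
proof -
  \<comment> \<open>The order of the localizing matrix grows with \<open>r\<close>, so every fixed
    \<open>q\<close> is eventually an admissible test polynomial.\<close>
  have ev: "\<forall>\<^sub>F r in H. relaxation_feasible G r (y r) \<and> N \<le> (2 * r - mat_degree G) div 2" for N
  proof -
    have "\<forall>\<^sub>F r in sequentially. N \<le> (2 * r - mat_degree G) div 2"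
      using eventually_ge_at_top[of "N + mat_degree G"] by (rule eventually_mono) linarith
    then show ?thesis
      using filter_leD[OF H(2)] feas by (simp add: eventually_conj)
  qed
  have nonneg: "0 \<le> Lfun z (q * q * poly_qform B v)" if "B \<in> set blocks" "v \<in> carrier_vec (dim_row B)" for q B v
  proof (rule tendsto_lowerbound[OF tendsto_Lfun[OF lim] _ H(1)])
    show "\<forall>\<^sub>F r in H. 0 \<le> Lfun (y r) (q * q * poly_qform B v)"
      using ev[of "total_degree q"]
    proof (rule eventually_mono, elim conjE)
      fix r assume r: "relaxation_feasible G r (y r)" "total_degree q \<le> (2 * r - mat_degree G) div 2"
      have "mdeg m \<le> total_degree q" if "m \<in> Poly_Mapping.keys q" for m
        using that by (simp add: total_degree_def)
      then show "0 \<le> Lfun (y r) (q * q * poly_qform B v)"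
        using r that by (intro localizing_block_nonneg[of r]) (auto intro: order_trans)
    qed
  qed
  have sq: "0 \<le> Lfun z (q * q)" for q
  proof (rule tendsto_lowerbound[OF tendsto_Lfun[OF lim] _ H(1)])
    show "\<forall>\<^sub>F r in H. 0 \<le> Lfun (y r) (q * q)"
      using ev[of "total_degree q"]
    proof (rule eventually_mono, elim conjE)
      fix r assume r: "relaxation_feasible G r (y r)" "total_degree q \<le> (2 * r - mat_degree G) div 2"
      have "mdeg m \<le> r" if "m \<in> Poly_Mapping.keys q" for m
      proof -
        have "mdeg m \<le> total_degree q" using that by (simp add: total_degree_def)
        then show ?thesis using r(2) by linarith
      qed
      then show "0 \<le> Lfun (y r) (q * q)"
        using r by (intro moment_matrix_nonneg[where k = r]) (auto simp: relaxation_feasible_def)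
    qed
  qed
  show mf: "moment_functional z"
  proof
    show "0 \<le> Lfun z (q * q)" for q by (rule sq)
    show "0 \<le> Lfun z (q * q * (1 - Var e * Var e))" for q e
      by (rule nonneg[of "box_block e" "vec 1 (\<lambda>_. 1)" q, unfolded poly_qform_box_block_1])
        (auto simp: set_blocks)
  qed
  have "((\<lambda>r. y r 0) \<longlongrightarrow> 1) H"
    using ev[of 0] by (intro tendsto_eventually) (auto elim: eventually_mono simp: relaxation_feasible_def)
  with lim[of 0] show "z 0 = 1"
    using tendsto_unique[OF H(1)] by blast
  show "moment_functional.zeros z \<subseteq> feasible_scaled"
  proof
    fix c assume c: "c \<in> moment_functional.zeros z"
    have ge: "0 \<le> eval_at c g" if "\<And>q. 0 \<le> Lfun z (q * q * g)" for g
      using c that by (simp add: moment_functional.zeros_def[OF mf] moment_functional.cone_def[OF mf])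
    have "\<bar>c $ e\<bar> \<le> 1" for e
    proof -
      have "0 \<le> eval_at c (1 - Var e * Var e)"
        using moment_functional.box_nonneg[OF mf] by (intro ge)
      then show ?thesis
        using abs_square_le_1[of "c $ e"] by (simp add: Lfun_diff eval_at_mult power2_eq_square)
    qed
    moreover have "0 \<le> eval_at c (poly_qform (block j) w)" if "w \<in> carrier_vec (Suc (n_dof j))" for j w
      using that carrier_matD[OF block_carrier[of j]] by (intro ge nonneg) (auto simp: set_blocks)
    ultimately show "c \<in> feasible_scaled"
      by (simp add: feasible_scaled_def unit_box_def)
  qed
qed

lemma barycenter_in_convex_hull:
  assumes mf: "moment_functional z" and z0: "z 0 = 1" and zeros: "moment_functional.zeros z \<subseteq> feasible_scaled"
  shows "(\<chi> e. first_moment z e) \<in> convex hull feasible_scaled"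
proof (rule ccontr)
  let ?x = "\<chi> e. first_moment z e"
  assume "?x \<notin> convex hull feasible_scaled"
  moreover have "closed (convex hull feasible_scaled)"
    using compact_feasible_scaled compact_convex_hull compact_imp_closed by blast
  ultimately obtain a b where ab: "inner a ?x < b" "\<forall>c\<in>convex hull feasible_scaled. b < inner a c"
    using separating_hyperplane_closed_point[OF convex_convex_hull] by blast
  \<comment> \<open>The separating affine function as a polynomial: positive on
    \<open>zeros\<close>, but of negative value under \<open>Lfun z\<close>, where
    \<open>z 0 = 1\<close> preserves the constant term.\<close>
  define p where "p = (\<Sum>e\<in>UNIV. Const (a $ e) * Var e) - Const b"
  have "0 < eval_at c p" if "c \<in> moment_functional.zeros z" for c
  proof -
    have "eval_at c p = inner a c - b"
      by (simp add: p_def Lfun_diff Lfun_sum Lfun_Const_mult inner_vec_def)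
    then show ?thesis
      using ab(2) that zeros hull_subset[of feasible_scaled convex] by auto
  qed
  then have "0 \<le> Lfun z p"
    by (rule moment_functional.Lfun_nonneg_if_pos_on_zeros[OF mf])
  also have "Lfun z p = inner a ?x - b"
    by (simp add: p_def Lfun_diff Lfun_sum Lfun_Const_mult Lfun_Var Lfun_Const z0 inner_vec_def)
  finally show False using ab(1) by simp
qed

text \<open>Instead of decomposing \<open>x\<close>, a convex superset \<open>T\<close> of the
  feasible set is exhibited: the points strictly heavier than the optimum, together with the
  minimizers. Mixing in a strictly heavier point with positive coefficient stays strictly heavier,
  so the convexity assumption is used only among minimizers.\<close>

lemma minimizer_if_in_convex_hull:
  assumes conv: "convex (global_minimizers rho len f cbar K0 K)"
    and a: "a \<in> global_minimizers rho len f cbar K0 K"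
    and x: "x \<in> convex hull feasible_scaled" "weight rho len (design x) \<le> weight rho len a"
  shows "design x \<in> global_minimizers rho len f cbar K0 K"
proof -
  let ?M = "global_minimizers rho len f cbar K0 K"
  let ?w = "\<lambda>c. weight rho len (design c)"
  define X where "X = {c\<in>unit_box. design c \<in> ?M}"
  define T where "T = {c. weight rho len a < ?w c} \<union> X"
  have wX: "?w c = weight rho len a" if "c \<in> X" for c
    using that a by (auto simp: X_def global_minimizers_iff intro: antisym)
  then have wT: "weight rho len a \<le> ?w c" if "c \<in> T" for c
    using that by (auto simp: T_def)
  have w_affine: "?w (u *\<^sub>R c + v *\<^sub>R d) = u * ?w c + v * ?w d" if "u + v = 1" for u v c d
    by (simp add: design_affine[OF that] weight_def sum.distrib sum_distrib_left algebra_simps)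
  have "convex T"
  proof (rule convexI)
    fix c d and u v :: real
    assume cd: "c \<in> T" "d \<in> T" and uv: "0 \<le> u" "0 \<le> v" "u + v = 1"
    show "u *\<^sub>R c + v *\<^sub>R d \<in> T"
    proof (cases "u = 0 \<or> v = 0")
      case True
      then show ?thesis using cd uv by auto
    next
      case False
      then have uv': "0 < u" "0 < v" using uv by auto
      show ?thesis
      proof (cases "c \<in> X \<and> d \<in> X")
        case True
        then have "u *\<^sub>R c + v *\<^sub>R d \<in> unit_box"
          using convex_unit_box uv by (auto simp: X_def convex_def)
        moreover have "design (u *\<^sub>R c + v *\<^sub>R d) \<in> ?M"
          using True conv uv by (auto simp: design_affine X_def convex_def)
        ultimately show ?thesis by (simp add: T_def X_def)
      next
        case False
        then have "weight rho len a < ?w c \<or> weight rho len a < ?w d"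
          using cd by (auto simp: T_def)
        then have "u * weight rho len a + v * weight rho len a < u * ?w c + v * ?w d"
          using wT[OF cd(1)] wT[OF cd(2)] uv'
          by (elim disjE) (simp_all add: add_less_le_mono add_le_less_mono)
        then have "weight rho len a < ?w (u *\<^sub>R c + v *\<^sub>R d)"
          using uv by (simp add: w_affine flip: distrib_right)
        then show ?thesis by (simp add: T_def)
      qed
    qed
  qed
  moreover have "feasible_scaled \<subseteq> T"
  proof
    fix c assume c: "c \<in> feasible_scaled"
    then have "feasible (design c)" "c \<in> unit_box" by (auto simp: feasible_scaled_iff)
    then show "c \<in> T"
      using a by (force simp: T_def X_def global_minimizers_iff not_less)
  qed
  ultimately have "x \<in> T" using x(1) hull_minimal by blast
  then show ?thesis using x(2) by (simp add: T_def X_def)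
qed

lemma moment_design_eq: "moment_design wbar rho len y = design (\<chi> e. first_moment y e)"
  by (simp add: moment_design_def scaled_design_def)

lemma relaxation_value_le:
  assumes opt: "relaxation_optimal (scaled_objective wbar) G r y"
    and a: "feasible a" "weight rho len a \<le> wbar"
  shows "weight rho len (moment_design wbar rho len y) \<le> weight rho len a"
proof -
  obtain c where c: "c \<in> feasible_scaled" "design c = a"
    using ex_scaled_preimage[OF a] by blast
  have y: "relaxation_feasible G r y"
    using opt by (simp add: relaxation_optimal_def is_arg_min_def)
  then have "y 0 = 1" by (simp add: relaxation_feasible_def)
  have "Lfun y (scaled_objective wbar) \<le> eval_at c (scaled_objective wbar)"
    using opt relaxation_feasible_monom_value[OF c(1), of r]
    by (auto simp: relaxation_optimal_def is_arg_min_def not_less)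
  then show ?thesis
    using c(2) \<open>y 0 = 1\<close> weight_design[of c] weight_design[of "\<chi> e. first_moment y e"]
    by (simp add: Lfun_scaled_objective moment_design_eq)
qed

text \<open>Monotonicity of the compliance makes \<open>t\<close> feasible in the univariate
  problem, where \<open>\<delta>\<close> is minimal.\<close>

lemma univariate_solution_le:
  assumes sol: "univariate_solution f cbar K0 K a \<delta>" and "feasible b" and "0 < t"
    and le: "\<And>e. b $ e \<le> t * a $ e"
  shows "\<delta> \<le> t"
proof -
  have "compliance (f j) (K0 j) (K j) (t *\<^sub>R a) \<le> cbar j" for j
    using stiffness_model.compliance_le_if_solvable_below[OF model[of j] f[of j],
        where a = b and b = "t *\<^sub>R a" and c = "cbar j"] assms
    by (simp add: feasible_def)
  then show ?thesis
    using sol \<open>0 < t\<close> unfolding univariate_solution_def is_arg_min_def by (meson not_le)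
qed

text \<open>Some components of a limit design may vanish, and the compliance is not continuous there; but
  \<open>1 + \<epsilon>\<close> times a nearby nonnegative design dominates the limit componentwise, so monotonicity of
  the compliance suffices.\<close>

lemma eventually_univariate_solution_le:
  assumes conv: "convex (global_minimizers rho len f cbar K0 K)"
    and a: "a \<in> global_minimizers rho len f cbar K0 K" "weight rho len a \<le> wbar"
    and opt: "\<forall>\<^sub>F r in sequentially. relaxation_optimal (scaled_objective wbar) G r (y r)"
    and sol: "\<forall>\<^sub>F r in sequentially. univariate_solution f cbar K0 K (moment_design wbar rho len (y r)) (\<delta> r)"
    and \<epsilon>: "0 < \<epsilon>"
  shows "\<forall>\<^sub>F r in sequentially. \<delta> r \<le> 1 + \<epsilon>"
proof (rule ccontr)
  assume neg: "\<not> (\<forall>\<^sub>F r in sequentially. \<delta> r \<le> 1 + \<epsilon>)"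
  \<comment> \<open>The cluster point is taken along the orders that violate the bound, so the
    violation still holds eventually along \<open>H\<close>.\<close>
  define F where "F = inf sequentially (principal {r. 1 + \<epsilon> < \<delta> r})"
  have "F \<noteq> bot"
  proof
    assume "F = bot"
    then have "eventually (\<lambda>_. False) F" by simp
    then show False
      using neg by (simp add: F_def eventually_inf_principal not_less)
  qed
  have "F \<le> sequentially" by (simp add: F_def)
  have feas: "\<forall>\<^sub>F r in sequentially. relaxation_feasible G r (y r)"
    using opt by (rule eventually_mono) (simp add: relaxation_optimal_def is_arg_min_def)
  have bound: "\<forall>\<^sub>F r in sequentially. \<bar>y r m\<bar> \<le> 1" for m
    using feas eventually_ge_at_top[of "mdeg m + mat_degree G"]
    by eventually_elim (rule relaxation_feasible_moments, assumption, linarith)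
  have bound_F: "\<forall>\<^sub>F r in F. \<bar>y r m\<bar> \<le> 1" for m
    using filter_leD[OF \<open>F \<le> sequentially\<close> bound] .
  obtain z H where H: "H \<noteq> bot" "H \<le> F" and lim: "\<And>m. ((\<lambda>r. y r m) \<longlongrightarrow> z m) H"
    by (rule ex_pointwise_cluster_point[where y = y, OF \<open>F \<noteq> bot\<close> bound_F]) blast
  have Hs: "H \<le> sequentially" using H(2) \<open>F \<le> sequentially\<close> by (rule order_trans)
  note z = limit_moment_functional[OF H(1) Hs feas lim]
  define x where "x = (\<chi> e. first_moment z e)"
  have x: "x \<in> convex hull feasible_scaled"
    unfolding x_def by (rule barycenter_in_convex_hull[OF z])
  let ?d = "\<lambda>r. moment_design wbar rho len (y r)"
  have lim_d: "((\<lambda>r. ?d r $ e) \<longlongrightarrow> design x $ e) H" for e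
    unfolding moment_design_def scaled_design_def x_def first_moment_def
    using rho_pos[of e] len_pos[of e] by (simp, intro tendsto_intros lim) simp
  have "((\<lambda>r. weight rho len (?d r)) \<longlongrightarrow> weight rho len (design x)) H"
    unfolding weight_def by (intro tendsto_intros lim_d)
  moreover have "\<forall>\<^sub>F r in H. weight rho len (?d r) \<le> weight rho len a"
    using filter_leD[OF Hs opt] by (rule eventually_mono)
      (use a in \<open>auto intro: relaxation_value_le simp: global_minimizers_iff\<close>)
  ultimately have "weight rho len (design x) \<le> weight rho len a"
    using tendsto_upperbound H(1) by blast
  then have "design x \<in> global_minimizers rho len f cbar K0 K"
    by (rule minimizer_if_in_convex_hull[OF conv a(1) x])
  then have fx: "feasible (design x)" by (simp add: global_minimizers_iff)
  have "\<forall>\<^sub>F r in H. design x $ e \<le> (1 + \<epsilon>) * ?d r $ e" for e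
  \<comment> \<open>The factor \<open>1 + \<epsilon>\<close> gives a strict margin only at a
    positive limit component; at a zero component, nonnegativity of the approximating designs
    suffices.\<close>
  proof (cases "design x $ e = 0")
    case True
    have "\<forall>\<^sub>F r in H. \<bar>first_moment (y r) e\<bar> \<le> 1"
      unfolding first_moment_def using filter_leD[OF Hs bound] .
    then show ?thesis
    proof (rule eventually_mono)
      fix r assume "\<bar>first_moment (y r) e\<bar> \<le> 1"
      then have "0 \<le> ?d r $ e"
        using rho_pos[of e] len_pos[of e] wbar_pos by (simp add: moment_design_def)
      then show "design x $ e \<le> (1 + \<epsilon>) * ?d r $ e" using True \<epsilon> by simp
    qed
  next
    case False
    then have "0 < design x $ e" using fx by (simp add: feasible_def less_le)
    then have "design x $ e < (1 + \<epsilon>) * design x $ e" using \<epsilon> by simp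
    moreover have "((\<lambda>r. (1 + \<epsilon>) * ?d r $ e) \<longlongrightarrow> (1 + \<epsilon>) * design x $ e) H"
      by (intro tendsto_intros lim_d)
    ultimately have "\<forall>\<^sub>F r in H. design x $ e < (1 + \<epsilon>) * ?d r $ e"
      by (intro order_tendstoD(1))
    then show ?thesis by (rule eventually_mono) simp
  qed
  then have "\<forall>\<^sub>F r in H. \<forall>e. design x $ e \<le> (1 + \<epsilon>) * ?d r $ e"
    by (rule eventually_all_finite)
  moreover have "\<forall>\<^sub>F r in H. 1 + \<epsilon> < \<delta> r"
    by (rule filter_leD[OF H(2)]) (simp add: F_def eventually_inf_principal)
  moreover have "\<forall>\<^sub>F r in H. univariate_solution f cbar K0 K (?d r) (\<delta> r)"
    using filter_leD[OF Hs sol] .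
  ultimately have "\<forall>\<^sub>F r in H. False"
  proof eventually_elim
    case (elim r)
    then have "\<delta> r \<le> 1 + \<epsilon>"
      using \<epsilon> by (intro univariate_solution_le[OF elim(3) fx]) auto
    with elim(2) show False by simp
  qed
  with H(1) show False by (simp add: trivial_limit_def)
qed

end

section \<open>The vanishing gap between upper and lower bounds\<close>

theorem theorem3:
  fixes n_dof :: "'l::{finite,linorder} \<Rightarrow> nat"
    and f :: "'l \<Rightarrow> real vec"
    and cbar :: "'l \<Rightarrow> real"
    and rho len :: "'e::{finite,linorder} \<Rightarrow> real"
    and K0 :: "'l \<Rightarrow> real mat"
    and K :: "'l \<Rightarrow> 'e \<Rightarrow> nat \<Rightarrow> real mat"
    and a_hat :: "real ^ ('e::{finite,linorder})"
    and delta_hat wbar :: real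
    and G :: "'e mpoly mat"
    and y :: "nat \<Rightarrow> ('e \<Rightarrow>\<^sub>0 nat) \<Rightarrow> real"
    and a_tilde :: "nat \<Rightarrow> real ^ ('e::{finite,linorder})"
    and delta_star :: "nat \<Rightarrow> real"
  assumes n_dof_pos: "\<And>j. 0 < n_dof j"
    and f: "\<And>j. f j \<in> carrier_vec (n_dof j)" "\<And>j. f j \<noteq> 0\<^sub>v (n_dof j)"
    and cbar_pos: "\<And>j. 0 < cbar j"
    and rho_pos: "\<And>e. 0 < rho e"
    and len_pos: "\<And>e. 0 < len e"
    and K0: "\<And>j. K0 j \<in> carrier_mat (n_dof j) (n_dof j)" "\<And>j. psd_mat (K0 j)"
    and K: "\<And>j e i. i \<in> {1..3} \<Longrightarrow> K j e i \<in> carrier_mat (n_dof j) (n_dof j)"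
           "\<And>j e i. i \<in> {1..3} \<Longrightarrow> psd_mat (K j e i)"
    and stiffness_pd: "\<And>a j. (\<forall>e. 0 < a $ e) \<Longrightarrow> pd_mat (stiffness (K0 j) (K j) a)"
    and a_hat_pos: "\<And>e. 0 < a_hat $ e"
    and delta_hat: "univariate_solution f cbar K0 K a_hat delta_hat"
    and wbar: "wbar = delta_hat * weight rho len a_hat"
    and G: "G = scaled_constraints wbar rho len f cbar K0 K"
    and y_optimal: "\<And>r. mat_degree G \<le> 2 * r \<Longrightarrow>
           relaxation_optimal (scaled_objective wbar) G r (y r)"
    and a_tilde: "\<And>r. a_tilde r = moment_design wbar rho len (y r)"
    and compliance_defined: "\<And>r j. mat_degree G \<le> 2 * r \<Longrightarrow>
           f j \<in> mat_image (stiffness (K0 j) (K j) (a_tilde r))"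
    and compliance_inf: "\<And>r j. mat_degree G \<le> 2 * r \<Longrightarrow>
           (INF \<delta>\<in>{0<..}. compliance (f j) (K0 j) (K j) (\<delta> *\<^sub>R a_tilde r)) < cbar j"
    and solvable: "global_minimizers rho len f cbar K0 K \<noteq> {}"
    and delta_star: "\<And>r. mat_degree G \<le> 2 * r \<Longrightarrow>
           univariate_solution f cbar K0 K (a_tilde r) (delta_star r)"
    and convex_minimizers: "convex (global_minimizers rho len f cbar K0 K)"
  shows "(\<lambda>r. (delta_star r - 1) *
            (0.5 * wbar * (real CARD('e) + (\<Sum>e\<in>UNIV. first_moment (y r) e)))) \<longlonglongrightarrow> 0"
proof -
  have model: "stiffness_model (n_dof j) (K0 j) (K j)" for j
    using K0 K by unfold_locales auto
  have dhat_pos: "0 < delta_hat"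
    and dhat: "\<And>j. compliance (f j) (K0 j) (K j) (delta_hat *\<^sub>R a_hat) \<le> cbar j"
    using delta_hat by (auto simp: univariate_solution_def is_arg_min_def)
  have "0 < weight rho len a_hat"
    unfolding weight_def using rho_pos len_pos a_hat_pos by (intro sum_pos) auto
  then have wbar_pos: "0 < wbar" using dhat_pos by (simp add: wbar)
  interpret scaled_problem n_dof f cbar rho len K0 K wbar
    by (rule scaled_problem.intro[OF f(1) rho_pos len_pos wbar_pos model])
  have weight_scale: "weight rho len (t *\<^sub>R b) = t * weight rho len b" for t b
    by (simp add: weight_def sum_distrib_left ac_simps)
  obtain a where a: "a \<in> global_minimizers rho len f cbar K0 K"
    using solvable by blast
  \<comment> \<open>This design certifies that \<open>wbar\<close> bounds the optimal weight, so the
    box cuts off no minimizer. Positive definiteness at \<open>a_hat\<close> provides the image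
    condition.\<close>
  have "feasible (delta_hat *\<^sub>R a_hat)"
  proof -
    have "f j \<in> mat_image (stiffness (K0 j) (K j) a_hat)" for j
    proof -
      interpret stiffness_model "n_dof j" "K0 j" "K j" by (rule model)
      let ?A = "stiffness (K0 j) (K j) a_hat"
      have "pd_mat ?A" using a_hat_pos by (intro stiffness_pd) simp
      have "w = 0\<^sub>v (n_dof j)" if w: "w \<in> carrier_vec (n_dof j)" "?A *\<^sub>v w = 0\<^sub>v (n_dof j)" for w
      proof (rule ccontr)
        assume "w \<noteq> 0\<^sub>v (n_dof j)"
        then have "0 < qform ?A w"
          using \<open>pd_mat ?A\<close> w(1) unfolding pd_mat_def carrier_matD(1)[OF stiffness_carrier[of a_hat]] by blast
        then show False using w by simp
      qed
      then have "scalar_prod (f j) w = 0" if "w \<in> carrier_vec (n_dof j)" "?A *\<^sub>v w = 0\<^sub>v (n_dof j)" for w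
        using that f(1)[of j] by fastforce
      from pinv_solves[OF stiffness_carrier stiffness_symmetric f(1)[of j] this]
      show ?thesis
        unfolding mat_image_def using carrier_matD[OF stiffness_carrier[of a_hat]] by (metis imageI)
    qed
    then show ?thesis
      using stiffness_model.solvable_withinI_compliance[OF model f(1) _ dhat_pos _ dhat] a_hat_pos dhat_pos
      by (auto simp: feasible_def less_imp_le)
  qed
  then have a_wbar: "weight rho len a \<le> wbar"
    using a by (auto simp: global_minimizers_iff wbar weight_scale)
  have G': "G = scaled_problem.G f cbar rho len K0 K wbar"
    using scaled_constraints_eq G by simp
  have opt: "\<forall>\<^sub>F r in sequentially. relaxation_optimal (scaled_objective wbar) G r (y r)"
    using eventually_ge_at_top[of "mat_degree G"] by (rule eventually_mono) (auto intro: y_optimal)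
  have sol: "\<forall>\<^sub>F r in sequentially. univariate_solution f cbar K0 K (a_tilde r) (delta_star r)"
    using eventually_ge_at_top[of "mat_degree G"] by (rule eventually_mono) (auto intro: delta_star)
  define w where "w r = weight rho len (a_tilde r)" for r
  have w_eq: "0.5 * wbar * (real CARD('e) + (\<Sum>e\<in>UNIV. first_moment (y r) e)) = w r" for r
    using weight_design[of "\<chi> e. first_moment (y r) e"] by (simp add: w_def a_tilde moment_design_eq)
  have w_le: "\<forall>\<^sub>F r in sequentially. w r \<le> weight rho len a"
    using opt by (rule eventually_mono)
      (use a a_wbar in \<open>auto simp: w_def a_tilde G' global_minimizers_iff intro: relaxation_value_le\<close>)
  \<comment> \<open>First moments have degree 1, and the threshold \<open>1 + mat_degree G\<close>
    ensures \<open>1 \<le> (2 * r - mat_degree G) div 2\<close>.\<close>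
  have nonneg: "\<forall>\<^sub>F r in sequentially. \<forall>e. 0 \<le> a_tilde r $ e"
    using opt eventually_ge_at_top[of "1 + mat_degree G"]
  proof eventually_elim
    case (elim r)
    have "\<bar>first_moment (y r) e\<bar> \<le> 1" for e
      unfolding first_moment_def
      by (rule relaxation_feasible_moments)
        (use elim in \<open>auto simp: relaxation_optimal_def is_arg_min_def G' mdeg_single\<close>)
    then show ?case
      using rho_pos len_pos wbar_pos
      by (auto simp: a_tilde moment_design_def abs_le_iff less_imp_le intro!: mult_nonneg_nonneg divide_nonneg_nonneg)
        (smt (verit))
  qed
  \<comment> \<open>Only the product is bounded below: \<open>delta_star r * w r\<close> is the
    weight of a feasible design, hence at least the optimum, which in turn is at least
    \<open>w r\<close>.\<close>
  have lower: "\<forall>\<^sub>F r in sequentially. 0 \<le> (delta_star r - 1) * w r"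
    using w_le nonneg eventually_ge_at_top[of "mat_degree G"]
  proof eventually_elim
    case (elim r)
    have ds: "0 < delta_star r" "\<And>j. compliance (f j) (K0 j) (K j) (delta_star r *\<^sub>R a_tilde r) \<le> cbar j"
      using delta_star[of r] elim(3) by (auto simp: univariate_solution_def is_arg_min_def)
    have "feasible (delta_star r *\<^sub>R a_tilde r)"
      using stiffness_model.solvable_withinI_compliance[OF model f(1) elim(2) ds(1) compliance_defined ds(2)]
        elim ds by (simp add: feasible_def)
    then have "weight rho len a \<le> delta_star r * w r"
      using a by (auto simp: global_minimizers_iff weight_scale w_def)
    then show ?case using elim(1) by (simp add: algebra_simps)
  qed
  have "(\<lambda>r. (delta_star r - 1) * w r) \<longlonglongrightarrow> 0"
  proof (rule tendstoI)
    fix \<epsilon> :: real assume "0 < \<epsilon>"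
    \<comment> \<open>The summand 1 keeps the denominator positive even for an optimal weight of 0,
      and makes the second inequality strict.\<close>
    define \<eta> where "\<eta> = \<epsilon> / (\<bar>weight rho len a\<bar> + 1)"
    have \<eta>: "0 < \<eta>" "\<eta> * \<bar>weight rho len a\<bar> < \<epsilon>"
      using \<open>0 < \<epsilon>\<close> by (auto simp: \<eta>_def field_simps)
    have upper: "\<forall>\<^sub>F r in sequentially. delta_star r \<le> 1 + \<eta>"
      using eventually_univariate_solution_le[OF convex_minimizers a a_wbar _ _ \<eta>(1), of y delta_star] opt sol
      by (simp add: G' a_tilde)
    show "\<forall>\<^sub>F r in sequentially. dist ((delta_star r - 1) * w r) 0 < \<epsilon>"
      using upper lower w_le nonneg
    proof eventually_elim
      case (elim r)
      have "0 \<le> w r"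
        unfolding w_def weight_def using elim(4) rho_pos len_pos
        by (intro sum_nonneg mult_nonneg_nonneg) (auto simp: less_imp_le)
      then have "(delta_star r - 1) * w r \<le> \<eta> * w r"
        using elim(1) by (intro mult_right_mono) auto
      also have "\<dots> \<le> \<eta> * \<bar>weight rho len a\<bar>"
        using \<eta>(1) elim(3) by (intro mult_left_mono) auto
      finally show ?case using elim(2) \<eta>(2) by simp
    qed
  qed
  then show ?thesis by (simp only: w_eq)
qed

end
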